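(* Let $\mathcal{L}$ be a polar space. A function $f:\mathcal{L}\to\mathbf{R}\cup\{\infty\}$ is submodular if and only if its Lovász extension $\overline f:K(\mathcal{L})\to\mathbf{R}\cup\{\infty\}$ is convex.
   Context: $\mathcal{S}_2=\{-1,0,1\}$ is the poset with minimum $0$ and incomparable $-1,1$; $\mathcal{S}_2^n$ has the componentwise order. A polar space of rank $n$ is a meet-semilattice $\mathcal{L}$ that is a union of subsemilattices (polar frames) such that (P0) each polar frame is isomorphic to $\mathcal{S}_2^n$; (P1) any two chains lie in a common polar frame; (P2) if polar frames $\mathcal{F},\mathcal{F}'$ both contain chains $C,D$, there is an isomorphism $\mathcal{F}\to\mathcal{F}'$ fixing $C,D$ pointwise. It is a modular semilattice (meet-semilattice of finite rank with rank $r$, principal ideals modular lattices, $x\vee y\vee z$ exists whenever the pairwise joins exist), graded by $r$. Submodularity: for $p,q$ let $I(p,q)$ be the elements on shortest $p$–$q$ paths of the covering graph; $r(u;p,q)=(r(u\wedge p)-r(p\wedge q),r(u\wedge q)-r(p\wedge q))$; $\mathcal{E}(p,q)$ the $u\in I(p,q)$ with $r(u;p,q)$ a componentwise-maximal extreme point of the convex hull $\mathrm{Conv}I(p,q)$; $C(u;p,q)=\{w\in\mathbf{R}^2_{\ge0}:\langle w,r(u;p,q)\rangle=\max_{z\in\mathrm{Conv}I(p,q)}\langle w,z\rangle\}=\{(x,y)\ge0:y\cos\alpha\le x\sin\alpha,\ y\cos\beta\ge x\sin\beta\}$ ($0\le\beta\le\alpha\le\pi/2$), $[C]=\frac{\sin\alpha}{\sin\alpha+\cos\alpha}-\frac{\sin\beta}{\sin\beta+\cos\beta}$.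 $f$ is submodular if $f(p)+f(q)\ge f(p\wedge q)+\sum_{u\in\mathcal{E}(p,q)}[C(u;p,q)]f(u)$ for all $p,q$ (zero-coefficient terms omitted; $a+\infty=\infty$). Orthoscheme complex: $K(\mathcal{L})$ is the set of formal convex combinations $\sum\lambda_ip_i$ supported on chains; a chain $p_0\prec\dots\prec p_k$ gives a simplex mapped by $\varphi(\sum\lambda_ip_i)=\sum_{i\ge1}\lambda_i(e_1+\dots+e_{r(p_i)-r(p_0)})$ into Euclidean space, with distance $\|\varphi(x)-\varphi(y)\|_2$ inside the simplex; $K(\mathcal{L})$ carries the induced length metric (infimum over continuous paths of $\sup\sum d_{\sigma_i}(\gamma(t_i),\gamma(t_{i+1}))$ over partitions with pieces inside simplices), a geodesic metric. $\overline f(\sum\lambda_ip_i)=\sum\lambda_if(p_i)$. $F$ is convex if $F(\gamma(t))\le(1-t)F(\gamma(0))+tF(\gamma(1))$ for every geodesic $\gamma:[0,1]\to K(\mathcal{L})$ and $t\in[0,1]$. *)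

theory Defs
  imports "HOL-Analysis.Analysis"
begin

text \<open>A poset is a carrier set L inside a type of class order (order = restriction).\<close>

definition is_glb :: "'a::order set \<Rightarrow> 'a \<Rightarrow> 'a \<Rightarrow> 'a \<Rightarrow> bool" where
  "is_glb L x y m \<longleftrightarrow> m \<in> L \<and> m \<le> x \<and> m \<le> y \<and> (\<forall>z\<in>L. z \<le> x \<and> z \<le> y \<longrightarrow> z \<le> m)"

definition meet_semilattice :: "'a::order set \<Rightarrow> bool" where
  "meet_semilattice L \<longleftrightarrow> (\<forall>x\<in>L. \<forall>y\<in>L. \<exists>m. is_glb L x y m)"

definition meet :: "'a::order set \<Rightarrow> 'a \<Rightarrow> 'a \<Rightarrow> 'a" where
  "meet L x y = (THE m. is_glb L x y m)"

definition is_chain :: "'a::order set \<Rightarrow> 'a set \<Rightarrow> bool" where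
  "is_chain L C \<longleftrightarrow> C \<subseteq> L \<and> (\<forall>x\<in>C. \<forall>y\<in>C. x \<le> y \<or> y \<le> x)"

definition order_iso :: "'a set \<Rightarrow> ('a \<Rightarrow> 'a \<Rightarrow> bool) \<Rightarrow> 'b set \<Rightarrow> ('b \<Rightarrow> 'b \<Rightarrow> bool)
    \<Rightarrow> ('a \<Rightarrow> 'b) \<Rightarrow> bool" where
  "order_iso A leA B leB h \<longleftrightarrow> bij_betw h A B \<and> (\<forall>x\<in>A. \<forall>y\<in>A. leA x y \<longleftrightarrow> leB (h x) (h y))"

text \<open>Elements of S_2^n: vectors v indexed by 0..n-1 with entries in {-1,0,1}
  (extended by 0 outside). Componentwise order of S_2 = {-1,0,1}: 0 is the minimum,
  -1 and 1 are incomparable.\<close>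

definition S2n :: "nat \<Rightarrow> (nat \<Rightarrow> int) set" where
  "S2n n = {v. (\<forall>i<n. v i \<in> {-1, 0, 1}) \<and> (\<forall>i\<ge>n. v i = 0)}"

definition S2_le :: "(nat \<Rightarrow> int) \<Rightarrow> (nat \<Rightarrow> int) \<Rightarrow> bool" where
  "S2_le v w \<longleftrightarrow> (\<forall>i. v i = 0 \<or> v i = w i)"

definition polar_space_frames :: "'a::order set \<Rightarrow> nat \<Rightarrow> 'a set set \<Rightarrow> bool" where
  "polar_space_frames L n \<F> \<longleftrightarrow>
     meet_semilattice L \<and> \<Union>\<F> = L \<and>
     (\<forall>F\<in>\<F>. F \<subseteq> L \<and> (\<forall>x\<in>F. \<forall>y\<in>F. meet L x y \<in> F)) \<and>
     \<comment> \<open>(P0)\<close>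
     (\<forall>F\<in>\<F>. \<exists>h. order_iso F (\<le>) (S2n n) S2_le h) \<and>
     \<comment> \<open>(P1)\<close>
     (\<forall>C D. is_chain L C \<longrightarrow> is_chain L D \<longrightarrow> (\<exists>F\<in>\<F>. C \<union> D \<subseteq> F)) \<and>
     \<comment> \<open>(P2)\<close>
     (\<forall>F\<in>\<F>. \<forall>F'\<in>\<F>. \<forall>C D. is_chain L C \<longrightarrow> is_chain L D \<longrightarrow> C \<union> D \<subseteq> F \<longrightarrow> C \<union> D \<subseteq> F'
        \<longrightarrow> (\<exists>h. order_iso F (\<le>) F' (\<le>) h \<and> (\<forall>x\<in>C \<union> D. h x = x)))"

definition polar_space :: "'a::order set \<Rightarrow> nat \<Rightarrow> bool" where
  "polar_space L n \<longleftrightarrow> (\<exists>\<F>. polar_space_frames L n \<F>)"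

definition rk :: "'a::order set \<Rightarrow> 'a \<Rightarrow> nat" where
  "rk L p = (SUP C \<in> {C. finite C \<and> C \<noteq> {} \<and> is_chain L C \<and> (\<forall>x\<in>C. x \<le> p)}. card C) - 1"

definition covers :: "'a::order set \<Rightarrow> 'a \<Rightarrow> 'a \<Rightarrow> bool" where
  "covers L x y \<longleftrightarrow> x \<in> L \<and> y \<in> L \<and> x < y \<and> \<not> (\<exists>z\<in>L. x < z \<and> z < y)"

definition cover_walk :: "'a::order set \<Rightarrow> 'a list \<Rightarrow> bool" where
  "cover_walk L xs \<longleftrightarrow> xs \<noteq> [] \<and> set xs \<subseteq> L \<and>
     (\<forall>i. Suc i < length xs \<longrightarrow> covers L (xs!i) (xs!Suc i) \<or> covers L (xs!Suc i) (xs!i))"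

definition shortest_path :: "'a::order set \<Rightarrow> 'a \<Rightarrow> 'a \<Rightarrow> 'a list \<Rightarrow> bool" where
  "shortest_path L p q xs \<longleftrightarrow> cover_walk L xs \<and> hd xs = p \<and> last xs = q \<and>
     (\<forall>ys. cover_walk L ys \<and> hd ys = p \<and> last ys = q \<longrightarrow> length xs \<le> length ys)"

definition Ipq :: "'a::order set \<Rightarrow> 'a \<Rightarrow> 'a \<Rightarrow> 'a set" where
  "Ipq L p q = {u. \<exists>xs. shortest_path L p q xs \<and> u \<in> set xs}"

definition rvec :: "'a::order set \<Rightarrow> 'a \<Rightarrow> 'a \<Rightarrow> 'a \<Rightarrow> real \<times> real" where
  "rvec L p q u = (real (rk L (meet L u p)) - real (rk L (meet L p q)),
                   real (rk L (meet L u q)) - real (rk L (meet L p q)))"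

definition ConvI :: "'a::order set \<Rightarrow> 'a \<Rightarrow> 'a \<Rightarrow> (real \<times> real) set" where
  "ConvI L p q = convex hull (rvec L p q ` Ipq L p q)"

definition compwise_maximal :: "(real \<times> real) set \<Rightarrow> real \<times> real \<Rightarrow> bool" where
  "compwise_maximal S z \<longleftrightarrow> z \<in> S \<and>
     \<not> (\<exists>w\<in>S. w \<noteq> z \<and> fst z \<le> fst w \<and> snd z \<le> snd w)"

definition Epq :: "'a::order set \<Rightarrow> 'a \<Rightarrow> 'a \<Rightarrow> 'a set" where
  "Epq L p q = {u \<in> Ipq L p q. rvec L p q u extreme_point_of ConvI L p q \<and>
                               compwise_maximal (ConvI L p q) (rvec L p q u)}"

definition Cone :: "'a::order set \<Rightarrow> 'a \<Rightarrow> 'a \<Rightarrow> 'a \<Rightarrow> (real \<times> real) set" where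
  "Cone L p q u = {w. 0 \<le> fst w \<and> 0 \<le> snd w \<and>
      w \<bullet> rvec L p q u = (SUP z \<in> ConvI L p q. w \<bullet> z)}"

definition sector :: "real \<Rightarrow> real \<Rightarrow> (real \<times> real) set" where
  "sector \<alpha> \<beta> = {(x, y). 0 \<le> x \<and> 0 \<le> y \<and> y * cos \<alpha> \<le> x * sin \<alpha> \<and> y * cos \<beta> \<ge> x * sin \<beta>}"

definition sector_ok :: "(real \<times> real) set \<Rightarrow> real \<times> real \<Rightarrow> bool" where
  "sector_ok C ab \<longleftrightarrow> 0 \<le> snd ab \<and> snd ab \<le> fst ab \<and> fst ab \<le> pi / 2 \<and> C = sector (fst ab) (snd ab)"

text \<open>[C] for a cone C given as sector(alpha,beta); set to 0 if C is not of that form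
  (such terms have zero coefficient and are omitted).\<close>
definition cone_weight :: "(real \<times> real) set \<Rightarrow> real" where
  "cone_weight C = (if \<exists>ab. sector_ok C ab then
      (let (\<alpha>, \<beta>) = (SOME ab. sector_ok C ab) in
        sin \<alpha> / (sin \<alpha> + cos \<alpha>) - sin \<beta> / (sin \<beta> + cos \<beta>))
    else 0)"

definition submodular :: "'a::order set \<Rightarrow> ('a \<Rightarrow> ereal) \<Rightarrow> bool" where
  "submodular L f \<longleftrightarrow> (\<forall>p\<in>L. \<forall>q\<in>L.
     f p + f q \<ge> f (meet L p q) +
       (\<Sum>u \<in> {u \<in> Epq L p q. cone_weight (Cone L p q u) \<noteq> 0}.
           ereal (cone_weight (Cone L p q u)) * f u))"

text \<open>A point of K(L): a formal convex combination, i.e. a nonnegative real weight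
  function with finite support, summing to 1, whose support is a chain of L.\<close>

definition supp :: "('a \<Rightarrow> real) \<Rightarrow> 'a set" where
  "supp x = {p. x p \<noteq> 0}"

definition Kpts :: "'a::order set \<Rightarrow> ('a \<Rightarrow> real) set" where
  "Kpts L = {x. finite (supp x) \<and> is_chain L (supp x) \<and> (\<forall>p. 0 \<le> x p) \<and> sum x (supp x) = 1}"

definition chain_min :: "'a::order set \<Rightarrow> 'a" where
  "chain_min C = (THE b. b \<in> C \<and> (\<forall>c\<in>C. b \<le> c))"

text \<open>The map phi of the simplex of the chain C (minimum p0) into R^n:
  sum over p in C of x(p) (e_1 + ... + e_{r(p)-r(p0)}); coordinate j (0-based) is e_{j+1}.\<close>
definition phi :: "'a::order set \<Rightarrow> 'a set \<Rightarrow> ('a \<Rightarrow> real) \<Rightarrow> nat \<Rightarrow> real" where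
  "phi L C x j = (\<Sum>p\<in>{p \<in> C. j < rk L p - rk L (chain_min C)}. x p)"

text \<open>Euclidean distance inside a common simplex (the smallest one, spanned by supp x \<union> supp y).\<close>
definition simplex_dist :: "nat \<Rightarrow> 'a::order set \<Rightarrow> ('a \<Rightarrow> real) \<Rightarrow> ('a \<Rightarrow> real) \<Rightarrow> real" where
  "simplex_dist n L x y =
     (let C = supp x \<union> supp y in sqrt (\<Sum>j<n. (phi L C x j - phi L C y j)\<^sup>2))"

definition same_simplex :: "'a::order set \<Rightarrow> ('a \<Rightarrow> real) \<Rightarrow> ('a \<Rightarrow> real) \<Rightarrow> bool" where
  "same_simplex L x y \<longleftrightarrow> x \<in> Kpts L \<and> y \<in> Kpts L \<and> is_chain L (supp x \<union> supp y)"

definition Kdist :: "nat \<Rightarrow> 'a::order set \<Rightarrow> ('a \<Rightarrow> real) \<Rightarrow> ('a \<Rightarrow> real) \<Rightarrow> real" where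
  "Kdist n L x y = Inf {(\<Sum>i<length xs - 1. simplex_dist n L (xs!i) (xs!Suc i)) | xs.
      xs \<noteq> [] \<and> hd xs = x \<and> last xs = y \<and>
      (\<forall>i. Suc i < length xs \<longrightarrow> same_simplex L (xs!i) (xs!Suc i))}"

definition geodesic :: "nat \<Rightarrow> 'a::order set \<Rightarrow> (real \<Rightarrow> ('a \<Rightarrow> real)) \<Rightarrow> bool" where
  "geodesic n L \<gamma> \<longleftrightarrow> (\<forall>t\<in>{0..1}. \<gamma> t \<in> Kpts L) \<and>
     (\<forall>s\<in>{0..1}. \<forall>t\<in>{0..1}. Kdist n L (\<gamma> s) (\<gamma> t) = \<bar>s - t\<bar> * Kdist n L (\<gamma> 0) (\<gamma> 1))"

definition K_convex :: "nat \<Rightarrow> 'a::order set \<Rightarrow> (('a \<Rightarrow> real) \<Rightarrow> ereal) \<Rightarrow> bool" where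
  "K_convex n L F \<longleftrightarrow> (\<forall>\<gamma>. geodesic n L \<gamma> \<longrightarrow>
     (\<forall>t\<in>{0..1}. F (\<gamma> t) \<le> ereal (1 - t) * F (\<gamma> 0) + ereal t * F (\<gamma> 1)))"

definition lovasz :: "('a \<Rightarrow> ereal) \<Rightarrow> ('a \<Rightarrow> real) \<Rightarrow> ereal" where
  "lovasz f x = (\<Sum>p\<in>supp x. ereal (x p) * f p)"

end

theory Submission
  imports Defs
begin

text \<open>
  A frame identifies its part of the orthoscheme complex with the cube [-1,1]^n, and the
  frame elements with the sign vectors in it. Retractions of the whole space onto a frame
  (centred at a chamber) never increase lengths; hence frames are isometrically embedded and, by
  strict convexity of the Euclidean norm, geodesics are unique, namely the straight segments in
  any frame containing their endpoints.

  For p, q in a frame, the maximal extreme points of the interval are attained exactly at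
  u = (p completed by q) and u' = (q completed by p), with weights 1/2 each (or u = u' with weight
  1): u is the largest element in the support of the geodesic from p to q near p, which makes it
  independent of the frame. The resulting inequality
  f(p) + f(q) \<ge> f(p \<and> q) + (f(u) + f(u')) / 2 is equivalent on a frame to bisubmodularity
  f(p) + f(q) \<ge> f(p \<and> q) + f(p \<squnion> q), where opposite signs cancel in p \<squnion> q.
  Bisubmodularity is convexity at the midpoint of p and q; conversely it allows one to uncross any
  convex representation of a point of the cube into the one supported on a chain, so the
  Lovasz extension is the lower convex envelope of f on every frame.
\<close>

section \<open>The poset of sign vectors\<close>

text \<open>Frames are related only by order isomorphisms, so metric data must first be recovered
  from the order. The inner product of two sign vectors qualifies: it is determined by how many
  elements lie below p, below both p and q, and below p while being bounded together with q. Two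
  frames through p and q are isomorphic over p and q, so this yields one function \<open>ip\<close>
  on the whole space, and its Gram matrices replace coordinates wherever two frames are compared. A
  retraction then needs no gluing: along a complete flag c, coordinate i of z is
  \<open>ip z (c (Suc i)) - ip z (c i)\<close>, which makes sense for every z. The obstacle in
  computing the extreme points is that the metric interval of p and q need not lie in a frame
  containing p and q; retractions bound the ranks of its elements. The weights are halves because
  the two extreme points differ by a multiple of (1, -1), the factor being the number of opposite
  signs, so their cones meet on the diagonal.\<close>

definition nz :: "(nat \<Rightarrow> int) \<Rightarrow> nat set" where
  "nz v = {i. v i \<noteq> 0}"

lemma finite_S2n: "finite (S2n n)"
proof -
  have "S2n n = {v. \<forall>i. (i \<in> {..<n} \<longrightarrow> v i \<in> {-1,0,1}) \<and> (i \<notin> {..<n} \<longrightarrow> v i = 0)}"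
    unfolding S2n_def by (rule Collect_cong) (simp only: lessThan_iff not_less, blast)
  then show ?thesis
    using finite_set_of_finite_funs[of "{..<n}" "{-1,0,1::int}" 0] by (simp only: finite_lessThan finite.intros)
qed

lemma S2n_values: "v \<in> S2n n \<Longrightarrow> v i = -1 \<or> v i = 0 \<or> v i = 1"
  by (cases "i < n") (auto simp: S2n_def)

lemma nz_S2n: "v \<in> S2n n \<Longrightarrow> nz v \<subseteq> {..<n}"
  unfolding S2n_def nz_def by (auto simp: not_less[symmetric])

lemma finite_nz: "v \<in> S2n n \<Longrightarrow> finite (nz v)"
  using nz_S2n finite_subset by blast

lemma S2nI: "(\<And>i. i < n \<Longrightarrow> v i = -1 \<or> v i = 0 \<or> v i = 1) \<Longrightarrow> (\<And>i. i \<ge> n \<Longrightarrow> v i = 0) \<Longrightarrow> v \<in> S2n n"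
  by (auto simp: S2n_def)

lemma S2_le_nz: "S2_le v w \<Longrightarrow> nz v \<subseteq> nz w"
  by (auto simp: S2_le_def nz_def)

lemma S2_le_nz_eq: "S2_le v w \<Longrightarrow> nz w \<subseteq> nz v \<Longrightarrow> v = w"
  by (rule ext) (auto simp: S2_le_def nz_def subset_iff, metis)

text \<open>A vector below \<open>v\<close> is \<open>v\<close> restricted to a subset of its
  support, so those with support in \<open>T\<close> correspond to the subsets of
  \<open>T\<close>.\<close>

lemma card_below:
  assumes v: "v \<in> S2n n" and T: "T \<subseteq> nz v"
  shows "card {z \<in> S2n n. S2_le z v \<and> nz z \<subseteq> T} = 2 ^ card T"
proof -
  have fin: "finite T" using T finite_nz[OF v] finite_subset by blast
  have "bij_betw nz {z \<in> S2n n. S2_le z v \<and> nz z \<subseteq> T} (Pow T)"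
  proof (rule bij_betwI[where g = "\<lambda>U i. if i \<in> U then v i else 0"])
    show "nz \<in> {z \<in> S2n n. S2_le z v \<and> nz z \<subseteq> T} \<rightarrow> Pow T" by auto
    show "(\<lambda>U i. if i \<in> U then v i else 0) \<in> Pow T \<rightarrow> {z \<in> S2n n. S2_le z v \<and> nz z \<subseteq> T}"
    proof (intro funcsetI CollectI conjI)
      fix U assume U: "U \<in> Pow T"
      show "(\<lambda>i. if i \<in> U then v i else 0) \<in> S2n n"
        using S2n_values[OF v] v by (intro S2nI) (auto simp: S2n_def)
    qed (use T in \<open>auto simp: S2_le_def nz_def split: if_splits\<close>)
    show "(\<lambda>i. if i \<in> nz z then v i else 0) = z" if "z \<in> {z \<in> S2n n. S2_le z v \<and> nz z \<subseteq> T}" for z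
      using that by (auto simp: S2_le_def nz_def fun_eq_iff)
    show "nz (\<lambda>i. if i \<in> U then v i else 0) = U" if "U \<in> Pow T" for U
      using that T by (auto simp: nz_def)
  qed
  then show ?thesis using bij_betw_same_card[of nz] card_Pow[OF fin] by simp
qed

lemma card_below_both:
  assumes v: "v \<in> S2n n" and w: "w \<in> S2n n"
  shows "card {z \<in> S2n n. S2_le z v \<and> S2_le z w} = 2 ^ card {i \<in> nz v. w i = v i}"
proof -
  have "S2_le z w \<longleftrightarrow> nz z \<subseteq> {i \<in> nz v. w i = v i}" if z: "S2_le z v" for z
  proof -
    have "z i = 0 \<or> z i = w i \<longleftrightarrow> (z i \<noteq> 0 \<longrightarrow> v i \<noteq> 0 \<and> w i = v i)" for i
      using z[unfolded S2_le_def, rule_format, of i] by auto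
    then show ?thesis unfolding S2_le_def nz_def by blast
  qed
  then have "{z \<in> S2n n. S2_le z v \<and> S2_le z w} = {z \<in> S2n n. S2_le z v \<and> nz z \<subseteq> {i \<in> nz v. w i = v i}}"
    by blast
  then show ?thesis using card_below[OF v] by simp
qed

text \<open>A vector below \<open>v\<close> has a common upper bound with \<open>w\<close> exactly
  when it is nonzero only where \<open>w\<close> vanishes or agrees with \<open>v\<close>. Unlike
  the count of common lower bounds, this one tells a zero of \<open>w\<close> from an opposite
  sign.\<close>

lemma card_below_compatible:
  assumes v: "v \<in> S2n n" and w: "w \<in> S2n n"
  shows "card {z \<in> S2n n. S2_le z v \<and> (\<exists>u \<in> S2n n. S2_le z u \<and> S2_le w u)}
    = 2 ^ card {i \<in> nz v. w i = 0 \<or> w i = v i}"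
proof -
  have "(\<exists>u \<in> S2n n. S2_le z u \<and> S2_le w u) \<longleftrightarrow> nz z \<subseteq> {i \<in> nz v. w i = 0 \<or> w i = v i}"
    if z: "z \<in> S2n n" "S2_le z v" for z
  proof
    assume "\<exists>u \<in> S2n n. S2_le z u \<and> S2_le w u"
    then obtain u where u: "S2_le z u" "S2_le w u" by blast
    have "v i \<noteq> 0 \<and> (w i = 0 \<or> w i = v i)" if "z i \<noteq> 0" for i
      using that z(2)[unfolded S2_le_def, rule_format, of i] u[unfolded S2_le_def, rule_format, of i] by auto
    then show "nz z \<subseteq> {i \<in> nz v. w i = 0 \<or> w i = v i}" by (auto simp: nz_def)
  next
    assume *: "nz z \<subseteq> {i \<in> nz v. w i = 0 \<or> w i = v i}"
    define u where "u = (\<lambda>i. if z i = 0 then w i else z i)"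
    have "u \<in> S2n n" using z(1) w by (auto simp: u_def S2n_def)
    moreover have "S2_le z u" by (auto simp: u_def S2_le_def)
    moreover have "w i = 0 \<or> w i = u i" for i
    proof (cases "z i = 0")
      case False
      then have "w i = 0 \<or> w i = v i" "z i = v i" using * z(2) by (auto simp: nz_def S2_le_def)
      then show ?thesis using False by (auto simp: u_def)
    qed (simp add: u_def)
    then have "S2_le w u" by (simp add: S2_le_def)
    ultimately show "\<exists>u \<in> S2n n. S2_le z u \<and> S2_le w u" by blast
  qed
  then have "{z \<in> S2n n. S2_le z v \<and> (\<exists>u \<in> S2n n. S2_le z u \<and> S2_le w u)}
    = {z \<in> S2n n. S2_le z v \<and> nz z \<subseteq> {i \<in> nz v. w i = 0 \<or> w i = v i}}"
    by blast
  then show ?thesis using card_below[OF v] by simp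
qed

section \<open>Inner products recovered by counting\<close>

definition sip :: "nat \<Rightarrow> (nat \<Rightarrow> int) \<Rightarrow> (nat \<Rightarrow> int) \<Rightarrow> int" where
  "sip n v w = (\<Sum>i<n. v i * w i)"

text \<open>On the support of \<open>v\<close> the product is 1, 0 or -1 as \<open>w\<close> agrees,
  vanishes or has the opposite sign, which is a sum of two indicators minus 1. All three
  cardinalities are logarithms of order-theoretic counts.\<close>

lemma sip_cards:
  assumes v: "v \<in> S2n n" and w: "w \<in> S2n n"
  shows "sip n v w = int (card {i \<in> nz v. w i = v i})
    + int (card {i \<in> nz v. w i = 0 \<or> w i = v i}) - int (card (nz v))"
proof -
  have fin: "finite (nz v)" by (rule finite_nz[OF v])
  have "sip n v w = (\<Sum>i\<in>nz v. v i * w i)"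
    unfolding sip_def by (rule sum.mono_neutral_right) (use nz_S2n[OF v] in \<open>auto simp: nz_def\<close>)
  also have "\<dots> = (\<Sum>i\<in>nz v. (if w i = v i then 1 else 0) + (if w i = 0 \<or> w i = v i then 1 else 0) - 1)"
  proof (rule sum.cong[OF refl])
    fix i assume "i \<in> nz v"
    then show "v i * w i = (if w i = v i then 1 else 0) + (if w i = 0 \<or> w i = v i then 1 else 0) - 1"
      using S2n_values[OF v, of i] S2n_values[OF w, of i] by (auto simp: nz_def)
  qed
  also have "\<dots> = int (card {i \<in> nz v. w i = v i})
    + int (card {i \<in> nz v. w i = 0 \<or> w i = v i}) - int (card (nz v))"
    using fin by (simp add: sum_subtractf sum.distrib sum.If_cases Int_def)
  finally show ?thesis .
qed

lemma sip_self: "v \<in> S2n n \<Longrightarrow> sip n v v = int (card (nz v))"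
  using sip_cards[of v n v] by simp

lemma sip_commute: "sip n v w = sip n w v"
  by (simp add: sip_def mult.commute)

lemma sip_le: "v \<in> S2n n \<Longrightarrow> w \<in> S2n n \<Longrightarrow> S2_le v w \<Longrightarrow> sip n v w = int (card (nz v))"
  by (subst sip_self[symmetric]) (auto simp: sip_def S2_le_def intro!: sum.cong)

lemma order_iso_card:
  assumes "order_iso F leF G leG h"
    and "\<And>x. x \<in> F \<Longrightarrow> P x \<longleftrightarrow> Q (h x)"
  shows "card {x \<in> F. P x} = card {y \<in> G. Q y}"
proof -
  have b: "bij_betw h F G" using assms(1) by (simp add: order_iso_def)
  then have "h ` {x \<in> F. P x} = {y \<in> G. Q y}"
    using assms(2) by (auto simp: bij_betw_def)
  moreover have "inj_on h {x \<in> F. P x}" using b by (auto simp: bij_betw_def intro: inj_on_subset)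
  ultimately show ?thesis using card_image by metis
qed

lemma order_iso_compose:
  assumes "order_iso F leF G leG h" "order_iso G leG H leH k"
  shows "order_iso F leF H leH (k \<circ> h)"
  using assms bij_betw_trans[of h F G k H] bij_betwE[of h F G]
  by (auto simp: order_iso_def)

text \<open>The order on \<open>F\<close> alone gives three counts that are powers of two, with the
  cardinalities of \<open>sip_cards\<close> as exponents.\<close>

lemma chart_sip_unique:
  fixes F :: "'a::order set"
  assumes h: "order_iso F (\<le>) (S2n n) S2_le h" and k: "order_iso F (\<le>) (S2n n) S2_le k"
    and pq: "p \<in> F" "q \<in> F"
  shows "sip n (h p) (h q) = sip n (k p) (k q)"
proof -
  have *: "int (card {z\<in>F. z \<le> p \<and> z \<le> q}) = 2 ^ card {i \<in> nz (g p). g q i = g p i}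
      \<and> int (card {z\<in>F. z \<le> p \<and> (\<exists>u\<in>F. z \<le> u \<and> q \<le> u)}) = 2 ^ card {i \<in> nz (g p). g q i = 0 \<or> g q i = g p i}
      \<and> int (card {z\<in>F. z \<le> p \<and> z \<le> p}) = 2 ^ card (nz (g p))"
    if g: "order_iso F (\<le>) (S2n n) S2_le g" for g
  proof -
    have b: "bij_betw g F (S2n n)" and le: "\<And>x y. x \<in> F \<Longrightarrow> y \<in> F \<Longrightarrow> x \<le> y \<longleftrightarrow> S2_le (g x) (g y)"
      using g by (auto simp: order_iso_def)
    have S: "g p \<in> S2n n" "g q \<in> S2n n" using b pq by (auto simp: bij_betw_def)
    have "(\<exists>u\<in>F. z \<le> u \<and> q \<le> u) \<longleftrightarrow> (\<exists>u\<in>S2n n. S2_le (g z) u \<and> S2_le (g q) u)" if "z \<in> F" for z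
      using b le pq that unfolding bij_betw_def by (metis (no_types, lifting) image_iff)
    then have "card {z\<in>F. z \<le> p \<and> (\<exists>u\<in>F. z \<le> u \<and> q \<le> u)}
      = card {z \<in> S2n n. S2_le z (g p) \<and> (\<exists>u \<in> S2n n. S2_le z u \<and> S2_le (g q) u)}"
      using le pq by (intro order_iso_card[OF g]) auto
    moreover have "card {z\<in>F. z \<le> p \<and> z \<le> q} = card {z \<in> S2n n. S2_le z (g p) \<and> S2_le z (g q)}"
      using le pq by (intro order_iso_card[OF g]) auto
    moreover have "card {z\<in>F. z \<le> p \<and> z \<le> p} = card {z \<in> S2n n. S2_le z (g p) \<and> S2_le z (g p)}"
      using le pq by (intro order_iso_card[OF g]) auto
    ultimately show ?thesis
      using card_below_both[OF S] card_below_both[OF S(1) S(1)] card_below_compatible[OF S] by simp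
  qed
  have inj: "a = b" if "(2::int) ^ a = 2 ^ b" for a b :: nat using that by simp
  have S: "h p \<in> S2n n" "h q \<in> S2n n" "k p \<in> S2n n" "k q \<in> S2n n"
    using h k pq by (auto simp: order_iso_def bij_betw_def)
  have "card {i \<in> nz (h p). h q i = h p i} = card {i \<in> nz (k p). k q i = k p i}"
    "card {i \<in> nz (h p). h q i = 0 \<or> h q i = h p i} = card {i \<in> nz (k p). k q i = 0 \<or> k q i = k p i}"
    "card (nz (h p)) = card (nz (k p))"
    by (intro inj; use *[OF h] *[OF k] in presburger)+
  then show ?thesis using sip_cards[OF S(1,2)] sip_cards[OF S(3,4)] by simp
qed

text \<open>Sorting the coordinates by the number of members of a chain in which they vanish refines
  the chain to a complete flag.\<close>

lemma flag_in_S2n: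
  fixes S :: "(nat \<Rightarrow> int) set"
  assumes S: "S \<subseteq> S2n n" and chain: "\<And>v w. v \<in> S \<Longrightarrow> w \<in> S \<Longrightarrow> S2_le v w \<or> S2_le w v"
  obtains c where "\<And>j. j \<le> n \<Longrightarrow> c j \<in> S2n n" "\<And>j. j \<le> n \<Longrightarrow> card (nz (c j)) = j"
    "\<And>i j. i \<le> j \<Longrightarrow> j \<le> n \<Longrightarrow> S2_le (c i) (c j)" "S \<subseteq> c ` {..n}"
proof -
  have fin: "finite S" using S finite_S2n finite_subset by blast
  define key where "key i = card {w \<in> S. w i = 0}" for i :: nat
  define ls where "ls = sort_key key [0..<n]"
  have len: "length ls = n" and dis: "distinct ls" and sis: "set ls = {..<n}"
    by (auto simp: ls_def)
  have srt: "key (ls ! i) \<le> key (ls ! j)" if "i \<le> j" "j < n" for i j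
    using sorted_sort_key[of key "[0..<n]"] that len
    by (auto simp: ls_def[symmetric] sorted_iff_nth_mono)
  \<comment> \<open>\<open>sg\<close> collects the signs shared by the members of \<open>S\<close>;
    the default 1 extends the flag over coordinates in which all members vanish.\<close>
  define sg :: "nat \<Rightarrow> int" where
    "sg i = (if \<exists>w\<in>S. w i \<noteq> 0 then (SOME w. w \<in> S \<and> w i \<noteq> 0) i else 1)" for i
  have sg: "sg i = w i" if "w \<in> S" "w i \<noteq> 0" for w i
  proof -
    have "(SOME w. w \<in> S \<and> w i \<noteq> 0) \<in> S \<and> (SOME w. w \<in> S \<and> w i \<noteq> 0) i \<noteq> 0"
      by (rule someI[where P = "\<lambda>w. w \<in> S \<and> w i \<noteq> 0"]) (use that in auto)
    then have "(SOME w. w \<in> S \<and> w i \<noteq> 0) i = w i"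
      using chain[of w "SOME w. w \<in> S \<and> w i \<noteq> 0"] that by (auto simp: S2_le_def)
    then show ?thesis using that by (auto simp: sg_def)
  qed
  have sg1: "sg i = 1 \<or> sg i = -1" for i
  proof (cases "\<exists>w\<in>S. w i \<noteq> 0")
    case True
    then obtain w where w: "w \<in> S" "w i \<noteq> 0" by auto
    with S have "w \<in> S2n n" by auto
    then show ?thesis using sg[OF w] S2n_values[of w n i] w(2) by auto
  qed (simp add: sg_def)
  define c where "c j i = (if i \<in> set (take j ls) then sg i else 0)" for j i
  have nzc: "nz (c j) = set (take j ls)" for j
    using sg1 by (auto simp: nz_def c_def) (metis zero_neq_one zero_neq_neg_one)
  have cS: "c j \<in> S2n n" if "j \<le> n" for j
  proof (rule S2nI)
    show "c j i = 0" if "n \<le> i" for i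
      using that sis set_take_subset[of j ls] by (auto simp: c_def)
  qed (use sg1 in \<open>auto simp: c_def\<close>)
  have cc: "card (nz (c j)) = j" if "j \<le> n" for j
    using that dis len by (simp add: nzc distinct_card)
  have cm: "S2_le (c i) (c j)" if "i \<le> j" for i j
    using set_take_subset_set_take[OF that, of ls] by (auto simp: S2_le_def c_def)
  have key: "key i < key j" if w: "w \<in> S" "w i \<noteq> 0" "w j = 0" for w i j
  proof -
    have "w' j = 0" if "w' \<in> S" "w' i = 0" for w'
      using chain[OF w(1) that(1)] that w unfolding S2_le_def by metis
    then have "{w \<in> S. w i = 0} \<subset> {w \<in> S. w j = 0}" using w by auto
    then show ?thesis unfolding key_def using fin by (intro psubset_card_mono) auto
  qed
  have "w \<in> c ` {..n}" if w: "w \<in> S" for w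
  proof -
    have wS: "w \<in> S2n n" using w S by auto
    let ?j = "card (nz w)"
    have j: "?j \<le> n" using card_mono[OF _ nz_S2n[OF wS]] by simp
    \<comment> \<open>Otherwise some \<open>a\<close> in the support of \<open>w\<close> comes after
      some \<open>b\<close> outside it in \<open>ls\<close>, while \<open>w\<close> itself shows
      that \<open>b\<close> has the larger key.\<close>
    have "nz w = set (take ?j ls)"
    proof (rule ccontr)
      assume ne: "nz w \<noteq> set (take ?j ls)"
      have cd: "card (set (take ?j ls)) = card (nz w)" using cc[OF j] nzc by simp
      obtain a where a: "a \<in> nz w" "a \<notin> set (take ?j ls)"
        using card_subset_eq[of "set (take ?j ls)" "nz w"] cd ne by fastforce
      obtain b where b: "b \<notin> nz w" "b \<in> set (take ?j ls)"
        using card_subset_eq[OF finite_nz[OF wS], of "set (take ?j ls)"] cd ne by fastforce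
      obtain ib where ib: "ib < ?j" "ls ! ib = b" using b(2) j len by (auto simp: in_set_conv_nth)
      have "a \<in> set ls" using a(1) nz_S2n[OF wS] sis by auto
      then obtain ia where ia: "ia < n" "ls ! ia = a" using len by (auto simp: in_set_conv_nth)
      have "\<not> ia < ?j" using a(2) ia len j by (auto simp: in_set_conv_nth)
      then have "key b \<le> key a" using srt[of ib ia] ia ib by auto
      moreover have "key a < key b" using key[OF w, of a b] a b by (auto simp: nz_def)
      ultimately show False by simp
    qed
    then have "w = c ?j" using sg[OF w] by (auto simp: fun_eq_iff c_def nz_def)
    then show ?thesis using j by auto
  qed
  then show ?thesis using that[OF cS cc] cm by blast
qed

section \<open>Polar spaces in frame coordinates\<close>

lemma is_chain_singleton [simp]: "is_chain L {p} \<longleftrightarrow> p \<in> L"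
  by (auto simp: is_chain_def)

lemma is_chain_pair: "p \<in> L \<Longrightarrow> q \<in> L \<Longrightarrow> p \<le> q \<Longrightarrow> is_chain L {p, q}"
  by (auto simp: is_chain_def)

lemma is_glb_unique: "is_glb L x y m \<Longrightarrow> is_glb L x y m' \<Longrightarrow> m = m'"
  by (meson is_glb_def order_antisym)

lemma meet_eqI: "is_glb L x y m \<Longrightarrow> meet L x y = m"
  unfolding meet_def using is_glb_unique by (intro the_equality) auto

locale polar =
  fixes L :: "'a::order set" and n :: nat and Fs :: "'a set set"
  assumes frames: "polar_space_frames L n Fs"
begin

definition chart :: "'a set \<Rightarrow> ('a \<Rightarrow> nat \<Rightarrow> int) \<Rightarrow> bool" where
  "chart F h \<longleftrightarrow> F \<in> Fs \<and> order_iso F (\<le>) (S2n n) S2_le h"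

lemma frame_subset: "F \<in> Fs \<Longrightarrow> F \<subseteq> L"
  using frames by (auto simp: polar_space_frames_def)

lemma chart_subset: "chart F h \<Longrightarrow> F \<subseteq> L"
  by (simp add: chart_def frame_subset)

lemma ex_chart: "F \<in> Fs \<Longrightarrow> \<exists>h. chart F h"
  using frames by (auto simp: polar_space_frames_def chart_def)

lemma ex_chart_chains:
  assumes "is_chain L C" "is_chain L D"
  obtains F h where "chart F h" "C \<subseteq> F" "D \<subseteq> F"
proof -
  have "\<forall>C D. is_chain L C \<longrightarrow> is_chain L D \<longrightarrow> (\<exists>F\<in>Fs. C \<union> D \<subseteq> F)"
    using frames unfolding polar_space_frames_def by (elim conjE)
  then obtain F where "F \<in> Fs" "C \<union> D \<subseteq> F" using assms by blast
  then show ?thesis using ex_chart that by blast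
qed

lemma ex_chart_points:
  assumes "p \<in> L" "q \<in> L"
  obtains F h where "chart F h" "p \<in> F" "q \<in> F"
  using ex_chart_chains[of "{p}" "{q}"] assms by auto

lemma chart_bij: "chart F h \<Longrightarrow> bij_betw h F (S2n n)"
  by (simp add: chart_def order_iso_def)

lemma chart_S2n: "chart F h \<Longrightarrow> p \<in> F \<Longrightarrow> h p \<in> S2n n"
  using chart_bij bij_betwE by blast

lemma chart_le: "chart F h \<Longrightarrow> p \<in> F \<Longrightarrow> q \<in> F \<Longrightarrow> p \<le> q \<longleftrightarrow> S2_le (h p) (h q)"
  by (simp add: chart_def order_iso_def)

lemma chart_inj: "chart F h \<Longrightarrow> p \<in> F \<Longrightarrow> q \<in> F \<Longrightarrow> h p = h q \<Longrightarrow> p = q"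
  using chart_bij by (auto simp: bij_betw_def inj_on_def)

lemma chart_surj:
  assumes "chart F h" "v \<in> S2n n"
  obtains p where "p \<in> F" "h p = v"
proof -
  have "v \<in> h ` F" using chart_bij[OF assms(1)] assms(2) by (simp add: bij_betw_def)
  then show ?thesis using that by blast
qed

lemma chart_finite: "chart F h \<Longrightarrow> finite F"
  using chart_bij bij_betw_finite finite_S2n by blast

lemma frame_meet: "F \<in> Fs \<Longrightarrow> p \<in> F \<Longrightarrow> q \<in> F \<Longrightarrow> meet L p q \<in> F"
  using frames by (auto simp: polar_space_frames_def)

lemma is_glb_meet: "p \<in> L \<Longrightarrow> q \<in> L \<Longrightarrow> is_glb L p q (meet L p q)"
  using frames meet_eqI unfolding polar_space_frames_def meet_semilattice_def by metis

lemma meet_in: "p \<in> L \<Longrightarrow> q \<in> L \<Longrightarrow> meet L p q \<in> L"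
  and meet_le1: "p \<in> L \<Longrightarrow> q \<in> L \<Longrightarrow> meet L p q \<le> p"
  and meet_le2: "p \<in> L \<Longrightarrow> q \<in> L \<Longrightarrow> meet L p q \<le> q"
  and meet_greatest: "p \<in> L \<Longrightarrow> q \<in> L \<Longrightarrow> z \<in> L \<Longrightarrow> z \<le> p \<Longrightarrow> z \<le> q \<Longrightarrow> z \<le> meet L p q"
  using is_glb_meet[of p q] by (auto simp: is_glb_def)

lemma meet_commute: "p \<in> L \<Longrightarrow> q \<in> L \<Longrightarrow> meet L p q = meet L q p"
  by (simp add: meet_in meet_le1 meet_le2 meet_greatest order_antisym)

lemma chart_meet:
  assumes h: "chart F h" and pq: "p \<in> F" "q \<in> F"
  shows "h (meet L p q) i = (if h p i = h q i then h p i else 0)"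
proof -
  have FL: "F \<subseteq> L" and L: "p \<in> L" "q \<in> L" using chart_subset[OF h] pq by auto
  have mF: "meet L p q \<in> F" using frame_meet h pq by (auto simp: chart_def)
  define v where "v i = (if h p i = h q i then h p i else 0)" for i
  have "v \<in> S2n n" using chart_S2n[OF h pq(1)] by (auto simp: S2n_def v_def)
  then obtain m where m: "m \<in> F" "h m = v" using chart_surj[OF h] by blast
  have "m \<le> p" "m \<le> q" using chart_le[OF h] m pq by (auto simp: S2_le_def v_def)
  then have "m \<le> meet L p q" using meet_greatest[OF L] m(1) FL by blast
  moreover have "meet L p q \<le> m"
  proof -
    have p: "S2_le (h (meet L p q)) (h p)" and q: "S2_le (h (meet L p q)) (h q)"
      using chart_le[OF h mF] meet_le1[OF L] meet_le2[OF L] pq by auto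
    have "h (meet L p q) i = 0 \<or> h (meet L p q) i = v i" for i
      using p[unfolded S2_le_def, rule_format, of i] q[unfolded S2_le_def, rule_format, of i]
      by (auto simp: v_def)
    then show ?thesis using chart_le[OF h mF m(1)] m(2) by (auto simp: S2_le_def)
  qed
  ultimately have "meet L p q = m" by simp
  then show ?thesis using m by (simp add: v_def)
qed

text \<open>(P2) gives an isomorphism of the frames fixing \<open>p\<close> and \<open>q\<close>;
  composed with \<open>k\<close> it is a second chart of \<open>F\<close>, so
  \<open>chart_sip_unique\<close> applies.\<close>

lemma chart_sip_eq:
  assumes h: "chart F h" and k: "chart G k" and "p \<in> F" "q \<in> F" "p \<in> G" "q \<in> G"
  shows "sip n (h p) (h q) = sip n (k p) (k q)"
proof -
  have "is_chain L {p}" "is_chain L {q}" using assms chart_subset[OF h] by auto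
  moreover have "\<forall>F\<in>Fs. \<forall>F'\<in>Fs. \<forall>C D. is_chain L C \<longrightarrow> is_chain L D \<longrightarrow> C \<union> D \<subseteq> F \<longrightarrow> C \<union> D \<subseteq> F'
        \<longrightarrow> (\<exists>h. order_iso F (\<le>) F' (\<le>) h \<and> (\<forall>x\<in>C \<union> D. h x = x))"
    using frames unfolding polar_space_frames_def by (elim conjE)
  moreover have "F \<in> Fs" "G \<in> Fs" using h k by (auto simp: chart_def)
  ultimately obtain g where g: "order_iso F (\<le>) G (\<le>) g" "\<forall>x\<in>{p} \<union> {q}. g x = x"
    using assms by (metis Un_subset_iff empty_subsetI insert_subset)
  have "sip n (h p) (h q) = sip n ((k \<circ> g) p) ((k \<circ> g) q)"
  proof (rule chart_sip_unique)
    show "order_iso F (\<le>) (S2n n) S2_le h" using h by (simp add: chart_def)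
    show "order_iso F (\<le>) (S2n n) S2_le (k \<circ> g)"
      by (rule order_iso_compose[OF g(1)]) (use k in \<open>simp add: chart_def\<close>)
  qed (use assms in auto)
  then show ?thesis using g by simp
qed

text \<open>The frame is chosen arbitrarily among those containing both points;
  \<open>chart_sip_eq\<close> makes the value independent of the choice.\<close>

definition ip :: "'a \<Rightarrow> 'a \<Rightarrow> int" where
  "ip p q = (case SOME (F, h). chart F h \<and> p \<in> F \<and> q \<in> F of (F, h) \<Rightarrow> sip n (h p) (h q))"

lemma chart_ip:
  assumes "chart F h" "p \<in> F" "q \<in> F"
  shows "sip n (h p) (h q) = ip p q"
proof -
  obtain G k where Gk: "(SOME (F, h). chart F h \<and> p \<in> F \<and> q \<in> F) = (G, k)" by force
  have "case (G, k) of (F, h) \<Rightarrow> chart F h \<and> p \<in> F \<and> q \<in> F"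
    unfolding Gk[symmetric] by (rule someI[of _ "(F, h)"]) (use assms in auto)
  then show ?thesis using assms chart_sip_eq[of F h G k p q] unfolding ip_def Gk by auto
qed

text \<open>\<open>G\<close> need not be a frame: a retraction has this property on each union of
  its central chain with another chain, but in general not on the whole space.\<close>

definition embeds :: "'a set \<Rightarrow> ('a \<Rightarrow> nat \<Rightarrow> int) \<Rightarrow> bool" where
  "embeds G k \<longleftrightarrow> G \<subseteq> L \<and> (\<forall>p\<in>G. k p \<in> S2n n)
     \<and> (\<forall>p\<in>G. \<forall>q\<in>G. p \<le> q \<longleftrightarrow> S2_le (k p) (k q)) \<and> (\<forall>p\<in>G. \<forall>q\<in>G. sip n (k p) (k q) = ip p q)"

lemma chart_embeds: "chart F h \<Longrightarrow> embeds F h"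
  by (simp add: embeds_def chart_subset chart_S2n chart_le chart_ip)

lemma embeds_subset: "embeds G k \<Longrightarrow> H \<subseteq> G \<Longrightarrow> embeds H k"
  unfolding embeds_def by (meson subset_iff)

lemma embeds_S2n: "embeds G k \<Longrightarrow> p \<in> G \<Longrightarrow> k p \<in> S2n n"
  and embeds_le: "embeds G k \<Longrightarrow> p \<in> G \<Longrightarrow> q \<in> G \<Longrightarrow> p \<le> q \<longleftrightarrow> S2_le (k p) (k q)"
  and embeds_ip: "embeds G k \<Longrightarrow> p \<in> G \<Longrightarrow> q \<in> G \<Longrightarrow> sip n (k p) (k q) = ip p q"
  by (auto simp: embeds_def)

lemma embeds_inj: "embeds G k \<Longrightarrow> p \<in> G \<Longrightarrow> q \<in> G \<Longrightarrow> k p = k q \<Longrightarrow> p = q"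
  using embeds_le[of G k p q] embeds_le[of G k q p] by (auto simp: S2_le_def)

lemma flag_in_frame:
  assumes h: "chart F h" and S: "S \<subseteq> F" "is_chain L S"
  obtains c where "\<And>j. j \<le> n \<Longrightarrow> c j \<in> F" "\<And>j. j \<le> n \<Longrightarrow> card (nz (h (c j))) = j"
    "\<And>i j. i \<le> j \<Longrightarrow> j \<le> n \<Longrightarrow> c i \<le> c j" "S \<subseteq> c ` {..n}"
proof -
  have SF: "\<And>p. p \<in> S \<Longrightarrow> p \<in> F" using S(1) by auto
  obtain c where c: "\<And>j. j \<le> n \<Longrightarrow> c j \<in> S2n n" "\<And>j. j \<le> n \<Longrightarrow> card (nz (c j)) = j"
    "\<And>i j. i \<le> j \<Longrightarrow> j \<le> n \<Longrightarrow> S2_le (c i) (c j)" "h ` S \<subseteq> c ` {..n}"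
  proof (rule flag_in_S2n[of "h ` S" n])
    show "h ` S \<subseteq> S2n n" using chart_S2n[OF h] SF by auto
    show "S2_le v w \<or> S2_le w v" if "v \<in> h ` S" "w \<in> h ` S" for v w
      using that S(2) chart_le[OF h] SF unfolding is_chain_def by auto
  qed blast
  define d where "d j = inv_into F h (c j)" for j
  have surj: "c j \<in> h ` F" if "j \<le> n" for j
    using c(1)[OF that] chart_bij[OF h] by (auto simp: bij_betw_def)
  have d: "d j \<in> F" "h (d j) = c j" if "j \<le> n" for j
    using surj[OF that] by (auto simp: d_def inv_into_into f_inv_into_f)
  have "S \<subseteq> d ` {..n}"
  proof
    fix p assume p: "p \<in> S"
    then obtain j where "j \<le> n" "h p = c j" using c(4) by auto
    then have "p = d j" using chart_inj[OF h SF[OF p] d(1)] d(2) by auto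
    then show "p \<in> d ` {..n}" using \<open>j \<le> n\<close> by auto
  qed
  moreover have "d i \<le> d j" if "i \<le> j" "j \<le> n" for i j
    using that c(3) chart_le[OF h] d by auto
  ultimately show ?thesis using that[of d] d c(2) by auto
qed

text \<open>\<open>rk\<close> ranges over all chains of \<open>L\<close>, so for the upper bound a
  chain and \<open>p\<close> are moved into a common frame \<open>G\<close>. There the support sizes
  strictly increase along the chain, and the support of \<open>p\<close> has the same size as in
  \<open>F\<close> because that size is the inner product of \<open>p\<close> with itself.\<close>

lemma rk_chart:
  assumes h: "chart F h" and p: "p \<in> F"
  shows "rk L p = card (nz (h p))"
proof -
  let ?r = "card (nz (h p))"
  have FL: "F \<subseteq> L" by (rule chart_subset[OF h])
  have r: "?r \<le> n" using card_mono[OF _ nz_S2n[OF chart_S2n[OF h p]]] by simp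
  have "(SUP C \<in> {C. finite C \<and> C \<noteq> {} \<and> is_chain L C \<and> (\<forall>x\<in>C. x \<le> p)}. card C) = ?r + 1"
  proof (rule cSup_eq_maximum)
    obtain c where c: "\<And>j. j \<le> n \<Longrightarrow> c j \<in> F" "\<And>j. j \<le> n \<Longrightarrow> card (nz (h (c j))) = j"
      "\<And>i j. i \<le> j \<Longrightarrow> j \<le> n \<Longrightarrow> c i \<le> c j" "{p} \<subseteq> c ` {..n}"
      using flag_in_frame[OF h, of "{p}"] p FL by auto
    from c(4) obtain j where j: "j \<le> n" "p = c j" by auto
    then have jr: "j = ?r" using c(2) by auto
    have inj: "inj_on c {..j}"
      by (rule inj_on_inverseI[where g = "\<lambda>q. card (nz (h q))"]) (use c(2) j in auto)
    have "is_chain L (c ` {..j})"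
      unfolding is_chain_def
    proof (intro conjI ballI)
      show "c ` {..j} \<subseteq> L" using c(1) j FL by auto
      fix x y assume "x \<in> c ` {..j}" "y \<in> c ` {..j}"
      then obtain a b where ab: "x = c a" "y = c b" "a \<le> j" "b \<le> j" by auto
      show "x \<le> y \<or> y \<le> x"
        using c(3)[of a b] c(3)[of b a] ab j le_cases[of a b] by auto
    qed
    moreover have "\<forall>x\<in>c ` {..j}. x \<le> p" using c(3) j by auto
    moreover have "card (c ` {..j}) = ?r + 1" using card_image[OF inj] jr by simp
    ultimately show "?r + 1 \<in> card ` {C. finite C \<and> C \<noteq> {} \<and> is_chain L C \<and> (\<forall>x\<in>C. x \<le> p)}"
      by (intro rev_image_eqI[of "c ` {..j}"]) auto
  next
    fix m assume "m \<in> card ` {C. finite C \<and> C \<noteq> {} \<and> is_chain L C \<and> (\<forall>x\<in>C. x \<le> p)}"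
    then obtain C where C: "finite C" "is_chain L C" "\<forall>x\<in>C. x \<le> p" "m = card C" by auto
    obtain G k where k: "chart G k" "C \<subseteq> G" "{p} \<subseteq> G"
      using ex_chart_chains[of C "{p}"] C(2) p FL by auto
    have pG: "p \<in> G" using k by simp
    have "int (card (nz (k p))) = int ?r"
      using sip_self chart_S2n[OF h p] chart_S2n[OF k(1) pG] chart_sip_eq[OF h k(1) p p pG pG] by metis
    then have kr: "card (nz (k p)) = ?r" by simp
    have "inj_on (\<lambda>q. card (nz (k q))) C"
    proof (rule inj_onI)
      fix x y assume xy: "x \<in> C" "y \<in> C" and eq: "card (nz (k x)) = card (nz (k y))"
      have G: "x \<in> G" "y \<in> G" using xy k(2) by auto
      have *: "a = b" if "a \<in> G" "b \<in> G" "a \<le> b" "card (nz (k a)) = card (nz (k b))" for a b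
      proof -
        have le: "S2_le (k a) (k b)" using that chart_le[OF k(1)] by auto
        then have "nz (k a) = nz (k b)"
          using card_subset_eq[OF finite_nz[OF chart_S2n[OF k(1) that(2)]] S2_le_nz] that by auto
        then show ?thesis using S2_le_nz_eq[OF le] chart_inj[OF k(1) that(1,2)] by auto
      qed
      have "x \<le> y \<or> y \<le> x" using C(2) xy by (auto simp: is_chain_def)
      then show "x = y" using *[OF G] *[OF G(2,1)] eq by auto
    qed
    moreover have "(\<lambda>q. card (nz (k q))) ` C \<subseteq> {..?r}"
    proof
      fix y assume "y \<in> (\<lambda>q. card (nz (k q))) ` C"
      then obtain q where q: "q \<in> C" "y = card (nz (k q))" by auto
      then have "S2_le (k q) (k p)" using chart_le[OF k(1)] C(3) k(2) pG by auto
      then have "y \<le> card (nz (k p))"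
        using q S2_le_nz card_mono[OF finite_nz[OF chart_S2n[OF k(1) pG]]] by auto
      then show "y \<in> {..?r}" using kr by simp
    qed
    ultimately have "card C \<le> card {..?r}" using card_inj_on_le by blast
    then show "m \<le> ?r + 1" using C by simp
  qed
  then show ?thesis by (simp add: rk_def)
qed

lemma ip_self: "p \<in> L \<Longrightarrow> ip p p = int (rk L p)"
proof -
  assume p: "p \<in> L"
  obtain F h where "chart F h" "p \<in> F" using ex_chart_points[OF p p] by blast
  then show ?thesis using rk_chart[of F h p] chart_ip[of F h p p] sip_self chart_S2n by simp
qed

lemma rk_embeds: "embeds G k \<Longrightarrow> p \<in> G \<Longrightarrow> rk L p = card (nz (k p))"
  using ip_self[of p] embeds_ip[of G k p p] sip_self[OF embeds_S2n[of G k p]]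
  by (auto simp: embeds_def)

lemma rk_le_n:
  assumes "p \<in> L"
  shows "rk L p \<le> n"
proof -
  obtain F h where "chart F h" "p \<in> F" using ex_chart_points[OF assms assms] by blast
  then show ?thesis
    using rk_chart[of F h p] card_mono[OF _ nz_S2n[OF chart_S2n[of F h p]]] by simp
qed

lemma ip_le:
  assumes "p \<in> L" "q \<in> L" "p \<le> q"
  shows "ip p q = int (rk L p)"
proof -
  obtain F h where h: "chart F h" "p \<in> F" "q \<in> F" using ex_chart_points[OF assms(1,2)] by blast
  then show ?thesis
    using rk_chart[OF h(1,2)] chart_ip[OF h] chart_le[OF h] assms(3)
      sip_le[OF chart_S2n[OF h(1,2)] chart_S2n[OF h(1,3)]] by simp
qed

lemma ip_commute:
  assumes "p \<in> L" "q \<in> L"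
  shows "ip p q = ip q p"
proof -
  obtain F h where h: "chart F h" "p \<in> F" "q \<in> F" using ex_chart_points[OF assms] by blast
  then show ?thesis using chart_ip[OF h] chart_ip[OF h(1,3,2)] sip_commute by metis
qed

lemma rk_mono: "p \<in> L \<Longrightarrow> q \<in> L \<Longrightarrow> p \<le> q \<Longrightarrow> rk L p \<le> rk L q"
  and rk_eq_imp_eq: "p \<in> L \<Longrightarrow> q \<in> L \<Longrightarrow> p \<le> q \<Longrightarrow> rk L p = rk L q \<Longrightarrow> p = q"
proof -
  assume pq: "p \<in> L" "q \<in> L" "p \<le> q"
  obtain F h where h: "chart F h" "p \<in> F" "q \<in> F" using ex_chart_points pq by metis
  have le: "S2_le (h p) (h q)" using chart_le h pq by metis
  have fin: "finite (nz (h q))" using finite_nz chart_S2n h by metis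
  show "rk L p \<le> rk L q"
    using rk_chart[OF h(1)] h S2_le_nz[OF le] card_mono[OF fin] by auto
  show "p = q" if "rk L p = rk L q"
    using that rk_chart[OF h(1)] h card_subset_eq[OF fin S2_le_nz[OF le]] S2_le_nz_eq[OF le]
      chart_inj[OF h(1)] by auto
qed

section \<open>Retractions and the covering graph\<close>

text \<open>In a frame through the flag, consecutive flag vectors differ by a signed unit vector, so
  differences of inner products read off the coordinates up to a signed permutation, which preserves
  order and inner products. The formula for \<open>R\<close> mentions no frame, hence one map serves
  all frames through the flag, and (P1) puts every chain into one of them.\<close>

lemma retraction:
  assumes h: "chart F h" and S: "is_chain L S" "S \<subseteq> F"
  obtains R where "embeds F R" "\<And>D. is_chain L D \<Longrightarrow> embeds (S \<union> D) R"
proof -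
  obtain c where c: "\<And>j. j \<le> n \<Longrightarrow> c j \<in> F" "\<And>j. j \<le> n \<Longrightarrow> card (nz (h (c j))) = j"
    "\<And>i j. i \<le> j \<Longrightarrow> j \<le> n \<Longrightarrow> c i \<le> c j" "S \<subseteq> c ` {..n}"
    using flag_in_frame[OF h S(2,1)] by metis
  define R where "R z i = (if i < n then ip z (c (Suc i)) - ip z (c i) else 0)" for z i
  have main: "embeds G R" if k: "chart G k" and G: "c ` {..n} \<subseteq> G" for G k
  proof -
    have cG: "c j \<in> G" if "j \<le> n" for j using G that by auto
    have kS: "k p \<in> S2n n" if "p \<in> G" for p using chart_S2n[OF k that] .
    have cd: "card (nz (k (c j))) = j" if "j \<le> n" for j
      using c(2)[OF that] rk_chart[OF h c(1)[OF that]] rk_chart[OF k cG[OF that]] by simp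
    have le: "S2_le (k (c i)) (k (c j))" if "i \<le> j" "j \<le> n" for i j
      using c(3)[OF that] chart_le[OF k cG cG] that by auto
    have "\<exists>a. a \<in> nz (k (c (Suc j))) \<and> a \<notin> nz (k (c j))" if "j < n" for j
    proof (rule ccontr)
      assume "\<not> ?thesis"
      then have "nz (k (c (Suc j))) \<subseteq> nz (k (c j))" by auto
      then have "card (nz (k (c (Suc j)))) \<le> card (nz (k (c j)))"
        using card_mono[OF finite_nz[OF kS[OF cG]]] that by simp
      then show False using cd that by simp
    qed
    \<comment> \<open>\<open>\<sigma> j\<close> is the coordinate that becomes nonzero at step
      \<open>j\<close> of the flag in the chart \<open>k\<close>.\<close>
    then obtain \<sigma> where \<sigma>: "\<sigma> j \<in> nz (k (c (Suc j)))" "\<sigma> j \<notin> nz (k (c j))" if "j < n" for j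
      by metis
    define s where "s j = k (c (Suc j)) (\<sigma> j)" for j
    have s1: "s j = 1 \<or> s j = -1" if "j < n" for j
      using \<sigma>(1)[OF that] S2n_values[OF kS[OF cG], of "Suc j" "\<sigma> j"] that by (auto simp: s_def nz_def)
    have \<sigma>n: "\<sigma> ` {..<n} \<subseteq> {..<n}"
    proof (rule image_subsetI)
      fix j assume "j \<in> {..<n}"
      then show "\<sigma> j \<in> {..<n}" using \<sigma>(1)[of j] nz_S2n[OF kS[OF cG[of "Suc j"]]] by auto
    qed
    have inj: "inj_on \<sigma> {..<n}"
    proof (rule linorder_inj_onI)
      fix i j assume ij: "i < j" "i \<in> {..<n}" "j \<in> {..<n}"
      then have "nz (k (c (Suc i))) \<subseteq> nz (k (c j))" using S2_le_nz[OF le, of "Suc i" j] by auto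
      then show "\<sigma> i \<noteq> \<sigma> j" using \<sigma>(1)[of i] \<sigma>(2)[of j] ij by auto
    qed auto
    then have bij: "bij_betw \<sigma> {..<n} {..<n}"
      using endo_inj_surj[OF finite_lessThan \<sigma>n] by (simp add: bij_betw_def)
    have diff: "k (c (Suc j)) i - k (c j) i = (if i = \<sigma> j then s j else 0)" if j: "j < n" for i j
    proof (cases "i = \<sigma> j")
      case True
      then show ?thesis using \<sigma>(2)[OF j] by (simp add: s_def nz_def)
    next
      case False
      have "insert (\<sigma> j) (nz (k (c j))) = nz (k (c (Suc j)))"
      proof (rule card_subset_eq)
        show "finite (nz (k (c (Suc j))))" using finite_nz[OF kS[OF cG]] j by simp
        show "insert (\<sigma> j) (nz (k (c j))) \<subseteq> nz (k (c (Suc j)))"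
          using \<sigma>(1)[OF j] S2_le_nz[OF le, of j "Suc j"] j by auto
        show "card (insert (\<sigma> j) (nz (k (c j)))) = card (nz (k (c (Suc j))))"
          using \<sigma>(2)[OF j] finite_nz[OF kS[OF cG]] cd j by simp
      qed
      then have "i \<in> nz (k (c (Suc j))) \<longleftrightarrow> i \<in> nz (k (c j))" using False by blast
      then have "k (c j) i = k (c (Suc j)) i"
        using le[of j "Suc j"] j by (auto simp: S2_le_def nz_def)
      then show ?thesis using False by simp
    qed
    have R: "R z i = (if i < n then k z (\<sigma> i) * s i else 0)" if z: "z \<in> G" for z i
    proof (cases "i < n")
      case True
      have "R z i = sip n (k z) (k (c (Suc i))) - sip n (k z) (k (c i))"
        using True z cG chart_ip[OF k] by (simp add: R_def)
      also have "\<dots> = (\<Sum>a<n. k z a * (k (c (Suc i)) a - k (c i) a))"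
        by (simp add: sip_def sum_subtractf right_diff_distrib)
      also have "\<dots> = (\<Sum>a<n. if a = \<sigma> i then k z a * s i else 0)"
        by (rule sum.cong) (auto simp: diff[OF True])
      also have "\<dots> = k z (\<sigma> i) * s i"
        using \<sigma>n True by (auto simp: sum.delta)
      finally show ?thesis using True by simp
    qed (simp add: R_def)
    show ?thesis
      unfolding embeds_def
    proof (intro conjI ballI)
      show "G \<subseteq> L" by (rule chart_subset[OF k])
    next
      fix p assume p: "p \<in> G"
      show "R p \<in> S2n n"
      proof (rule S2nI)
        fix i assume "i < n"
        then show "R p i = -1 \<or> R p i = 0 \<or> R p i = 1"
          using R[OF p] s1[of i] S2n_values[OF kS[OF p], of "\<sigma> i"] by auto
      qed (simp add: R_def)
      fix q assume q: "q \<in> G"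
      show "p \<le> q \<longleftrightarrow> S2_le (R p) (R q)"
      proof
        assume "p \<le> q"
        then have "S2_le (k p) (k q)" using chart_le[OF k p q] by simp
        then show "S2_le (R p) (R q)" by (auto simp: S2_le_def R[OF p] R[OF q])
      next
        assume RR: "S2_le (R p) (R q)"
        have "k p i = 0 \<or> k p i = k q i" for i
        proof (cases "i < n")
          case True
          then obtain j where j: "j < n" "i = \<sigma> j" using bij by (auto simp: bij_betw_def image_iff)
          then show ?thesis
            using RR[unfolded S2_le_def, rule_format, of j] s1[OF j(1)] by (auto simp: R[OF p] R[OF q])
        next
          case False
          then show ?thesis using nz_S2n[OF kS[OF p]] by (auto simp: nz_def)
        qed
        then show "p \<le> q" using chart_le[OF k p q] by (simp add: S2_le_def)
      qed
      have "sip n (R p) (R q) = (\<Sum>j<n. k p (\<sigma> j) * k q (\<sigma> j))"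
        unfolding sip_def
      proof (rule sum.cong[OF refl])
        fix j assume "j \<in> {..<n}"
        then show "R p j * R q j = k p (\<sigma> j) * k q (\<sigma> j)"
          using s1[of j] by (auto simp: R[OF p] R[OF q])
      qed
      also have "\<dots> = sip n (k p) (k q)"
        unfolding sip_def by (rule sum.reindex_bij_betw[OF bij])
      also have "\<dots> = ip p q" by (rule chart_ip[OF k p q])
      finally show "sip n (R p) (R q) = ip p q" .
    qed
  qed
  have C: "is_chain L (c ` {..n})"
    unfolding is_chain_def
  proof (intro conjI ballI)
    show "c ` {..n} \<subseteq> L" using c(1) chart_subset[OF h] by auto
    fix x y assume "x \<in> c ` {..n}" "y \<in> c ` {..n}"
    then obtain a b where ab: "x = c a" "y = c b" "a \<le> n" "b \<le> n" by auto
    show "x \<le> y \<or> y \<le> x"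
      using c(3)[of a b] c(3)[of b a] ab le_cases[of a b] by auto
  qed
  have "embeds (S \<union> D) R" if D: "is_chain L D" for D
  proof -
    obtain G k where "chart G k" "c ` {..n} \<subseteq> G" "D \<subseteq> G" using ex_chart_chains[OF C D] .
    then show ?thesis using main[of G k] c(4) embeds_subset[of G R "S \<union> D"] by blast
  qed
  moreover have "embeds F R" using main[OF h] c(1) by auto
  ultimately show ?thesis using that by blast
qed

end

section \<open>The distance of the covering graph\<close>

definition l1 :: "nat \<Rightarrow> (nat \<Rightarrow> int) \<Rightarrow> (nat \<Rightarrow> int) \<Rightarrow> int" where
  "l1 n v w = (\<Sum>i<n. \<bar>v i - w i\<bar>)"

lemma l1_cards:
  assumes v: "v \<in> S2n n" and w: "w \<in> S2n n"
  shows "l1 n v w = int (card (nz v)) + int (card (nz w)) - 2 * int (card {i \<in> nz v. v i = w i})"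
proof -
  have "l1 n v w = (\<Sum>i<n. (if i \<in> nz v then 1 else 0) + (if i \<in> nz w then 1 else 0)
      - 2 * (if i \<in> {i \<in> nz v. v i = w i} then 1 else 0))"
    unfolding l1_def
  proof (rule sum.cong[OF refl])
    fix i
    show "\<bar>v i - w i\<bar> = (if i \<in> nz v then 1 else 0) + (if i \<in> nz w then 1 else 0)
      - 2 * (if i \<in> {i \<in> nz v. v i = w i} then 1 else 0)"
      using S2n_values[OF v, of i] S2n_values[OF w, of i] by (auto simp: nz_def)
  qed
  also have "\<dots> = int (card ({..<n} \<inter> nz v)) + int (card ({..<n} \<inter> nz w))
      - 2 * int (card ({..<n} \<inter> {i \<in> nz v. v i = w i}))"
    by (simp only: sum.distrib sum_subtractf sum_distrib_left[symmetric] sum.inter_restrict[symmetric, OF finite_lessThan]) simp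
  also have "{..<n} \<inter> nz v = nz v" using nz_S2n[OF v] by auto
  also have "{..<n} \<inter> nz w = nz w" using nz_S2n[OF w] by auto
  also have "{..<n} \<inter> {i \<in> nz v. v i = w i} = {i \<in> nz v. v i = w i}" using nz_S2n[OF v] by auto
  finally show ?thesis .
qed

lemma l1_triangle: "l1 n u w \<le> l1 n u v + l1 n v w"
  unfolding l1_def sum.distrib[symmetric] by (rule sum_mono) simp

lemma l1_commute: "l1 n v w = l1 n w v"
  by (simp add: l1_def abs_minus_commute)

lemma l1_le:
  assumes "v \<in> S2n n" "w \<in> S2n n" "S2_le v w"
  shows "l1 n v w = int (card (nz w)) - int (card (nz v))"
proof -
  have "{i \<in> nz v. v i = w i} = nz v" using assms(3) by (auto simp: S2_le_def nz_def)
  then show ?thesis using l1_cards[OF assms(1,2)] by simp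
qed

context polar begin

text \<open>Length of a route from \<open>p\<close> down to the meet and up to \<open>q\<close>; it
  turns out to be the distance in the covering graph.\<close>

definition gd :: "'a \<Rightarrow> 'a \<Rightarrow> int" where
  "gd p q = int (rk L p) + int (rk L q) - 2 * int (rk L (meet L p q))"

lemma nz_meet: "chart F h \<Longrightarrow> p \<in> F \<Longrightarrow> q \<in> F \<Longrightarrow> nz (h (meet L p q)) = {i \<in> nz (h p). h p i = h q i}"
  by (auto simp: nz_def chart_meet split: if_splits)

lemma rk_meet_chart:
  "chart F h \<Longrightarrow> p \<in> F \<Longrightarrow> q \<in> F \<Longrightarrow> rk L (meet L p q) = card {i \<in> nz (h p). h p i = h q i}"
  using rk_chart[of F h "meet L p q"] frame_meet[of F p q] nz_meet[of F h p q] by (auto simp: chart_def)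

lemma gd_chart: "chart F h \<Longrightarrow> p \<in> F \<Longrightarrow> q \<in> F \<Longrightarrow> gd p q = l1 n (h p) (h q)"
  by (simp add: gd_def rk_chart rk_meet_chart l1_cards chart_S2n)

lemma gd_commute: "p \<in> L \<Longrightarrow> q \<in> L \<Longrightarrow> gd p q = gd q p"
  by (simp add: gd_def meet_commute)

lemma gd_nonneg: "p \<in> L \<Longrightarrow> q \<in> L \<Longrightarrow> gd p q \<ge> 0"
  using rk_mono[of "meet L p q" p] rk_mono[of "meet L p q" q] by (simp add: gd_def meet_in meet_le1 meet_le2)

lemma meet_le_eq: "p \<in> L \<Longrightarrow> q \<in> L \<Longrightarrow> p \<le> q \<Longrightarrow> meet L p q = p"
  by (rule meet_eqI) (auto simp: is_glb_def)

lemma meet_idem [simp]: "p \<in> L \<Longrightarrow> meet L p p = p"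
  by (simp add: meet_le_eq)

lemma gd_le: "p \<in> L \<Longrightarrow> q \<in> L \<Longrightarrow> p \<le> q \<Longrightarrow> gd p q = int (rk L q) - int (rk L p)"
  by (simp add: gd_def meet_le_eq)

text \<open>\<open>R\<close> is faithful on the chains that the meet forms with \<open>x\<close> and
  with \<open>y\<close>, so both legs of the route through the meet keep their length, and the
  triangle inequality does the rest.\<close>

lemma l1_retraction_le_gd:
  assumes R: "\<And>D. is_chain L D \<Longrightarrow> embeds (S \<union> D) R" and xy: "x \<in> L" "y \<in> L"
  shows "l1 n (R x) (R y) \<le> gd x y"
proof -
  have *: "l1 n (R (meet L x y)) (R z) = int (rk L z) - int (rk L (meet L x y))"
    if "z = x \<or> z = y" for z
  proof -
    have z: "z \<in> L" "meet L x y \<le> z" using that xy meet_le1 meet_le2 by auto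
    have e: "embeds (S \<union> {meet L x y, z}) R"
      by (rule R[OF is_chain_pair]) (use z meet_in[OF xy] in auto)
    have "S2_le (R (meet L x y)) (R z)" using embeds_le[OF e, of "meet L x y" z] z(2) by auto
    then show ?thesis
      using l1_le[OF embeds_S2n[OF e] embeds_S2n[OF e], of "meet L x y" z]
        rk_embeds[OF e, of z] rk_embeds[OF e, of "meet L x y"] by auto
  qed
  show ?thesis
    using l1_triangle[of n "R x" "R y" "R (meet L x y)"] *[of x] *[of y]
      l1_commute[of n "R x" "R (meet L x y)"] by (simp add: gd_def)
qed

lemma ex_cover_between:
  assumes xy: "x \<in> L" "y \<in> L" "x < y"
  obtains z where "z \<in> L" "x < z" "z \<le> y" "rk L z = Suc (rk L x)"
proof -
  have ch: "is_chain L {x, y}" using is_chain_pair[of x L y] xy by auto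
  obtain F h where h: "chart F h" "{x, y} \<subseteq> F" using ex_chart_chains[OF ch ch] by metis
  obtain c where c: "\<And>j. j \<le> n \<Longrightarrow> c j \<in> F" "\<And>j. j \<le> n \<Longrightarrow> card (nz (h (c j))) = j"
    "\<And>i j. i \<le> j \<Longrightarrow> j \<le> n \<Longrightarrow> c i \<le> c j" "{x, y} \<subseteq> c ` {..n}"
    using flag_in_frame[OF h ch] by metis
  then obtain i j where ij: "i \<le> n" "x = c i" "j \<le> n" "y = c j" by auto
  have ci: "rk L (c i) = i" if "i \<le> n" for i using rk_chart[OF h(1) c(1)[OF that]] c(2)[OF that] by simp
  have "i < j" using c(3)[of j i] ij xy(3) by (meson leD not_le_imp_less)
  then have *: "c (Suc i) \<in> L" "c i \<le> c (Suc i)" "c (Suc i) \<le> c j" "rk L (c (Suc i)) = Suc i"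
    using c(1,3) ij chart_subset[OF h(1)] ci by auto
  moreover have "c i \<noteq> c (Suc i)" using ci[of i] ij *(4) by auto
  ultimately show ?thesis using that[of "c (Suc i)"] ij ci[of i] by auto
qed

lemma rk_strict_mono: "p \<in> L \<Longrightarrow> q \<in> L \<Longrightarrow> p < q \<Longrightarrow> rk L p < rk L q"
  using rk_mono[of p q] rk_eq_imp_eq[of p q] by (auto simp: less_le)

lemma covers_iff: "covers L x y \<longleftrightarrow> x \<in> L \<and> y \<in> L \<and> x < y \<and> rk L y = Suc (rk L x)"
proof
  assume c: "covers L x y"
  then have xy: "x \<in> L" "y \<in> L" "x < y" by (auto simp: covers_def)
  obtain z where "z \<in> L" "x < z" "z \<le> y" "rk L z = Suc (rk L x)" using ex_cover_between[OF xy] .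
  moreover from this have "z = y" using c by (auto simp: covers_def order_le_less)
  ultimately show "x \<in> L \<and> y \<in> L \<and> x < y \<and> rk L y = Suc (rk L x)" using xy by simp
next
  assume xy: "x \<in> L \<and> y \<in> L \<and> x < y \<and> rk L y = Suc (rk L x)"
  have False if z: "z \<in> L" "x < z" "z < y" for z
  proof -
    have "rk L x < rk L z"
      by (rule rk_strict_mono) (use xy z in auto)
    moreover have "rk L z < rk L y"
      by (rule rk_strict_mono) (use xy z in auto)
    ultimately show False using xy by simp
  qed
  then show "covers L x y" using xy by (auto simp: covers_def)
qed

definition adj :: "'a \<Rightarrow> 'a \<Rightarrow> bool" where
  "adj x y \<longleftrightarrow> covers L x y \<or> covers L y x"

lemma adj_in: "adj x y \<Longrightarrow> x \<in> L \<and> y \<in> L"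
  by (auto simp: adj_def covers_def)

text \<open>Three arbitrary points need not share a frame, but a covering pair is a chain and
  therefore shares one with \<open>z\<close>. This much of the triangle inequality supports an
  induction along walks.\<close>

lemma gd_adj:
  assumes xy: "adj x y" and z: "z \<in> L"
  shows "gd x z \<le> gd y z + 1"
proof -
  have L: "x \<in> L" "y \<in> L" using adj_in xy by auto
  have g1: "gd x y = 1"
    using xy L gd_le[of x y] gd_le[of y x] gd_commute[of x y] unfolding adj_def covers_iff by auto
  have ch: "is_chain L {x, y}" using xy L by (auto simp: adj_def covers_iff is_chain_def)
  obtain F h where h: "chart F h" "{x, y} \<subseteq> F" "{z} \<subseteq> F"
    using ex_chart_chains[OF ch, of "{z}"] z by auto
  then show ?thesis
    using l1_triangle[of n "h x" "h z" "h y"] gd_chart[OF h(1), of x z] gd_chart[OF h(1), of y z]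
      gd_chart[OF h(1), of x y] g1 by simp
qed

lemma gd_le_path: "(adj ^^ k) x y \<Longrightarrow> x \<in> L \<Longrightarrow> y \<in> L \<Longrightarrow> gd x y \<le> int k"
proof (induction k arbitrary: x)
  case 0
  then show ?case by (simp add: gd_def)
next
  case (Suc k)
  then obtain w where w: "adj x w" "(adj ^^ k) w y" by (meson relpowp_Suc_D2)
  then show ?case using Suc.IH[OF w(2)] gd_adj[OF w(1), of y] adj_in[OF w(1)] Suc.prems by simp
qed

lemma path_le:
  assumes "x \<in> L" "y \<in> L" "x \<le> y"
  shows "(adj ^^ (rk L y - rk L x)) x y \<and> (adj ^^ (rk L y - rk L x)) y x"
  using assms
proof (induction "rk L y - rk L x" arbitrary: x)
  case 0
  then have "x = y" using rk_mono[of x y] rk_eq_imp_eq[of x y] by simp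
  then show ?case by simp
next
  case (Suc k)
  then have "x < y" by (auto simp: order_le_less)
  then obtain z where z: "z \<in> L" "x < z" "z \<le> y" "rk L z = Suc (rk L x)"
    using ex_cover_between[of x y] Suc.prems by metis
  have k: "k = rk L y - rk L z" using Suc.hyps(2) z(4) by simp
  have a: "adj x z" "adj z x" using z Suc.prems by (auto simp: adj_def covers_iff)
  have "(adj ^^ k) z y" "(adj ^^ k) y z" using Suc.hyps(1)[OF k z(1) _ z(3)] Suc.prems k by auto
  then have "(adj ^^ Suc k) x y" "(adj ^^ Suc k) y x"
    using relpowp_Suc_I2[of adj x z k y] relpowp_Suc_I[of k adj y z x] a by auto
  then show ?case using Suc.hyps(2) by simp
qed

lemma path_gd:
  assumes "x \<in> L" "y \<in> L"
  shows "(adj ^^ nat (gd x y)) x y"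
proof -
  let ?m = "meet L x y"
  have m: "rk L ?m \<le> rk L x" "rk L ?m \<le> rk L y"
    using rk_mono meet_in meet_le1 meet_le2 assms by auto
  have "nat (gd x y) = (rk L x - rk L ?m) + (rk L y - rk L ?m)"
    using m by (simp add: gd_def)
  moreover have "(adj ^^ (rk L x - rk L ?m)) x ?m" "(adj ^^ (rk L y - rk L ?m)) ?m y"
    using path_le meet_in meet_le1 meet_le2 assms by blast+
  ultimately show ?thesis by (auto simp: relpowp_add)
qed

lemma walk_path:
  assumes "cover_walk L xs" "i \<le> j" "j < length xs"
  shows "(adj ^^ (j - i)) (xs ! i) (xs ! j)"
  unfolding relpowp_fun_conv
  by (rule exI[of _ "\<lambda>m. xs ! (i + m)"]) (use assms in \<open>auto simp: cover_walk_def adj_def\<close>)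

lemma gd_le_walk:
  assumes "cover_walk L xs" "i \<le> j" "j < length xs"
  shows "gd (xs ! i) (xs ! j) \<le> int (j - i)"
proof -
  have "xs ! i \<in> L" "xs ! j \<in> L" using assms nth_mem[of i xs] nth_mem[of j xs] unfolding cover_walk_def by force+
  then show ?thesis using gd_le_path[OF walk_path[OF assms]] by simp
qed

lemma path_walk:
  assumes "p \<in> L" "(adj ^^ a) p u" "(adj ^^ b) u q"
  obtains xs where "cover_walk L xs" "hd xs = p" "last xs = q" "u \<in> set xs" "length xs = Suc (a + b)"
proof -
  obtain f where f: "f 0 = p" "f a = u" "\<And>i. i < a \<Longrightarrow> adj (f i) (f (Suc i))"
    using assms(2) unfolding relpowp_fun_conv by blast
  obtain g where g: "g 0 = u" "g b = q" "\<And>i. i < b \<Longrightarrow> adj (g i) (g (Suc i))"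
    using assms(3) unfolding relpowp_fun_conv by blast
  define e where "e i = (if i \<le> a then f i else g (i - a))" for i
  have e: "adj (e i) (e (Suc i))" if "i < a + b" for i
  proof (cases "i < a")
    case False
    then have "e i = g (i - a)" "e (Suc i) = g (Suc (i - a))"
      using f(2) g(1) by (auto simp: e_def Suc_diff_le)
    then show ?thesis using g(3)[of "i - a"] False that by auto
  qed (simp add: e_def f(3))
  have e0: "e 0 = p" and ea: "e a = u" and eb: "e (a + b) = q"
    using f g by (auto simp: e_def)
  have eL: "e i \<in> L" if "i \<le> a + b" for i
    using that e adj_in e0 assms(1) by (cases i) (auto simp: Suc_le_eq)
  let ?xs = "map e [0..<Suc (a + b)]"
  have "cover_walk L ?xs"
    using e eL by (auto simp: cover_walk_def adj_def simp del: upt_Suc)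
  moreover have "hd ?xs = p" "last ?xs = q" using e0 eb by (auto simp: hd_map last_map simp del: upt_Suc)
  moreover have "u \<in> set ?xs" using ea by (force simp del: upt_Suc)
  ultimately show ?thesis using that[of ?xs] by simp
qed

text \<open>Splitting a shortest walk at \<open>u\<close> bounds both distances from above, while
  their sum cannot fall below \<open>gd p q\<close>. Conversely, routes through the meets
  concatenate to a walk of length \<open>gd p q\<close>. Shortest paths thereby become a metric
  equation.\<close>

lemma Ipq_iff:
  assumes pq: "p \<in> L" "q \<in> L"
  shows "u \<in> Ipq L p q \<longleftrightarrow> u \<in> L \<and> gd p u + gd u q = gd p q"
proof
  assume "u \<in> Ipq L p q"
  then obtain xs where xs: "shortest_path L p q xs" "u \<in> set xs" by (auto simp: Ipq_def)
  then have w: "cover_walk L xs" "hd xs = p" "last xs = q" "xs \<noteq> []"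
    by (auto simp: shortest_path_def cover_walk_def)
  obtain ys where "cover_walk L ys" "hd ys = p" "last ys = q" "length ys = Suc (nat (gd p q) + 0)"
    using path_walk[OF pq(1) path_gd[OF pq], of 0 q] by auto
  then have len: "length xs \<le> Suc (nat (gd p q))"
    using xs(1) by (auto simp: shortest_path_def)
  obtain i where i: "i < length xs" "u = xs ! i" using xs(2) by (auto simp: in_set_conv_nth)
  have uL: "u \<in> L" using xs(2) w(1) by (auto simp: cover_walk_def)
  have "gd p u \<le> int i"
    using gd_le_walk[OF w(1), of 0 i] i w by (simp add: hd_conv_nth)
  moreover have "gd u q \<le> int (length xs - 1 - i)"
    using gd_le_walk[OF w(1), of i "length xs - 1"] i w by (simp add: last_conv_nth)
  moreover have "gd p q \<le> int (nat (gd p u) + nat (gd u q))"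
    by (rule gd_le_path) (use path_gd[OF pq(1) uL] path_gd[OF uL pq(2)] pq in \<open>auto simp: relpowp_add\<close>)
  ultimately show "u \<in> L \<and> gd p u + gd u q = gd p q"
    using uL len i gd_nonneg[OF pq] gd_nonneg[OF pq(1) uL] gd_nonneg[OF uL pq(2)] by auto
next
  assume u: "u \<in> L \<and> gd p u + gd u q = gd p q"
  obtain xs where xs: "cover_walk L xs" "hd xs = p" "last xs = q" "u \<in> set xs"
    "length xs = Suc (nat (gd p u) + nat (gd u q))"
    using path_walk[OF pq(1) path_gd path_gd, of u q] u pq by metis
  have "length xs \<le> length ys" if ys: "cover_walk L ys" "hd ys = p" "last ys = q" for ys
  proof -
    have "ys \<noteq> []" using ys by (auto simp: cover_walk_def)
    then have "gd p q \<le> int (length ys - 1)"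
      using gd_le_walk[OF ys(1), of 0 "length ys - 1"] ys by (simp add: hd_conv_nth last_conv_nth)
    then show ?thesis
      using xs(5) u gd_nonneg[of p u] gd_nonneg[of u q] pq \<open>ys \<noteq> []\<close> by (cases ys) auto
  qed
  then show "u \<in> Ipq L p q" using xs by (auto simp: Ipq_def shortest_path_def)
qed

end

section \<open>Coordinates in the orthoscheme complex\<close>

text \<open>The affine extension of the coordinates \<open>k\<close>: the position of
  \<open>x\<close> in the cube.\<close>

definition pos :: "('a \<Rightarrow> nat \<Rightarrow> int) \<Rightarrow> ('a \<Rightarrow> real) \<Rightarrow> nat \<Rightarrow> real" where
  "pos k x i = (\<Sum>p\<in>supp x. x p * real_of_int (k p i))"

definition ed :: "nat \<Rightarrow> (nat \<Rightarrow> real) \<Rightarrow> (nat \<Rightarrow> real) \<Rightarrow> real" where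
  "ed n a b = L2_set (\<lambda>i. a i - b i) {..<n}"

lemma ed_triangle: "ed n a c \<le> ed n a b + ed n b c"
  unfolding ed_def using L2_set_triangle_ineq[of "\<lambda>i. a i - b i" "\<lambda>i. b i - c i" "{..<n}"] by simp

lemma ed_nonneg [simp]: "0 \<le> ed n a b"
  by (simp add: ed_def)

lemma sum_supp:
  fixes g :: "'a \<Rightarrow> real"
  assumes "finite C" "supp x \<subseteq> C"
  shows "(\<Sum>p\<in>supp x. x p * g p) = (\<Sum>p\<in>C. x p * g p)"
  using assms by (intro sum.mono_neutral_left) (auto simp: supp_def)

lemma pos_eq:
  assumes "finite C" "supp x \<subseteq> C"
  shows "pos k x i = (\<Sum>p\<in>C. x p * real_of_int (k p i))"
  unfolding pos_def by (rule sum_supp[OF assms])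

lemma Kpts_supp: "x \<in> Kpts L \<Longrightarrow> finite (supp x)" "x \<in> Kpts L \<Longrightarrow> is_chain L (supp x)"
    "x \<in> Kpts L \<Longrightarrow> 0 \<le> x p" "x \<in> Kpts L \<Longrightarrow> sum x (supp x) = 1"
    "x \<in> Kpts L \<Longrightarrow> supp x \<subseteq> L"
  by (auto simp: Kpts_def is_chain_def)

lemma Kpts_supp_pos: "x \<in> Kpts L \<Longrightarrow> p \<in> supp x \<Longrightarrow> 0 < x p"
  using Kpts_supp(3)[of x L p] by (auto simp: supp_def)

lemma Kpts_sum: "x \<in> Kpts L \<Longrightarrow> finite C \<Longrightarrow> supp x \<subseteq> C \<Longrightarrow> sum x C = 1"
  using sum_supp[of C x "\<lambda>_. 1"] Kpts_supp(4)[of x L] by simp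

lemma Kpts_supp_ne: "x \<in> Kpts L \<Longrightarrow> supp x \<noteq> {}"
  using Kpts_supp(4)[of x L] by auto

lemma sum_square_expand:
  fixes z :: "'a \<Rightarrow> real"
  shows "(\<Sum>i<n. (\<Sum>p\<in>C. z p * g p i)\<^sup>2) = (\<Sum>p\<in>C. \<Sum>q\<in>C. z p * z q * (\<Sum>i<n. g p i * g q i))"
proof -
  have "(\<Sum>i<n. (\<Sum>p\<in>C. z p * g p i)\<^sup>2) = (\<Sum>i<n. \<Sum>p\<in>C. \<Sum>q\<in>C. z p * z q * (g p i * g q i))"
    by (simp add: power2_eq_square sum_product mult_ac)
  also have "\<dots> = (\<Sum>p\<in>C. \<Sum>i<n. \<Sum>q\<in>C. z p * z q * (g p i * g q i))" by (rule sum.swap)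
  also have "\<dots> = (\<Sum>p\<in>C. \<Sum>q\<in>C. \<Sum>i<n. z p * z q * (g p i * g q i))"
    by (rule sum.cong[OF refl], rule sum.swap)
  finally show ?thesis by (simp add: sum_distrib_left)
qed

lemma sum_square_sip:
  "(\<Sum>i<n. (\<Sum>p\<in>C. z p * real_of_int (k p i))\<^sup>2)
    = (\<Sum>p\<in>C. \<Sum>q\<in>C. z p * z q * real_of_int (sip n (k p) (k q)))"
  by (simp add: sum_square_expand sip_def)

lemma finite_chain_has_max:
  fixes C :: "'a::order set"
  assumes "finite C" "C \<noteq> {}" "\<And>x y. x \<in> C \<Longrightarrow> y \<in> C \<Longrightarrow> x \<le> y \<or> y \<le> x"
  obtains m where "m \<in> C" "\<And>b. b \<in> C \<Longrightarrow> b \<le> m"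
  using finite_has_maximal[OF assms(1,2)] assms(3) by metis

lemma chain_min:
  assumes "finite C" "C \<noteq> {}" "is_chain L C"
  shows "chain_min C \<in> C" "\<And>b. b \<in> C \<Longrightarrow> chain_min C \<le> b"
proof -
  obtain m where m: "m \<in> C" "\<forall>b\<in>C. m \<le> b"
    using finite_has_minimal[OF assms(1,2)] assms(3) unfolding is_chain_def by metis
  have "chain_min C = m"
    unfolding chain_min_def using m by (intro the_equality) (auto intro: order_antisym)
  then show "chain_min C \<in> C" "\<And>b. b \<in> C \<Longrightarrow> chain_min C \<le> b" using m by auto
qed

context polar begin

text \<open>The squared norm of a linear combination depends only on the Gram matrix, which is
  \<open>ip\<close> for both maps. This is how metric and affine statements travel between
  frames.\<close>

lemma sum_square_embeds:
  assumes "embeds G k" "embeds G k'" "C \<subseteq> G"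
  shows "(\<Sum>i<n. (\<Sum>p\<in>C. z p * real_of_int (k p i))\<^sup>2) = (\<Sum>i<n. (\<Sum>p\<in>C. z p * real_of_int (k' p i))\<^sup>2)"
  unfolding sum_square_sip using assms embeds_ip by (intro sum.cong refl) (auto simp: subset_iff)

lemma ed_eq_sum:
  assumes "finite C" "supp x \<subseteq> C" "supp y \<subseteq> C"
  shows "ed n (pos k x) (pos k y) = sqrt (\<Sum>i<n. (\<Sum>p\<in>C. (x p - y p) * real_of_int (k p i))\<^sup>2)"
  by (simp add: ed_def L2_set_def pos_eq[OF assms(1,2)] pos_eq[OF assms(1,3)] sum_subtractf left_diff_distrib)

lemma ed_embeds:
  assumes "embeds G k" "embeds G k'" "x \<in> Kpts L" "y \<in> Kpts L" "supp x \<subseteq> G" "supp y \<subseteq> G"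
  shows "ed n (pos k x) (pos k y) = ed n (pos k' x) (pos k' y)"
  using sum_square_embeds[OF assms(1,2), of "supp x \<union> supp y" "\<lambda>p. x p - y p"] assms
    ed_eq_sum[of "supp x \<union> supp y" x y] Kpts_supp(1)[of x L] Kpts_supp(1)[of y L] by simp

lemma ip_comparable:
  assumes "p \<in> L" "q \<in> L" "p \<le> q \<or> q \<le> p"
  shows "ip p q = int (min (rk L p) (rk L q))"
  using assms ip_le[of p q] ip_le[of q p] ip_commute[of p q] rk_mono[of p q] rk_mono[of q p] by auto

text \<open>The Gram matrix of the orthoscheme vertices is the minimum of the two ranks, lowered by
  the rank of the bottom vertex; that of the sign vectors is the minimum itself. The constant drops
  out because the coefficients of a difference of two convex combinations sum to zero.\<close>

lemma simplex_dist_embeds: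
  assumes ss: "same_simplex L x y" and k: "embeds (supp x \<union> supp y) k"
  shows "simplex_dist n L x y = ed n (pos k x) (pos k y)"
proof -
  let ?C = "supp x \<union> supp y"
  let ?p0 = "chain_min ?C"
  define z where "z p = x p - y p" for p
  define g where "g p j = (if j < rk L p - rk L ?p0 then 1 else 0::real)" for p j
  have K: "x \<in> Kpts L" "y \<in> Kpts L" and ch: "is_chain L ?C" using ss by (auto simp: same_simplex_def)
  have fin: "finite ?C" and ne: "?C \<noteq> {}" using K Kpts_supp(1) Kpts_supp_ne by blast+
  have CL: "p \<in> L" if "p \<in> ?C" for p using ch that by (auto simp: is_chain_def)
  have p0: "rk L ?p0 \<le> rk L p" if "p \<in> ?C" for p
    using chain_min[OF fin ne ch] that rk_mono CL by metis
  have z0: "sum z ?C = 0"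
    using Kpts_sum[OF K(1) fin] Kpts_sum[OF K(2) fin] by (simp add: z_def sum_subtractf)
  have phi: "phi L ?C w j = (\<Sum>p\<in>?C. w p * g p j)" for w j
    unfolding phi_def g_def sum.inter_filter[OF fin] by (rule sum.cong) auto
  have "(\<Sum>j<n. (phi L ?C x j - phi L ?C y j)\<^sup>2) = (\<Sum>j<n. (\<Sum>p\<in>?C. z p * g p j)\<^sup>2)"
    by (simp add: phi z_def sum_subtractf left_diff_distrib)
  also have "\<dots> = (\<Sum>p\<in>?C. \<Sum>q\<in>?C. z p * z q * (\<Sum>j<n. g p j * g q j))"
    by (rule sum_square_expand)
  also have "\<dots> = (\<Sum>p\<in>?C. \<Sum>q\<in>?C. z p * z q * (real (min (rk L p) (rk L q)) - real (rk L ?p0)))"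
  proof (intro sum.cong refl arg_cong2[where f = "(*)"])
    fix p q assume pq: "p \<in> ?C" "q \<in> ?C"
    let ?m = "min (rk L p - rk L ?p0) (rk L q - rk L ?p0)"
    have "(\<Sum>j<n. g p j * g q j) = (\<Sum>j<n. if j < ?m then 1 else 0)"
      by (rule sum.cong) (auto simp: g_def)
    also have "\<dots> = real (card ({..<n} \<inter> {j. j < ?m}))" by (simp add: sum.If_cases)
    also have "{..<n} \<inter> {j. j < ?m} = {..<?m}" using rk_le_n[OF CL[OF pq(1)]] by auto
    finally show "(\<Sum>j<n. g p j * g q j) = real (min (rk L p) (rk L q)) - real (rk L ?p0)"
      using p0[OF pq(1)] p0[OF pq(2)] by (auto simp: min_def of_nat_diff)
  qed
  also have "\<dots> = (\<Sum>p\<in>?C. \<Sum>q\<in>?C. z p * z q * real (min (rk L p) (rk L q))) - real (rk L ?p0) * (sum z ?C * sum z ?C)"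
    unfolding sum_product by (simp only: right_diff_distrib sum_subtractf sum_distrib_left mult_ac)
  also have "\<dots> = (\<Sum>p\<in>?C. \<Sum>q\<in>?C. z p * z q * real_of_int (sip n (k p) (k q)))"
  proof -
    have "real (min (rk L p) (rk L q)) = real_of_int (sip n (k p) (k q))" if "p \<in> ?C" "q \<in> ?C" for p q
      using embeds_ip[OF k that] ip_comparable[OF CL CL, OF that] ch that unfolding is_chain_def by auto
    then show ?thesis using z0 by simp
  qed
  also have "\<dots> = (\<Sum>i<n. (\<Sum>p\<in>?C. z p * real_of_int (k p i))\<^sup>2)"
    by (rule sum_square_sip[symmetric])
  finally show ?thesis
    unfolding simplex_dist_def Let_def using ed_eq_sum[OF fin, of x y k] by (simp add: z_def)
qed

lemma embeds_comparable:
  assumes "embeds G k" "p \<in> G" "q \<in> G" "p \<le> q \<or> q \<le> p" "k p i \<noteq> 0" "k q i \<noteq> 0"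
  shows "k p i = k q i"
  using assms(4)
proof
  assume "p \<le> q"
  then show ?thesis using embeds_le[OF assms(1-3)] assms(5) by (auto simp: S2_le_def)
next
  assume "q \<le> p"
  then show ?thesis using embeds_le[OF assms(1,3,2)] assms(6)[unfolded neq_commute] by (auto simp: S2_le_def)
qed

lemma supp_comparable: "x \<in> Kpts L \<Longrightarrow> p \<in> supp x \<Longrightarrow> q \<in> supp x \<Longrightarrow> p \<le> q \<or> q \<le> p"
  using Kpts_supp(2)[of x L] by (auto simp: is_chain_def)

text \<open>Along a chain a coordinate never changes sign, so nothing cancels in the sum.\<close>

lemma pos_sign:
  assumes k: "embeds G k" and x: "x \<in> Kpts L" "supp x \<subseteq> G" and w: "w \<in> supp x" "k w i \<noteq> 0"
  shows "pos k x i = real_of_int (k w i) * (\<Sum>p\<in>supp x. x p * \<bar>real_of_int (k p i)\<bar>)"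
    and "(\<Sum>p\<in>supp x. x p * \<bar>real_of_int (k p i)\<bar>) > 0"
proof -
  have G: "p \<in> G" if "p \<in> supp x" for p using that x(2) by auto
  have v: "k p i = -1 \<or> k p i = 0 \<or> k p i = 1" if "p \<in> supp x" for p
    using S2n_values[OF embeds_S2n[OF k G[OF that]]] .
  show "pos k x i = real_of_int (k w i) * (\<Sum>p\<in>supp x. x p * \<bar>real_of_int (k p i)\<bar>)"
    unfolding pos_def sum_distrib_left
  proof (rule sum.cong[OF refl])
    fix p assume p: "p \<in> supp x"
    show "x p * real_of_int (k p i) = real_of_int (k w i) * (x p * \<bar>real_of_int (k p i)\<bar>)"
    proof (cases "k p i = 0")
      case False
      then have "k w i = k p i"
        using embeds_comparable[OF k G[OF p] G[OF w(1)] supp_comparable[OF x(1) p w(1)] False w(2)] by simp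
      then show ?thesis using v[OF p] False by auto
    qed simp
  qed
  have "0 < x w * \<bar>real_of_int (k w i)\<bar>" using w Kpts_supp_pos[OF x(1)] by simp
  also have "\<dots> \<le> (\<Sum>p\<in>supp x. x p * \<bar>real_of_int (k p i)\<bar>)"
    using Kpts_supp(1,3)[OF x(1)] w(1) by (intro member_le_sum) auto
  finally show "(\<Sum>p\<in>supp x. x p * \<bar>real_of_int (k p i)\<bar>) > 0" .
qed

lemma pos_sgn:
  assumes k: "embeds G k" and x: "x \<in> Kpts L" "supp x \<subseteq> G" and w: "w \<in> supp x" "k w i \<noteq> 0"
  shows "sgn (pos k x i) = real_of_int (k w i)"
proof -
  have "k w i = -1 \<or> k w i = 1" using S2n_values[OF embeds_S2n[OF k], of w i] x(2) w by auto
  then show ?thesis using pos_sign[OF assms] by (auto simp: sgn_mult)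
qed

lemma abs_pos:
  assumes k: "embeds G k" and x: "x \<in> Kpts L" "supp x \<subseteq> G"
  shows "\<bar>pos k x i\<bar> = (\<Sum>p\<in>supp x. x p * \<bar>real_of_int (k p i)\<bar>)"
proof (cases "\<exists>w\<in>supp x. k w i \<noteq> 0")
  case True
  then obtain w where w: "w \<in> supp x" "k w i \<noteq> 0" by auto
  have "k w i = -1 \<or> k w i = 1" using S2n_values[OF embeds_S2n[OF k], of w i] x(2) w by auto
  then show ?thesis using pos_sign[OF k x w] by (auto simp: abs_mult)
qed (simp add: pos_def)

text \<open>Supports along a chain are nested: a vertex nonzero at \<open>j\<close> must lie above
  \<open>w\<close> and so is nonzero at \<open>i\<close>, and \<open>w\<close> itself makes the
  inequality strict.\<close>

lemma abs_pos_less: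
  assumes k: "embeds G k" and x: "x \<in> Kpts L" "supp x \<subseteq> G" and w: "w \<in> supp x" "k w i \<noteq> 0" "k w j = 0"
  shows "\<bar>pos k x j\<bar> < \<bar>pos k x i\<bar>"
  unfolding abs_pos[OF k x]
proof (rule sum_strict_mono_ex1)
  show "finite (supp x)" by (rule Kpts_supp(1)[OF x(1)])
  have G: "p \<in> G" if "p \<in> supp x" for p using that x(2) by auto
  have v: "k p i = -1 \<or> k p i = 0 \<or> k p i = 1" if "p \<in> supp x" for p i
    using S2n_values[OF embeds_S2n[OF k G[OF that]]] .
  show "\<forall>p\<in>supp x. x p * \<bar>real_of_int (k p j)\<bar> \<le> x p * \<bar>real_of_int (k p i)\<bar>"
  proof
    fix p assume p: "p \<in> supp x"
    have "k p i \<noteq> 0" if "k p j \<noteq> 0"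
    proof -
      have "\<not> p \<le> w" using embeds_le[OF k G[OF p] G[OF w(1)]] that w(3) by (auto simp: S2_le_def)
      then have "S2_le (k w) (k p)"
        using supp_comparable[OF x(1) p w(1)] embeds_le[OF k G[OF w(1)] G[OF p]] by auto
      then show ?thesis using w(2) unfolding S2_le_def by metis
    qed
    then show "x p * \<bar>real_of_int (k p j)\<bar> \<le> x p * \<bar>real_of_int (k p i)\<bar>"
      using v[OF p, of i] v[OF p, of j] Kpts_supp(3)[OF x(1), of p] by auto
  qed
  show "\<exists>p\<in>supp x. x p * \<bar>real_of_int (k p j)\<bar> < x p * \<bar>real_of_int (k p i)\<bar>"
    using w Kpts_supp_pos[OF x(1) w(1)] by (intro bexI[of _ w]) auto
qed

text \<open>The simplices of the cube are cut out by the hyperplanes on which a coordinate vanishes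
  or two coordinates agree in absolute value. Incomparable vertices \<open>p\<close> and
  \<open>q\<close> either conflict in a sign or have private coordinates \<open>i\<close> and
  \<open>j\<close>, which order the absolute values oppositely.\<close>

lemma same_simplexI:
  assumes k: "embeds G k" and x: "x \<in> Kpts L" "supp x \<subseteq> G" and y: "y \<in> Kpts L" "supp y \<subseteq> G"
    and sg: "\<And>i. i < n \<Longrightarrow> pos k x i * pos k y i \<ge> 0"
    and ord: "\<And>i j. i < n \<Longrightarrow> j < n \<Longrightarrow> \<bar>pos k x i\<bar> < \<bar>pos k x j\<bar> \<Longrightarrow> \<bar>pos k y i\<bar> \<le> \<bar>pos k y j\<bar>"
  shows "same_simplex L x y"
proof -
  have main: "p \<le> q \<or> q \<le> p" if p: "p \<in> supp x" and q: "q \<in> supp y" for p q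
  proof -
    have G: "p \<in> G" "q \<in> G" using p q x(2) y(2) by auto
    have S: "k p \<in> S2n n" "k q \<in> S2n n" using G embeds_S2n[OF k] by auto
    have eq: "k p i = k q i" if "k p i \<noteq> 0" "k q i \<noteq> 0" for i
    proof -
      have i: "i < n" using that(1) nz_S2n[OF S(1)] by (auto simp: nz_def)
      have "sgn (pos k x i * pos k y i) = real_of_int (k p i * k q i)"
        using pos_sgn[OF k x p that(1)] pos_sgn[OF k y q that(2)] by (simp add: sgn_mult)
      moreover have "sgn (pos k x i * pos k y i) \<ge> 0" using sg[OF i] by (simp add: sgn_real_def)
      ultimately have "k p i * k q i \<ge> 0" by linarith
      then show ?thesis using that S2n_values[OF S(1), of i] S2n_values[OF S(2), of i] by auto
    qed
    show ?thesis
    proof (rule ccontr)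
      assume n: "\<not> ?thesis"
      then have "\<not> S2_le (k p) (k q)" "\<not> S2_le (k q) (k p)"
        using embeds_le[OF k G] embeds_le[OF k G(2,1)] by auto
      then obtain i j where i: "k p i \<noteq> 0" "k p i \<noteq> k q i" and j: "k q j \<noteq> 0" "k q j \<noteq> k p j"
        unfolding S2_le_def by auto
      have i0: "k q i = 0" and j0: "k p j = 0" using eq[of i] eq[of j] i j by metis+
      have "i < n" "j < n" using i j nz_S2n[OF S(1)] nz_S2n[OF S(2)] by (auto simp: nz_def)
      then show False
        using abs_pos_less[OF k x p i(1) j0] abs_pos_less[OF k y q j(1) i0] ord[of j i] by simp
    qed
  qed
  have "is_chain L (supp x \<union> supp y)"
    using main supp_comparable[OF x(1)] supp_comparable[OF y(1)] Kpts_supp(5)[OF x(1)] Kpts_supp(5)[OF y(1)]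
    unfolding is_chain_def by (metis Un_iff Un_least)
  then show ?thesis using x y by (simp add: same_simplex_def)
qed

text \<open>Equal positions force a common simplex, and the vertices of a chain are affinely
  independent: the largest vertex at which the weights differ has a coordinate in which all other
  such vertices vanish.\<close>

lemma pos_inj:
  assumes k: "embeds G k" and x: "x \<in> Kpts L" "supp x \<subseteq> G" and y: "y \<in> Kpts L" "supp y \<subseteq> G"
    and eq: "\<And>i. i < n \<Longrightarrow> pos k x i = pos k y i"
  shows "x = y"
proof (rule ccontr)
  assume ne: "x \<noteq> y"
  let ?C = "supp x \<union> supp y"
  have ss: "same_simplex L x y" by (rule same_simplexI[OF k x y]) (auto simp: eq)
  have fin: "finite ?C" using Kpts_supp(1) x y by auto
  have G: "p \<in> G" if "p \<in> ?C" for p using that x y by auto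
  define z where "z p = x p - y p" for p
  define S where "S = {p \<in> ?C. z p \<noteq> 0}"
  have S: "finite S" "S \<subseteq> ?C" using fin by (auto simp: S_def)
  have cmp: "p \<le> q \<or> q \<le> p" if "p \<in> ?C" "q \<in> ?C" for p q
    using ss that by (auto simp: same_simplex_def is_chain_def)
  have sumS: "(\<Sum>p\<in>?C. z p * g p) = (\<Sum>p\<in>S. z p * g p)" for g :: "'a \<Rightarrow> real"
    using fin by (intro sum.mono_neutral_right) (auto simp: S_def)
  have s0: "sum z S = 0"
    using sumS[of "\<lambda>_. 1"] Kpts_sum[OF x(1) fin] Kpts_sum[OF y(1) fin] by (simp add: z_def sum_subtractf)
  have si: "(\<Sum>p\<in>S. z p * real_of_int (k p i)) = 0" if "i < n" for i
    using sumS[of "\<lambda>p. real_of_int (k p i)"] eq[OF that] pos_eq[OF fin, of x k i] pos_eq[OF fin, of y k i]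
    by (simp add: z_def sum_subtractf left_diff_distrib)
  obtain p where "x p \<noteq> y p" using ne by auto
  then have "p \<in> S" by (auto simp: S_def z_def supp_def)
  then have "S \<noteq> {}" by auto
  then obtain m where m: "m \<in> S" "\<And>b. b \<in> S \<Longrightarrow> b \<le> m"
    using finite_chain_has_max[OF S(1)] cmp S(2) by (metis subset_iff)
  have zm: "z m \<noteq> 0" using m by (simp add: S_def)
  show False
  \<comment> \<open>A lone \<open>m\<close> may be the zero vector, so this case uses the sum of the
    coefficients instead of a coordinate.\<close>
  proof (cases "S = {m}")
    case True
    then show False using s0 zm by simp
  next
    case False
    then have ne': "S - {m} \<noteq> {}" using m by auto
    have fS: "finite (S - {m})" using S(1) by simp
    obtain m' where m': "m' \<in> S - {m}" "\<And>b. b \<in> S - {m} \<Longrightarrow> b \<le> m'"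
      by (rule finite_chain_has_max[OF fS ne']) (use cmp S(2) in blast)+
    have mG: "m \<in> G" "m' \<in> G" using m m' S G by auto
    have "\<not> m \<le> m'" using m(2)[of m'] m'(1) by (auto dest: order_antisym)
    then have "\<not> S2_le (k m) (k m')" "S2_le (k m') (k m)"
      using embeds_le[OF k mG] embeds_le[OF k mG(2,1)] m m' by auto
    moreover from this(1) obtain i where "k m i \<noteq> 0" "k m i \<noteq> k m' i" by (auto simp: S2_le_def)
    ultimately have i: "k m i \<noteq> 0" "k m' i = 0" by (auto simp: S2_le_def)
    have "k p i = 0" if "p \<in> S" "p \<noteq> m" for p
    proof -
      have p: "p \<in> ?C" "p \<le> m'" using that m'(2)[of p] S(2) by auto
      then have "S2_le (k p) (k m')" using embeds_le[OF k G[OF p(1)] mG(2)] by simp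
      then show ?thesis using i(2) by (simp add: S2_le_def) (metis)
    qed
    then have "(\<Sum>p\<in>S. z p * real_of_int (k p i)) = (\<Sum>p\<in>S. if p = m then z m * real_of_int (k m i) else 0)"
      by (intro sum.cong) auto
    moreover have "i < n" using i nz_S2n[OF embeds_S2n[OF k mG(1)]] by (auto simp: nz_def)
    ultimately show False using si[of i] S m zm i by (simp add: sum.delta)
  qed
qed

end

text \<open>The strings of points in \<open>Kdist\<close>, generated step by step, so that
  concatenation and length estimates are inductions instead of index computations on lists.\<close>

inductive plen :: "nat \<Rightarrow> 'a::order set \<Rightarrow> ('a \<Rightarrow> real) \<Rightarrow> ('a \<Rightarrow> real) \<Rightarrow> real \<Rightarrow> bool"
  for n L where
  plen_refl: "plen n L x x 0"
| plen_step: "same_simplex L x y \<Longrightarrow> plen n L y z d \<Longrightarrow> plen n L x z (simplex_dist n L x y + d)"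

lemma plen_trans: "plen n L x y d \<Longrightarrow> plen n L y z e \<Longrightarrow> plen n L x z (d + e)"
  by (induction rule: plen.induct) (auto simp: add.assoc intro: plen_step)

lemma plen_single: "same_simplex L x y \<Longrightarrow> plen n L x y (simplex_dist n L x y)"
  using plen_step[OF _ plen_refl] by fastforce

lemma simplex_dist_nonneg: "simplex_dist n L x y \<ge> 0"
  unfolding simplex_dist_def Let_def by (simp add: sum_nonneg)

lemma plen_nonneg: "plen n L x y d \<Longrightarrow> 0 \<le> d"
  by (induction rule: plen.induct) (auto simp: simplex_dist_nonneg)

lemma plen_of_list:
  assumes "xs \<noteq> []" "\<forall>i. Suc i < length xs \<longrightarrow> same_simplex L (xs!i) (xs!Suc i)"
  shows "plen n L (hd xs) (last xs) (\<Sum>i<length xs - 1. simplex_dist n L (xs!i) (xs!Suc i))"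
  using assms
proof (induction xs rule: induct_list012)
  case (3 x y zs)
  have "same_simplex L ((y # zs) ! i) ((y # zs) ! Suc i)" if "Suc i < length (y # zs)" for i
    using 3(4)[rule_format, of "Suc i"] that by simp
  then have "plen n L y (last (y # zs)) (\<Sum>i<length zs. simplex_dist n L ((y # zs)!i) ((y # zs)!Suc i))"
    using 3(2) by simp
  moreover have "same_simplex L x y" using 3(4)[rule_format, of 0] by simp
  ultimately show ?case
    using plen_step[of L x y n "last (y # zs)"] by (simp add: sum.lessThan_Suc_shift del: sum.lessThan_Suc)
qed (auto intro: plen_refl)

lemma list_of_plen:
  "plen n L x y d \<Longrightarrow> \<exists>xs. xs \<noteq> [] \<and> hd xs = x \<and> last xs = y
    \<and> (\<forall>i. Suc i < length xs \<longrightarrow> same_simplex L (xs!i) (xs!Suc i))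
    \<and> d = (\<Sum>i<length xs - 1. simplex_dist n L (xs!i) (xs!Suc i))"
proof (induction rule: plen.induct)
  case (plen_refl x)
  show ?case by (rule exI[of _ "[x]"]) simp
next
  case (plen_step x y z d)
  then obtain xs where xs: "xs \<noteq> []" "hd xs = y" "last xs = z"
    "\<forall>i. Suc i < length xs \<longrightarrow> same_simplex L (xs!i) (xs!Suc i)"
    "d = (\<Sum>i<length xs - 1. simplex_dist n L (xs!i) (xs!Suc i))" by auto
  then obtain ys where ys: "xs = y # ys" by (cases xs) auto
  have "same_simplex L ((x # xs) ! i) ((x # xs) ! Suc i)" if "Suc i < length (x # xs)" for i
    using that xs(4) plen_step(1) ys by (cases i) auto
  then show ?case
    using xs(1,3,5) ys
    by (intro exI[of _ "x # xs"]) (auto simp: sum.lessThan_Suc_shift simp del: sum.lessThan_Suc)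
qed

lemma Kdist_plen: "Kdist n L x y = Inf {d. plen n L x y d}"
proof -
  have "{(\<Sum>i<length xs - 1. simplex_dist n L (xs!i) (xs!Suc i)) | xs.
      xs \<noteq> [] \<and> hd xs = x \<and> last xs = y \<and>
      (\<forall>i. Suc i < length xs \<longrightarrow> same_simplex L (xs!i) (xs!Suc i))} = {d. plen n L x y d}"
    using plen_of_list[of _ L n] list_of_plen[of n L x y] by auto
  then show ?thesis by (simp add: Kdist_def)
qed

lemma Kdist_le: "plen n L x y d \<Longrightarrow> Kdist n L x y \<le> d"
  unfolding Kdist_plen by (rule cInf_lower) (auto intro!: bdd_belowI[of _ 0] plen_nonneg)

context polar begin

text \<open>\<open>R\<close> is isometric on the simplex spanned by any chain, so it preserves the
  length of each step, and the image string is at least as long as the straight distance.\<close>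

lemma plen_lower:
  assumes R: "\<And>D. is_chain L D \<Longrightarrow> embeds (S \<union> D) R"
  shows "plen n L x y d \<Longrightarrow> ed n (pos R x) (pos R y) \<le> d"
proof (induction rule: plen.induct)
  case (plen_refl x)
  show ?case by (simp add: ed_def L2_set_def)
next
  case (plen_step x y z d)
  have "embeds (supp x \<union> supp y) R"
    using embeds_subset[OF R[of "supp x \<union> supp y"]] plen_step(1) by (auto simp: same_simplex_def)
  then show ?case
    using simplex_dist_embeds[OF plen_step(1)] plen_step.IH ed_triangle[of n "pos R x" "pos R z" "pos R y"] by simp
qed

end

section \<open>Uncrossing and convexity on a frame\<close>

text \<open>Weights are functions on the whole type; pinning them to 0 outside \<open>A\<close>
  makes the box a product of compact sets.\<close>

lemma compact_weights:
  fixes A :: "'a set"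
  shows "compact {l :: 'a \<Rightarrow> real. \<forall>p. l p \<in> (if p \<in> A then {0..1} else {0})}" (is "compact ?K")
proof -
  have "?K = PiE UNIV (\<lambda>p. if p \<in> A then {0..1} else {0})" by (auto simp: PiE_def Pi_def)
  moreover have "compactin (product_topology (\<lambda>_. euclidean) UNIV) (PiE UNIV (\<lambda>p. if p \<in> A then {0..1::real} else {0}))"
    unfolding compactin_PiE by auto
  ultimately show ?thesis by (simp add: euclidean_product_topology)
qed

definition weights :: "'a set \<Rightarrow> ('a \<Rightarrow> real) \<Rightarrow> bool" where
  "weights A l \<longleftrightarrow> (\<forall>p. 0 \<le> l p) \<and> (\<forall>p. p \<notin> A \<longrightarrow> l p = 0) \<and> sum l A = 1"

text \<open>\<open>g\<close> is only bounded, not minimized, so a single linear functional decides: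
  any move that keeps the position, does not increase \<open>g\<close> and raises
  \<open>\<phi>\<close> contradicts the maximum.\<close>

lemma weights_maximizer:
  fixes A :: "'a set" and h :: "'a \<Rightarrow> nat \<Rightarrow> real" and g \<phi> :: "'a \<Rightarrow> real"
  assumes "finite A" and l0: "weights A l0"
  obtains l where "weights A l"
    "\<forall>i<n. (\<Sum>p\<in>A. l p * h p i) = (\<Sum>p\<in>A. l0 p * h p i)"
    "(\<Sum>p\<in>A. l p * g p) \<le> (\<Sum>p\<in>A. l0 p * g p)"
    "\<forall>l'. weights A l' \<and> (\<forall>i<n. (\<Sum>p\<in>A. l' p * h p i) = (\<Sum>p\<in>A. l0 p * h p i))
      \<and> (\<Sum>p\<in>A. l' p * g p) \<le> (\<Sum>p\<in>A. l0 p * g p) \<longrightarrow> (\<Sum>p\<in>A. l' p * \<phi> p) \<le> (\<Sum>p\<in>A. l p * \<phi> p)"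
proof -
  let ?B = "{l :: 'a \<Rightarrow> real. \<forall>p. l p \<in> (if p \<in> A then {0..1} else {0})}"
  let ?C = "{l :: 'a \<Rightarrow> real. sum l A = 1 \<and> (\<forall>i. i < n \<longrightarrow> (\<Sum>p\<in>A. l p * h p i) = (\<Sum>p\<in>A. l0 p * h p i))
      \<and> (\<Sum>p\<in>A. l p * g p) \<le> (\<Sum>p\<in>A. l0 p * g p)}"
  have cont: "continuous_on S (\<lambda>l :: 'a \<Rightarrow> real. \<Sum>p\<in>A. l p * u p)" for u S
    by (intro continuous_intros continuous_on_subset[OF continuous_on_product_coordinates]) auto
  have cont1: "continuous_on S (\<lambda>l :: 'a \<Rightarrow> real. sum l A)" for S
    using cont[of S "\<lambda>_. 1"] by simp
  have "closed ?C"
    by (intro closed_Collect_conj closed_Collect_all closed_Collect_imp closed_Collect_eq closed_Collect_le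
        open_Collect_const cont cont1 continuous_on_const)
  then have "compact (?B \<inter> ?C)" by (rule compact_Int_closed[OF compact_weights])
  have B: "l \<in> ?B \<longleftrightarrow> (\<forall>p. 0 \<le> l p) \<and> (\<forall>p. p \<notin> A \<longrightarrow> l p = 0)" if "sum l A = 1" for l
  proof
    assume *: "(\<forall>p. 0 \<le> l p) \<and> (\<forall>p. p \<notin> A \<longrightarrow> l p = 0)"
    have "l p \<le> 1" if "p \<in> A" for p
      using member_le_sum[OF that, of l] * assms(1) \<open>sum l A = 1\<close> by simp
    then show "l \<in> ?B" using * by auto
  next
    assume *: "l \<in> ?B"
    have "0 \<le> l p" for p using *[THEN CollectD, rule_format, of p] by (auto split: if_splits)
    moreover have "l p = 0" if "p \<notin> A" for p using *[THEN CollectD, rule_format, of p] that by auto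
    ultimately show "(\<forall>p. 0 \<le> l p) \<and> (\<forall>p. p \<notin> A \<longrightarrow> l p = 0)" by blast
  qed
  have "l0 \<in> ?B \<inter> ?C" using B[of l0] l0 by (simp add: weights_def)
  then have "\<exists>l\<in>?B \<inter> ?C. \<forall>l'\<in>?B \<inter> ?C. (\<Sum>p\<in>A. l' p * \<phi> p) \<le> (\<Sum>p\<in>A. l p * \<phi> p)"
    by (intro continuous_attains_sup[OF \<open>compact (?B \<inter> ?C)\<close> _ cont]) blast
  then obtain l where l: "l \<in> ?B" "l \<in> ?C"
    and mx: "\<And>l'. l' \<in> ?B \<Longrightarrow> l' \<in> ?C \<Longrightarrow> (\<Sum>p\<in>A. l' p * \<phi> p) \<le> (\<Sum>p\<in>A. l p * \<phi> p)"
    by blast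
  have B': "weights A l \<longleftrightarrow> l \<in> ?B \<and> sum l A = 1" for l
    unfolding weights_def using B[of l] by blast
  show ?thesis
    by (rule that[of l]) (use l mx B' in auto)
qed

section \<open>Joins of two elements in frame coordinates\<close>

context polar begin

definition bjoin :: "'a set \<Rightarrow> ('a \<Rightarrow> nat \<Rightarrow> int) \<Rightarrow> 'a \<Rightarrow> 'a \<Rightarrow> 'a" where
  "bjoin F h p q = inv_into F h
    (\<lambda>i. if h p i = 0 then h q i else if h q i = 0 \<or> h q i = h p i then h p i else 0)"

definition ujoin :: "'a set \<Rightarrow> ('a \<Rightarrow> nat \<Rightarrow> int) \<Rightarrow> 'a \<Rightarrow> 'a \<Rightarrow> 'a" where
  "ujoin F h p q = inv_into F h (\<lambda>i. if h p i = 0 then h q i else h p i)"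

lemma chart_inv:
  assumes "chart F h" "v \<in> S2n n"
  shows "inv_into F h v \<in> F" "h (inv_into F h v) = v"
proof -
  have "v \<in> h ` F" using chart_bij[OF assms(1)] assms(2) by (simp add: bij_betw_def)
  then show "inv_into F h v \<in> F" "h (inv_into F h v) = v"
    by (auto intro: inv_into_into f_inv_into_f)
qed

lemma bjoin:
  assumes "chart F h" "p \<in> F" "q \<in> F"
  shows "bjoin F h p q \<in> F" "h (bjoin F h p q) i =
    (if h p i = 0 then h q i else if h q i = 0 \<or> h q i = h p i then h p i else 0)"
proof -
  have "(\<lambda>i. if h p i = 0 then h q i else if h q i = 0 \<or> h q i = h p i then h p i else 0) \<in> S2n n"
    using S2n_values[OF chart_S2n[OF assms(1,2)]] S2n_values[OF chart_S2n[OF assms(1,3)]]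
      chart_S2n[OF assms(1,2)] chart_S2n[OF assms(1,3)] by (intro S2nI) (auto simp: S2n_def)
  then show "bjoin F h p q \<in> F" "h (bjoin F h p q) i =
    (if h p i = 0 then h q i else if h q i = 0 \<or> h q i = h p i then h p i else 0)"
    unfolding bjoin_def using chart_inv[OF assms(1)] by auto
qed

lemma ujoin:
  assumes "chart F h" "p \<in> F" "q \<in> F"
  shows "ujoin F h p q \<in> F" "h (ujoin F h p q) i = (if h p i = 0 then h q i else h p i)"
proof -
  have "(\<lambda>i. if h p i = 0 then h q i else h p i) \<in> S2n n"
    using S2n_values[OF chart_S2n[OF assms(1,2)]] S2n_values[OF chart_S2n[OF assms(1,3)]]
      chart_S2n[OF assms(1,2)] chart_S2n[OF assms(1,3)] by (intro S2nI) (auto simp: S2n_def)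
  then show "ujoin F h p q \<in> F" "h (ujoin F h p q) i = (if h p i = 0 then h q i else h p i)"
    unfolding ujoin_def using chart_inv[OF assms(1)] by auto
qed

text \<open>\<open>a\<close> counts the coordinates with equal nonzero signs, \<open>b\<close> those
  with opposite signs, \<open>c\<close> and \<open>d\<close> those that are nonzero in
  \<open>p\<close> only and in \<open>q\<close> only. Rank computations reduce to arithmetic in
  these numbers.\<close>

lemma rank_decomposition:
  assumes h: "chart F h" and pq: "p \<in> F" "q \<in> F"
  obtains a b c d where "rk L p = a + b + c" "rk L q = a + b + d" "rk L (meet L p q) = a"
    "rk L (bjoin F h p q) = a + c + d" "rk L (ujoin F h p q) = a + b + c + d"
    "a + b + c + d \<le> n" "b = 0 \<Longrightarrow> c = 0 \<Longrightarrow> p \<le> q" "b = 0 \<Longrightarrow> d = 0 \<Longrightarrow> q \<le> p"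
    "b = 0 \<longleftrightarrow> ujoin F h p q = ujoin F h q p"
proof -
  let ?v = "h p" and ?w = "h q"
  have S: "?v \<in> S2n n" "?w \<in> S2n n" using chart_S2n[OF h] pq by auto
  define A where "A = {i \<in> nz ?v. ?v i = ?w i}"
  define B where "B = {i \<in> nz ?v. ?w i \<noteq> 0 \<and> ?v i \<noteq> ?w i}"
  define C where "C = {i \<in> nz ?v. ?w i = 0}"
  define D where "D = {i \<in> nz ?w. ?v i = 0}"
  note defs = A_def B_def C_def D_def
  have fin: "finite A" "finite B" "finite C" "finite D"
    using finite_nz[OF S(1)] finite_nz[OF S(2)] by (auto simp: defs)
  have disj: "A \<inter> B = {}" "(A \<union> B) \<inter> C = {}" "(A \<union> B) \<inter> D = {}" "A \<inter> C = {}" "(A \<union> C) \<inter> D = {}"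
    "(A \<union> B \<union> C) \<inter> D = {}"
    by (auto simp: defs nz_def)
  have "nz ?v = A \<union> B \<union> C" "nz ?w = A \<union> B \<union> D" by (auto simp: defs nz_def)
  then have 1: "rk L p = card A + card B + card C" "rk L q = card A + card B + card D"
    using rk_chart[OF h] pq fin disj by (auto simp: card_Un_disjoint)
  have 2: "rk L (meet L p q) = card A" using rk_meet_chart[OF h pq] by (simp add: A_def)
  have "nz (h (bjoin F h p q)) = A \<union> C \<union> D"
    using bjoin(2)[OF h pq] by (auto simp: defs nz_def split: if_splits)
  then have 3: "rk L (bjoin F h p q) = card A + card C + card D"
    using rk_chart[OF h bjoin(1)[OF h pq]] fin disj by (auto simp: card_Un_disjoint)
  have nu: "nz (h (ujoin F h p q)) = A \<union> B \<union> C \<union> D"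
    using ujoin(2)[OF h pq] by (auto simp: defs nz_def split: if_splits)
  then have 4: "rk L (ujoin F h p q) = card A + card B + card C + card D"
    using rk_chart[OF h ujoin(1)[OF h pq]] fin disj by (auto simp: card_Un_disjoint)
  have 5: "card A + card B + card C + card D \<le> n"
    using rk_le_n[of "ujoin F h p q"] ujoin(1)[OF h pq] chart_subset[OF h] 4 by auto
  have 6: "p \<le> q" if "card B = 0" "card C = 0"
  proof -
    have "B = {}" "C = {}" using that fin by auto
    then show ?thesis using chart_le[OF h pq] by (auto simp: defs nz_def S2_le_def)
  qed
  have 7: "q \<le> p" if "card B = 0" "card D = 0"
  proof -
    have "B = {}" "D = {}" using that fin by auto
    then have "\<And>i. h q i = 0 \<or> h q i = h p i" by (auto simp: defs nz_def)
    then show ?thesis using chart_le[OF h pq(2,1)] by (simp add: S2_le_def)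
  qed
  have 8: "card B = 0 \<longleftrightarrow> ujoin F h p q = ujoin F h q p"
  proof
    assume "card B = 0"
    then have "B = {}" using fin by auto
    then have "h (ujoin F h p q) i = h (ujoin F h q p) i" for i
      using ujoin(2)[OF h pq] ujoin(2)[OF h pq(2,1)] by (auto simp: defs nz_def)
    then show "ujoin F h p q = ujoin F h q p"
      using chart_inj[OF h ujoin(1)[OF h pq] ujoin(1)[OF h pq(2,1)]] by auto
  next
    assume "ujoin F h p q = ujoin F h q p"
    then have "(if h p i = 0 then h q i else h p i) = (if h q i = 0 then h p i else h q i)" for i
      using ujoin(2)[OF h pq, of i] ujoin(2)[OF h pq(2,1), of i] by simp
    then have "B = {}" by (auto simp: defs nz_def) metis
    then show "card B = 0" by simp
  qed
  show ?thesis using that[OF 1 2 3 4 5 6 7 8] by blast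
qed

lemma meet_bjoin_sum:
  assumes h: "chart F h" and pq: "p \<in> F" "q \<in> F"
  shows "h p i + h q i = h (meet L p q) i + h (bjoin F h p q) i"
  using chart_meet[OF h pq] bjoin(2)[OF h pq] S2n_values[OF chart_S2n[OF h pq(1)], of i]
    S2n_values[OF chart_S2n[OF h pq(2)], of i] by auto

text \<open>With \<open>s\<close> for \<open>n + 1\<close> minus \<open>a + b + c + d\<close>, the
  right side exceeds the left by \<open>2bb + 2b(c + d + 2s) + 2cd\<close>. For \<open>b = 0\<close>
  this is strict convexity in the rank; opposite signs lower the total rank by \<open>2b\<close>,
  which a decreasing function rewards.\<close>

lemma rank_square_strict:
  assumes h: "chart F h" and pq: "p \<in> F" "q \<in> F" and nc: "\<not> p \<le> q" "\<not> q \<le> p"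
  defines "\<phi> \<equiv> \<lambda>p. (real (n + 1) - real (rk L p))\<^sup>2"
  shows "\<phi> p + \<phi> q < \<phi> (meet L p q) + \<phi> (bjoin F h p q)"
proof -
  obtain a b c d where r: "rk L p = a + b + c" "rk L q = a + b + d" "rk L (meet L p q) = a"
    "rk L (bjoin F h p q) = a + c + d" "rk L (ujoin F h p q) = a + b + c + d"
    "a + b + c + d \<le> n" "b = 0 \<Longrightarrow> c = 0 \<Longrightarrow> p \<le> q" "b = 0 \<Longrightarrow> d = 0 \<Longrightarrow> q \<le> p"
    using rank_decomposition[OF h pq] by metis
  define s where "s = n + 1 - (a + b + c + d)"
  have s: "n + 1 = a + b + c + d + s" "s > 0" using r(6) by (auto simp: s_def)
  have "b > 0 \<or> (c > 0 \<and> d > 0)" using r(7,8) nc by auto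
  then have "0 < 2 * real b * real b + 2 * real b * (real c + real d + 2 * real s) + 2 * real c * real d"
  proof
    assume "b > 0"
    then have "0 < real b * real b" by simp
    moreover have "0 \<le> real b * (real c + real d + 2 * real s)" "0 \<le> real c * real d" by simp_all
    ultimately show ?thesis by linarith
  next
    assume "c > 0 \<and> d > 0"
    then have "0 < real c * real d" by simp
    moreover have "0 \<le> real b * (real c + real d + 2 * real s)" "0 \<le> real b * real b" by simp_all
    ultimately show ?thesis by linarith
  qed
  then show ?thesis
    unfolding \<phi>_def s(1) r by (simp add: power2_eq_square algebra_simps)
qed

text \<open>Uncrossing: a representation of a point by arbitrary weights on a frame that maximises
  the strictly supermodular potential among all representations of no larger value is
  supported on a chain.\<close>

lemma uncross:
  assumes h: "chart F h" and A: "A \<subseteq> F"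
    and closed: "\<And>p q. p \<in> A \<Longrightarrow> q \<in> A \<Longrightarrow> meet L p q \<in> A \<and> bjoin F h p q \<in> A"
    and sub: "\<And>p q. p \<in> A \<Longrightarrow> q \<in> A \<Longrightarrow> g (meet L p q) + g (bjoin F h p q) \<le> g p + g q"
    and l0: "weights A l0"
  obtains x where "x \<in> Kpts L" "supp x \<subseteq> A" "\<And>i. pos h x i = (\<Sum>p\<in>A. l0 p * real_of_int (h p i))"
    "(\<Sum>p\<in>A. x p * g p) \<le> (\<Sum>p\<in>A. l0 p * g p)"
proof -
  have fin: "finite A" using A chart_finite[OF h] finite_subset by blast
  define \<phi> where "\<phi> p = (real (n + 1) - real (rk L p))\<^sup>2" for p
  obtain l where lw: "weights A l"
    and l: "\<forall>i<n. (\<Sum>p\<in>A. l p * real_of_int (h p i)) = (\<Sum>p\<in>A. l0 p * real_of_int (h p i))"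
    "(\<Sum>p\<in>A. l p * g p) \<le> (\<Sum>p\<in>A. l0 p * g p)"
    and mx: "\<forall>l'. weights A l' \<and> (\<forall>i<n. (\<Sum>p\<in>A. l' p * real_of_int (h p i)) = (\<Sum>p\<in>A. l0 p * real_of_int (h p i)))
      \<and> (\<Sum>p\<in>A. l' p * g p) \<le> (\<Sum>p\<in>A. l0 p * g p) \<longrightarrow> (\<Sum>p\<in>A. l' p * \<phi> p) \<le> (\<Sum>p\<in>A. l p * \<phi> p)"
    by (rule weights_maximizer[OF fin l0, of n "\<lambda>p i. real_of_int (h p i)" g \<phi>])
  have l1: "0 \<le> l p" for p using lw by (simp add: weights_def)
  have l2: "l p = 0" if "p \<notin> A" for p using lw that by (simp add: weights_def)
  have l3: "sum l A = 1" using lw by (simp add: weights_def)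
  have suppA: "supp l \<subseteq> A" using l2 by (auto simp: supp_def)
  have cmp: "p \<le> q \<or> q \<le> p" if p: "p \<in> supp l" and q: "q \<in> supp l" for p q
  proof (rule ccontr)
    assume nc: "\<not> ?thesis"
    have pqA: "p \<in> A" "q \<in> A" using p q suppA by auto
    have pqF: "p \<in> F" "q \<in> F" using pqA A by auto
    have ne: "p \<noteq> q" using nc by auto
    let ?m = "meet L p q" and ?j = "bjoin F h p q"
    have mj: "?m \<in> A" "?j \<in> A" using closed[OF pqA] by auto
    define \<epsilon> where "\<epsilon> = min (l p) (l q)"
    have \<epsilon>: "\<epsilon> > 0" "\<epsilon> \<le> l p" "\<epsilon> \<le> l q"
      using p q l1[of p] l1[of q] by (auto simp: \<epsilon>_def supp_def)
    \<comment> \<open>Moves the weight \<open>\<epsilon>\<close> from \<open>p\<close> and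
      \<open>q\<close> to their meet and bjoin. The terms are additive because meet and bjoin may
      coincide; the position is unchanged by \<open>meet_bjoin_sum\<close>.\<close>
    define l' where "l' x = l x - (if x = p then \<epsilon> else 0) - (if x = q then \<epsilon> else 0)
      + (if x = ?m then \<epsilon> else 0) + (if x = ?j then \<epsilon> else 0)" for x
    have sums: "(\<Sum>x\<in>A. l' x * u x) = (\<Sum>x\<in>A. l x * u x) + \<epsilon> * (u ?m + u ?j - u p - u q)" for u
    proof -
      have "(\<Sum>x\<in>A. l' x * u x) = (\<Sum>x\<in>A. l x * u x - (if x = p then \<epsilon> * u p else 0)
        - (if x = q then \<epsilon> * u q else 0) + (if x = ?m then \<epsilon> * u ?m else 0) + (if x = ?j then \<epsilon> * u ?j else 0))"
        by (rule sum.cong) (simp_all add: l'_def algebra_simps)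
      also have "\<dots> = (\<Sum>x\<in>A. l x * u x) - \<epsilon> * u p - \<epsilon> * u q + \<epsilon> * u ?m + \<epsilon> * u ?j"
        using pqA mj fin by (simp only: sum.distrib sum_subtractf sum.delta) simp
      finally show ?thesis by (simp add: algebra_simps)
    qed
    have "(\<Sum>x\<in>A. l' x * \<phi> x) \<le> (\<Sum>x\<in>A. l x * \<phi> x)"
    proof (rule mx[rule_format], intro conjI allI impI)
      have "0 \<le> l' x" for x using l1[of x] \<epsilon> ne by (auto simp: l'_def)
      moreover have "l' x = 0" if "x \<notin> A" for x using l2[OF that] that pqA mj by (auto simp: l'_def)
      moreover have "sum l' A = 1" using sums[of "\<lambda>_. 1"] l3 by simp
      ultimately show "weights A l'" by (simp add: weights_def)
      show "(\<Sum>p\<in>A. l' p * real_of_int (h p i)) = (\<Sum>p\<in>A. l0 p * real_of_int (h p i))" if "i < n" for i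
        using sums[of "\<lambda>p. real_of_int (h p i)"] l(1) that meet_bjoin_sum[OF h pqF, of i]
        by (simp add: of_int_add[symmetric] del: of_int_add)
      have "\<epsilon> * (g ?m + g ?j - g p - g q) \<le> 0"
        using sub[OF pqA] \<epsilon>(1) by (simp add: mult_le_0_iff)
      then show "(\<Sum>p\<in>A. l' p * g p) \<le> (\<Sum>p\<in>A. l0 p * g p)" using sums[of g] l(2) by simp
    qed
    moreover have "0 < \<epsilon> * (\<phi> ?m + \<phi> ?j - \<phi> p - \<phi> q)"
      using rank_square_strict[OF h pqF] nc \<epsilon>(1) unfolding \<phi>_def by simp
    ultimately show False using sums[of \<phi>] by simp
  qed
  have "l \<in> Kpts L"
    unfolding Kpts_def is_chain_def
  proof (intro CollectI conjI)
    show "finite (supp l)" using suppA fin finite_subset by blast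
    show "supp l \<subseteq> L" using suppA A chart_subset[OF h] by blast
    show "sum l (supp l) = 1" using sum_supp[OF fin suppA, of "\<lambda>_. 1"] l3 by simp
  qed (use cmp l1 in auto)
  moreover have "pos h l i = (\<Sum>p\<in>A. l0 p * real_of_int (h p i))" for i
  proof (cases "i < n")
    case True
    then show ?thesis using pos_eq[OF fin suppA, of h i] l(1) by simp
  next
    case False
    then have "h p i = 0" if "p \<in> A" for p
      using that A nz_S2n[OF chart_S2n[OF h, of p]] by (auto simp: nz_def)
    then show ?thesis using pos_eq[OF fin suppA, of h i] by simp
  qed
  ultimately show ?thesis using that[of l] suppA l(2) by blast
qed

lemma convex_weights:
  assumes x: "x \<in> Kpts L" "supp x \<subseteq> A" and y: "y \<in> Kpts L" "supp y \<subseteq> A" and t: "0 \<le> t" "t \<le> 1"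
    and A: "finite A"
  defines "l \<equiv> \<lambda>p. (1 - t) * x p + t * y p"
  shows "weights A l"
    "(\<Sum>p\<in>A. l p * u p) = (1 - t) * (\<Sum>p\<in>A. x p * u p) + t * (\<Sum>p\<in>A. y p * u p)"
proof -
  have "0 \<le> l p" for p using Kpts_supp(3)[OF x(1), of p] Kpts_supp(3)[OF y(1), of p] t by (simp add: l_def)
  moreover have "l p = 0" if "p \<notin> A" for p
  proof -
    have "x p = 0" "y p = 0" using that x(2) y(2) by (auto simp: supp_def)
    then show ?thesis by (simp add: l_def)
  qed
  moreover show *: "(\<Sum>p\<in>A. l p * u p) = (1 - t) * (\<Sum>p\<in>A. x p * u p) + t * (\<Sum>p\<in>A. y p * u p)" for u
    by (simp add: l_def sum_distrib_left sum.distrib[symmetric] algebra_simps)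
  moreover have "sum l A = 1"
    using *[of "\<lambda>_. 1"] Kpts_sum[OF x(1) A x(2)] Kpts_sum[OF y(1) A y(2)] by simp
  ultimately show "weights A l" by (simp add: weights_def)
qed

text \<open>Uncrossing with the zero value function turns the mixture of \<open>x\<close> and
  \<open>y\<close> into a chain-supported point at the same position.\<close>

lemma frame_point:
  assumes h: "chart F h" and x: "x \<in> Kpts L" "supp x \<subseteq> F" and y: "y \<in> Kpts L" "supp y \<subseteq> F"
    and t: "0 \<le> t" "t \<le> 1"
  obtains z where "z \<in> Kpts L" "supp z \<subseteq> F" "\<And>i. pos h z i = (1 - t) * pos h x i + t * pos h y i"
proof -
  have fin: "finite F" by (rule chart_finite[OF h])
  note cw = convex_weights[OF x y t fin]
  have cl: "meet L p q \<in> F \<and> bjoin F h p q \<in> F" if "p \<in> F" "q \<in> F" for p q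
    using bjoin(1)[OF h that] frame_meet that h by (auto simp: chart_def)
  obtain z where "z \<in> Kpts L" "supp z \<subseteq> F"
    "\<And>i. pos h z i = (\<Sum>p\<in>F. ((1 - t) * x p + t * y p) * real_of_int (h p i))"
    by (rule uncross[OF h subset_refl cl _ cw(1), where g = "\<lambda>_. 0"]) auto
  then show ?thesis
    using that[of z] cw(2) pos_eq[OF fin x(2)] pos_eq[OF fin y(2)] by simp
qed

section \<open>The Lovasz extension on one frame\<close>

lemma sum_not_MInfty: "(\<And>p. p \<in> A \<Longrightarrow> g p \<noteq> (-\<infinity>::ereal)) \<Longrightarrow> sum g A \<noteq> -\<infinity>"
  by (induction A rule: infinite_finite_induct) (auto simp: ereal_plus_eq_MInfty)

lemma lovasz_infinite:
  assumes x: "x \<in> Kpts L" and f: "\<forall>p\<in>L. f p \<noteq> -\<infinity>"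
  shows "lovasz f x = \<infinity> \<longleftrightarrow> (\<exists>p\<in>supp x. f p = \<infinity>)" "lovasz f x \<noteq> -\<infinity>"
proof -
  have *: "ereal (x p) * f p = \<infinity> \<longleftrightarrow> f p = \<infinity>" "ereal (x p) * f p \<noteq> -\<infinity>" if "p \<in> supp x" for p
    using Kpts_supp_pos[OF x that] f Kpts_supp(5)[OF x] that by (cases "f p"; auto)+
  show "lovasz f x = \<infinity> \<longleftrightarrow> (\<exists>p\<in>supp x. f p = \<infinity>)"
    unfolding lovasz_def using Kpts_supp(1)[OF x] * by (simp add: sum_Pinfty)
  show "lovasz f x \<noteq> -\<infinity>"
    unfolding lovasz_def using *(2) by (rule sum_not_MInfty)
qed

lemma lovasz_finite:
  assumes x: "x \<in> Kpts L" "finite A" "supp x \<subseteq> A" and f: "\<And>p. p \<in> supp x \<Longrightarrow> \<bar>f p\<bar> \<noteq> \<infinity>"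
  shows "lovasz f x = ereal (\<Sum>p\<in>A. x p * real_of_ereal (f p))"
proof -
  have "lovasz f x = (\<Sum>p\<in>supp x. ereal (x p * real_of_ereal (f p)))"
    unfolding lovasz_def using f by (intro sum.cong refl) (metis ereal_real times_ereal.simps(1))
  then show ?thesis using sum_supp[OF x(2,3)] by simp
qed

definition bisubmodular_on :: "'a set \<Rightarrow> ('a \<Rightarrow> nat \<Rightarrow> int) \<Rightarrow> ('a \<Rightarrow> ereal) \<Rightarrow> bool" where
  "bisubmodular_on F h f \<longleftrightarrow> (\<forall>p\<in>F. \<forall>q\<in>F. f (meet L p q) + f (bjoin F h p q) \<le> f p + f q)"

text \<open>Uncrossing the mixture of \<open>x\<close> and \<open>y\<close> gives a point of no
  larger value at the position of \<open>z\<close>, and this point is \<open>z\<close> since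
  positions determine points. The uncrossing takes place among the elements of finite value, which
  bisubmodularity closes under meet and bjoin.\<close>

lemma lovasz_convex_on_frame:
  assumes h: "chart F h" and f: "\<forall>p\<in>L. f p \<noteq> -\<infinity>" and bs: "bisubmodular_on F h f"
    and x: "x \<in> Kpts L" "supp x \<subseteq> F" and y: "y \<in> Kpts L" "supp y \<subseteq> F" and z: "z \<in> Kpts L" "supp z \<subseteq> F"
    and t: "0 \<le> t" "t \<le> 1" and eq: "\<And>i. i < n \<Longrightarrow> pos h z i = (1 - t) * pos h x i + t * pos h y i"
  shows "lovasz f z \<le> ereal (1 - t) * lovasz f x + ereal t * lovasz f y"
proof -
  note e = chart_embeds[OF h]
  \<comment> \<open>At the ends of the segment an infinite value gets the coefficient 0 and
    disappears, so those cases rest on \<open>z = x\<close> and \<open>z = y\<close>.\<close>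
  consider "t = 0" | "t = 1" | "0 < t" "t < 1" "\<exists>p\<in>supp x \<union> supp y. f p = \<infinity>"
    | "\<forall>p\<in>supp x \<union> supp y. f p \<noteq> \<infinity>" using t by fastforce
  then show ?thesis
  proof cases
    case 1
    then have "z = x" using pos_inj[OF e z x] eq by simp
    then show ?thesis using 1 by (simp add: zero_ereal_def[symmetric] one_ereal_def[symmetric])
  next
    case 2
    then have "z = y" using pos_inj[OF e z y] eq by simp
    then show ?thesis using 2 by (simp add: zero_ereal_def[symmetric] one_ereal_def[symmetric])
  next
    case 3
    then have "lovasz f x = \<infinity> \<or> lovasz f y = \<infinity>"
      using lovasz_infinite(1)[OF x(1) f] lovasz_infinite(1)[OF y(1) f] by auto
    then have inf: "ereal (1 - t) * lovasz f x + ereal t * lovasz f y = \<infinity>"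
      using lovasz_infinite(2)[OF x(1) f] lovasz_infinite(2)[OF y(1) f] 3(1,2)
      by (cases "lovasz f x"; cases "lovasz f y") auto
    show ?thesis unfolding inf by simp
  next
    case 4
    define A where "A = {p \<in> F. f p \<noteq> \<infinity>}"
    have fin: "finite A" and AF: "A \<subseteq> F" using chart_finite[OF h] by (auto simp: A_def)
    have xA: "supp x \<subseteq> A" and yA: "supp y \<subseteq> A" using 4 x y by (auto simp: A_def)
    have FL: "F \<subseteq> L" by (rule chart_subset[OF h])
    have fA: "\<bar>f p\<bar> \<noteq> \<infinity>" if "p \<in> A" for p using that f FL by (auto simp: A_def)
    have mF: "meet L p q \<in> F" if "p \<in> F" "q \<in> F" for p q using frame_meet that h by (auto simp: chart_def)
    have bs': "f (meet L p q) + f (bjoin F h p q) \<le> f p + f q" if "p \<in> A" "q \<in> A" for p q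
      using bs that AF by (auto simp: bisubmodular_on_def)
    have cl: "meet L p q \<in> A \<and> bjoin F h p q \<in> A" if pq: "p \<in> A" "q \<in> A" for p q
    proof -
      have pqF: "p \<in> F" "q \<in> F" using pq AF by auto
      have F: "meet L p q \<in> F" "bjoin F h p q \<in> F" using mF[OF pqF] bjoin(1)[OF h pqF] by auto
      then have "f (meet L p q) \<noteq> -\<infinity>" "f (bjoin F h p q) \<noteq> -\<infinity>" using f FL by auto
      moreover have "f p + f q \<noteq> \<infinity>" using pq by (auto simp: A_def)
      ultimately show ?thesis using bs'[OF pq] F by (auto simp: A_def)
    qed
    have sub: "real_of_ereal (f (meet L p q)) + real_of_ereal (f (bjoin F h p q))
      \<le> real_of_ereal (f p) + real_of_ereal (f q)" if pq: "p \<in> A" "q \<in> A" for p q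
      using bs'[OF pq] fA[OF pq(1)] fA[OF pq(2)] fA[of "meet L p q"] fA[of "bjoin F h p q"] cl[OF pq]
      by (cases "f p"; cases "f q"; cases "f (meet L p q)"; cases "f (bjoin F h p q)") auto
    note cw = convex_weights[OF x(1) xA y(1) yA t fin]
    obtain w where w: "w \<in> Kpts L" "supp w \<subseteq> A"
      "\<And>i. pos h w i = (\<Sum>p\<in>A. ((1 - t) * x p + t * y p) * real_of_int (h p i))"
      "(\<Sum>p\<in>A. w p * real_of_ereal (f p)) \<le> (\<Sum>p\<in>A. ((1 - t) * x p + t * y p) * real_of_ereal (f p))"
      using uncross[OF h AF cl sub cw(1)] by blast
    have "z = w"
    proof (rule pos_inj[OF e z w(1)])
      show "supp w \<subseteq> F" using w(2) AF by blast
      show "pos h z i = pos h w i" if "i < n" for i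
        using eq[OF that] w(3) cw(2) pos_eq[OF fin xA] pos_eq[OF fin yA] by simp
    qed
    have lf: "lovasz f v = ereal (\<Sum>p\<in>A. v p * real_of_ereal (f p))" if "v \<in> Kpts L" "supp v \<subseteq> A" for v
    proof (rule lovasz_finite[OF that(1) fin that(2)])
      fix p assume "p \<in> supp v"
      then have "p \<in> A" using that(2) by blast
      then show "\<bar>f p\<bar> \<noteq> \<infinity>" by (rule fA)
    qed
    show ?thesis
      unfolding \<open>z = w\<close> lf[OF w(1,2)] lf[OF x(1) xA] lf[OF y(1) yA]
      using w(4) cw(2)[of "\<lambda>p. real_of_ereal (f p)"] by simp
  qed
qed

end

section \<open>Geodesics\<close>

lemma ed_scale:
  assumes "\<And>i. i < n \<Longrightarrow> a i - b i = c * (a' i - b' i)"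
  shows "ed n a b = \<bar>c\<bar> * ed n a' b'"
proof -
  have "(\<Sum>i<n. (a i - b i)\<^sup>2) = c\<^sup>2 * (\<Sum>i<n. (a' i - b' i)\<^sup>2)"
    unfolding sum_distrib_left by (rule sum.cong) (auto simp: assms power_mult_distrib)
  then show ?thesis by (simp add: ed_def L2_set_def real_sqrt_mult)
qed

lemma affine_zero_between:
  fixes \<alpha> \<beta> s t :: real
  defines "g \<equiv> \<lambda>r. (1 - r) * \<alpha> + r * \<beta>"
  assumes st: "s < t" and neg: "g s * g t < 0"
  obtains r where "s < r" "r < t" "g r = 0"
proof -
  define u where "u = g s / (g s - g t)"
  have ne: "g s - g t \<noteq> 0" using neg by (auto simp: mult_less_0_iff)
  have u: "0 < u" "u < 1" using neg by (auto simp: u_def mult_less_0_iff field_simps)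
  have "g (s + (t - s) * u) = (1 - u) * g s + u * g t" by (simp add: g_def algebra_simps)
  also have "\<dots> = g s - u * (g s - g t)" by (simp add: algebra_simps)
  also have "\<dots> = 0" using ne by (simp add: u_def)
  finally have "g (s + (t - s) * u) = 0" .
  moreover have "s < s + (t - s) * u" using st u by simp
  moreover have "(t - s) * u < (t - s) * 1" using st u(2) by (intro mult_strict_left_mono) auto
  then have "s + (t - s) * u < t" by simp
  ultimately show ?thesis using that by blast
qed

text \<open>The second condition discards the identically zero function, whose zeros would fill the
  line.\<close>

lemma finite_affine_zeros:
  fixes \<alpha> \<beta> :: real
  shows "finite {r. (1 - r) * \<alpha> + r * \<beta> = 0 \<and> (\<alpha> \<noteq> 0 \<or> \<beta> \<noteq> 0)}"
proof (rule finite_subset)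
  show "{r. (1 - r) * \<alpha> + r * \<beta> = 0 \<and> (\<alpha> \<noteq> 0 \<or> \<beta> \<noteq> 0)} \<subseteq> {\<alpha> / (\<alpha> - \<beta>)}"
  proof
    fix r assume "r \<in> {r. (1 - r) * \<alpha> + r * \<beta> = 0 \<and> (\<alpha> \<noteq> 0 \<or> \<beta> \<noteq> 0)}"
    then have *: "\<alpha> = r * (\<alpha> - \<beta>)" and ab: "\<alpha> \<noteq> 0 \<or> \<beta> \<noteq> 0" by (auto simp: algebra_simps)
    then have "\<alpha> - \<beta> \<noteq> 0" by auto
    then show "r \<in> {\<alpha> / (\<alpha> - \<beta>)}" using * by (simp add: field_simps)
  qed
qed simp

text \<open>The parameters at which the segment from a to b can leave an open simplex of the cube:
  those where two of its coordinates become equal or opposite (for i = j, where one vanishes).\<close>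

definition critical :: "nat \<Rightarrow> (nat \<Rightarrow> real) \<Rightarrow> (nat \<Rightarrow> real) \<Rightarrow> real set" where
  "critical n a b = (\<Union>i<n. \<Union>j<n. \<Union>\<sigma>\<in>{1, -1}. {r. (1 - r) * (a i + \<sigma> * a j) + r * (b i + \<sigma> * b j) = 0
     \<and> (a i + \<sigma> * a j \<noteq> 0 \<or> b i + \<sigma> * b j \<noteq> 0)})"

lemma finite_critical: "finite (critical n a b)"
  unfolding critical_def by (intro finite_UN_I finite_affine_zeros) auto

lemma not_critical_sign:
  assumes "s < t" "critical n a b \<inter> {s<..<t} = {}" "i < n" "j < n" "\<sigma> = 1 \<or> \<sigma> = -1"
  shows "((1 - s) * (a i + \<sigma> * a j) + s * (b i + \<sigma> * b j)) * ((1 - t) * (a i + \<sigma> * a j) + t * (b i + \<sigma> * b j)) \<ge> 0"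
proof (rule ccontr)
  assume "\<not> ?thesis"
  then have neg: "((1 - s) * (a i + \<sigma> * a j) + s * (b i + \<sigma> * b j)) * ((1 - t) * (a i + \<sigma> * a j) + t * (b i + \<sigma> * b j)) < 0"
    by simp
  then obtain r where r: "s < r" "r < t" "(1 - r) * (a i + \<sigma> * a j) + r * (b i + \<sigma> * b j) = 0"
    using affine_zero_between[OF assms(1)] by metis
  have "a i + \<sigma> * a j \<noteq> 0 \<or> b i + \<sigma> * b j \<noteq> 0" using neg by auto
  then have "r \<in> critical n a b" using r(3) assms(3-5) unfolding critical_def by blast
  then show False using r assms(2) by auto
qed

text \<open>By Stewart's identity the squared distance from \<open>w\<close> to the dividing point
  is \<open>(1 - t)\<close> times that to \<open>a\<close>, plus \<open>t\<close> times that to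
  \<open>b\<close>, minus \<open>t * (1 - t)\<close> times that between \<open>a\<close> and
  \<open>b\<close>. The two bounds make this nonpositive.\<close>

lemma euclid_between:
  assumes t: "0 \<le> t" "t \<le> 1" and aw: "ed n a w \<le> t * ed n a b" and wb: "ed n w b \<le> (1 - t) * ed n a b"
    and i: "i < n"
  shows "w i = (1 - t) * a i + t * b i"
proof -
  define N where "N u v = (\<Sum>i<n. (u i - v i)\<^sup>2)" for u v :: "nat \<Rightarrow> real"
  have N: "N u v = (ed n u v)\<^sup>2" for u v by (simp add: N_def ed_def L2_set_def sum_nonneg)
  define D where "D = ed n a b"
  have 1: "N a w \<le> t\<^sup>2 * D\<^sup>2" using power_mono[OF aw ed_nonneg, of 2] by (simp add: N D_def power_mult_distrib)
  have 2: "N w b \<le> (1 - t)\<^sup>2 * D\<^sup>2" using power_mono[OF wb ed_nonneg, of 2] by (simp add: N D_def power_mult_distrib)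
  have "(\<Sum>i<n. (w i - ((1 - t) * a i + t * b i))\<^sup>2)
    = (\<Sum>i<n. (1 - t) * (a i - w i)\<^sup>2 + t * (w i - b i)\<^sup>2 - t * (1 - t) * (a i - b i)\<^sup>2)"
    by (rule sum.cong) (simp_all add: power2_eq_square algebra_simps)
  also have "\<dots> = (1 - t) * N a w + t * N w b - t * (1 - t) * N a b"
    by (simp add: N_def sum.distrib sum_subtractf sum_distrib_left)
  also have "\<dots> \<le> (1 - t) * (t\<^sup>2 * D\<^sup>2) + t * ((1 - t)\<^sup>2 * D\<^sup>2) - t * (1 - t) * D\<^sup>2"
    using mult_left_mono[OF 1, of "1 - t"] mult_left_mono[OF 2 t(1)] t by (simp add: N D_def)
  also have "\<dots> = 0" by (simp add: power2_eq_square algebra_simps)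
  finally have "(\<Sum>i<n. (w i - ((1 - t) * a i + t * b i))\<^sup>2) = 0"
    using sum_nonneg[of "{..<n}" "\<lambda>i. (w i - ((1 - t) * a i + t * b i))\<^sup>2"] by simp
  then show ?thesis using i by (simp add: sum_nonneg_eq_0_iff)
qed

section \<open>Straight segments in a frame and the length metric\<close>

context polar begin

text \<open>Induction on the number of critical parameters inside the segment: if there is none, the
  endpoints share a simplex; otherwise cutting at one leaves fewer on each side.\<close>

lemma segment_plen:
  assumes h: "chart F h"
    and z: "\<And>t. 0 \<le> t \<Longrightarrow> t \<le> 1 \<Longrightarrow> z t \<in> Kpts L \<and> supp (z t) \<subseteq> F \<and> (\<forall>i<n. pos h (z t) i = (1 - t) * a i + t * b i)"
  shows "0 \<le> s \<Longrightarrow> s < t \<Longrightarrow> t \<le> 1 \<Longrightarrow> plen n L (z s) (z t) ((t - s) * ed n a b)"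
proof (induction "card (critical n a b \<inter> {s<..<t})" arbitrary: s t rule: less_induct)
  case less
  note e = chart_embeds[OF h]
  have zs: "z s \<in> Kpts L" "supp (z s) \<subseteq> F" "\<And>i. i < n \<Longrightarrow> pos h (z s) i = (1 - s) * a i + s * b i"
    and zt: "z t \<in> Kpts L" "supp (z t) \<subseteq> F" "\<And>i. i < n \<Longrightarrow> pos h (z t) i = (1 - t) * a i + t * b i"
    using z[of s] z[of t] less.prems by auto
  show ?case
  proof (cases "critical n a b \<inter> {s<..<t} = {}")
    case True
    have sgn: "(pos h (z s) i + \<sigma> * pos h (z s) j) * (pos h (z t) i + \<sigma> * pos h (z t) j) \<ge> 0"
      if "i < n" "j < n" "\<sigma> = 1 \<or> \<sigma> = -1" for i j \<sigma>
    proof -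
      have "pos h (z s) i + \<sigma> * pos h (z s) j = (1 - s) * (a i + \<sigma> * a j) + s * (b i + \<sigma> * b j)"
        unfolding zs(3)[OF that(1)] zs(3)[OF that(2)] by (simp add: algebra_simps)
      moreover have "pos h (z t) i + \<sigma> * pos h (z t) j = (1 - t) * (a i + \<sigma> * a j) + t * (b i + \<sigma> * b j)"
        unfolding zt(3)[OF that(1)] zt(3)[OF that(2)] by (simp add: algebra_simps)
      ultimately show ?thesis using not_critical_sign[OF less.prems(2) True that] by simp
    qed
    have ss: "same_simplex L (z s) (z t)"
    proof (rule same_simplexI[OF e zs(1,2) zt(1,2)])
      show "0 \<le> pos h (z s) i * pos h (z t) i" if "i < n" for i
        using sgn[OF that that, of 1] by simp
      fix i j assume ij: "i < n" "j < n" and lt: "\<bar>pos h (z s) i\<bar> < \<bar>pos h (z s) j\<bar>"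
      show "\<bar>pos h (z t) i\<bar> \<le> \<bar>pos h (z t) j\<bar>"
      proof (rule ccontr)
        assume "\<not> ?thesis"
        then have gt: "\<bar>pos h (z t) j\<bar> < \<bar>pos h (z t) i\<bar>" by simp
        \<comment> \<open>Squares turn the comparison of absolute values into the sign of
          \<open>(?A - ?B) * (?A + ?B)\<close>, and neither factor has opposite signs at the two
          ends.\<close>
        let ?A = "pos h (z s) i" and ?B = "pos h (z s) j" and ?A' = "pos h (z t) i" and ?B' = "pos h (z t) j"
        have "?A\<^sup>2 < ?B\<^sup>2" "?B'\<^sup>2 < ?A'\<^sup>2" using lt gt abs_le_square_iff[of ?B ?A] abs_le_square_iff[of ?A' ?B'] by linarith+
        then have "(?A\<^sup>2 - ?B\<^sup>2) * (?A'\<^sup>2 - ?B'\<^sup>2) < 0" by (simp add: mult_less_0_iff)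
        moreover have "((?A - ?B) * (?A' - ?B')) * ((?A + ?B) * (?A' + ?B')) \<ge> 0"
          using sgn[OF ij, of 1] sgn[OF ij, of "-1"] by simp
        ultimately show False by (simp add: power2_eq_square algebra_simps)
      qed
    qed
    have "simplex_dist n L (z s) (z t) = ed n (pos h (z s)) (pos h (z t))"
      by (rule simplex_dist_embeds[OF ss embeds_subset[OF e]]) (use zs zt in auto)
    also have "\<dots> = \<bar>t - s\<bar> * ed n a b"
      by (rule ed_scale) (simp add: zs(3) zt(3) algebra_simps)
    finally show ?thesis using plen_single[OF ss, of n] less.prems by simp
  next
    case False
    then obtain c where c: "c \<in> critical n a b" "s < c" "c < t" by auto
    have "critical n a b \<inter> {s<..<c} \<subset> critical n a b \<inter> {s<..<t}"
      "critical n a b \<inter> {c<..<t} \<subset> critical n a b \<inter> {s<..<t}" using c by auto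
    then have "card (critical n a b \<inter> {s<..<c}) < card (critical n a b \<inter> {s<..<t})"
      "card (critical n a b \<inter> {c<..<t}) < card (critical n a b \<inter> {s<..<t})"
      by (auto intro!: psubset_card_mono simp: finite_critical)
    then have "plen n L (z s) (z c) ((c - s) * ed n a b)" "plen n L (z c) (z t) ((t - c) * ed n a b)"
      using less.hyps[of s c] less.hyps[of c t] less.prems c by auto
    from plen_trans[OF this] show ?thesis by (simp add: algebra_simps)
  qed
qed

lemma plen_frame:
  assumes h: "chart F h" and x: "x \<in> Kpts L" "supp x \<subseteq> F" and y: "y \<in> Kpts L" "supp y \<subseteq> F"
  shows "plen n L x y (ed n (pos h x) (pos h y))"
proof -
  have "\<exists>z. z \<in> Kpts L \<and> supp z \<subseteq> F \<and> (\<forall>i<n. pos h z i = (1 - t) * pos h x i + t * pos h y i)"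
    if "0 \<le> t" "t \<le> 1" for t
    using frame_point[OF h x y that] by metis
  then obtain z where z: "0 \<le> t \<Longrightarrow> t \<le> 1 \<Longrightarrow> z t \<in> Kpts L \<and> supp (z t) \<subseteq> F
    \<and> (\<forall>i<n. pos h (z t) i = (1 - t) * pos h x i + t * pos h y i)" for t
    by metis
  have "z 0 = x" "z 1 = y"
    using z[of 0] z[of 1] pos_inj[OF chart_embeds[OF h] _ _ x, of "z 0"]
      pos_inj[OF chart_embeds[OF h] _ _ y, of "z 1"] by auto
  then show ?thesis using segment_plen[OF h z, of 0 1] by simp
qed

lemma ex_chart_Kpts:
  assumes "x \<in> Kpts L" "y \<in> Kpts L"
  obtains F h where "chart F h" "supp x \<subseteq> F" "supp y \<subseteq> F"
  using ex_chart_chains[OF Kpts_supp(2)[OF assms(1)] Kpts_supp(2)[OF assms(2)]] .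

lemma Kdist_ge:
  assumes R: "\<And>D. is_chain L D \<Longrightarrow> embeds (S \<union> D) R" and xy: "x \<in> Kpts L" "y \<in> Kpts L"
  shows "ed n (pos R x) (pos R y) \<le> Kdist n L x y"
  unfolding Kdist_plen
proof (rule cInf_greatest)
  \<comment> \<open>A lower bound passes to the infimum only over a nonempty set; a frame containing
    both points supplies a string.\<close>
  obtain F h where "chart F h" "supp x \<subseteq> F" "supp y \<subseteq> F" by (rule ex_chart_Kpts[OF xy])
  then show "{d. plen n L x y d} \<noteq> {}" using plen_frame xy by blast
qed (use plen_lower[OF R] in blast)

text \<open>The straight segment in the frame gives the upper bound, a retraction centred at some
  flag of the frame the lower one.\<close>

lemma Kdist_frame:
  assumes h: "chart F h" and x: "x \<in> Kpts L" "supp x \<subseteq> F" and y: "y \<in> Kpts L" "supp y \<subseteq> F"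
  shows "Kdist n L x y = ed n (pos h x) (pos h y)"
proof (rule antisym)
  show "Kdist n L x y \<le> ed n (pos h x) (pos h y)" by (rule Kdist_le[OF plen_frame[OF assms]])
  obtain R where R: "embeds F R" "\<And>D. is_chain L D \<Longrightarrow> embeds ({} \<union> D) R"
    by (rule retraction[OF h, of "{}"]) (auto simp: is_chain_def)
  show "ed n (pos h x) (pos h y) \<le> Kdist n L x y"
    using Kdist_ge[OF R(2) x(1) y(1)] ed_embeds[OF chart_embeds[OF h] R(1) x(1) y(1) x(2) y(2)] by simp
qed

text \<open>The affine relation says that a certain linear combination of sign vectors has norm
  zero, which holds in both coordinate systems at once because their Gram matrices agree.\<close>

lemma frame_point_embeds:
  assumes k: "embeds G k" "embeds G k'" and K: "x \<in> Kpts L" "y \<in> Kpts L" "m \<in> Kpts L"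
    and G: "supp x \<subseteq> G" "supp y \<subseteq> G" "supp m \<subseteq> G"
    and m: "\<And>i. i < n \<Longrightarrow> pos k m i = (1 - t) * pos k x i + t * pos k y i" and i: "i < n"
  shows "pos k' m i = (1 - t) * pos k' x i + t * pos k' y i"
proof -
  let ?C = "supp x \<union> supp y \<union> supp m"
  have fin: "finite ?C" using K Kpts_supp(1) by blast
  define c where "c p = m p - (1 - t) * x p - t * y p" for p
  have c: "(\<Sum>p\<in>?C. c p * real_of_int (u p i)) = pos u m i - (1 - t) * pos u x i - t * pos u y i" for u i
  proof -
    have "pos u w i = (\<Sum>p\<in>?C. w p * real_of_int (u p i))" if "w \<in> {x, y, m}" for w
      by (rule pos_eq[OF fin]) (use that in auto)
    then show ?thesis by (simp add: c_def sum_subtractf left_diff_distrib sum_distrib_left mult.assoc)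
  qed
  have "(\<Sum>i<n. (\<Sum>p\<in>?C. c p * real_of_int (k' p i))\<^sup>2) = (\<Sum>i<n. (\<Sum>p\<in>?C. c p * real_of_int (k p i))\<^sup>2)"
    by (rule sum_square_embeds[OF k(2,1)]) (use G in blast)
  also have "\<dots> = 0" by (rule sum.neutral) (simp add: c m)
  finally have "(\<Sum>p\<in>?C. c p * real_of_int (k' p i)) = 0"
    using i by (simp add: sum_nonneg_eq_0_iff)
  then show ?thesis by (simp add: c)
qed

text \<open>Retracting onto the frame from a chamber around m does not change the distance to m, so a
  point that is a candidate for m on a geodesic is identified with m by strict convexity of the
  Euclidean norm.\<close>

lemma geodesic_point_unique:
  assumes h: "chart F h" and x: "x \<in> Kpts L" "supp x \<subseteq> F" and y: "y \<in> Kpts L" "supp y \<subseteq> F"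
    and m: "m \<in> Kpts L" "supp m \<subseteq> F" and t: "0 \<le> t" "t \<le> 1"
    and pm: "\<And>i. i < n \<Longrightarrow> pos h m i = (1 - t) * pos h x i + t * pos h y i"
    and z: "z \<in> Kpts L" "Kdist n L x z \<le> t * Kdist n L x y" "Kdist n L z y \<le> (1 - t) * Kdist n L x y"
  shows "z = m"
proof -
  obtain R where R: "embeds F R" "\<And>D. is_chain L D \<Longrightarrow> embeds (supp m \<union> D) R"
    by (rule retraction[OF h Kpts_supp(2)[OF m(1)] m(2)]) (rule that; blast)
  note e = chart_embeds[OF h]
  have D: "Kdist n L x y = ed n (pos R x) (pos R y)"
    using Kdist_frame[OF h x y] ed_embeds[OF e R(1) x(1) y(1) x(2) y(2)] by simp
  have mz: "pos R m i = pos R z i" if i: "i < n" for i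
  proof -
    have "pos R z i = (1 - t) * pos R x i + t * pos R y i"
    proof (rule euclid_between[OF t _ _ i])
      show "ed n (pos R x) (pos R z) \<le> t * ed n (pos R x) (pos R y)"
        using Kdist_ge[OF R(2) x(1) z(1)] z(2) D by simp
      show "ed n (pos R z) (pos R y) \<le> (1 - t) * ed n (pos R x) (pos R y)"
        using Kdist_ge[OF R(2) z(1) y(1)] z(3) D by simp
    qed
    then show ?thesis
      using frame_point_embeds[OF e R(1) x(1) y(1) m(1) x(2) y(2) m(2) pm i] by simp
  qed
  show ?thesis
    using pos_inj[OF R(2)[OF Kpts_supp(2)[OF z(1)]] m(1) _ z(1) _ mz] by auto
qed

lemma geodesic_in_frame:
  assumes h: "chart F h" and g: "geodesic n L \<gamma>" and F: "supp (\<gamma> 0) \<subseteq> F" "supp (\<gamma> 1) \<subseteq> F" and t: "t \<in> {0..1}"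
  shows "supp (\<gamma> t) \<subseteq> F" "pos h (\<gamma> t) i = (1 - t) * pos h (\<gamma> 0) i + t * pos h (\<gamma> 1) i"
proof -
  have K: "\<gamma> s \<in> Kpts L" if "s \<in> {0..1}" for s using g that unfolding geodesic_def by blast
  have K01: "\<gamma> 0 \<in> Kpts L" "\<gamma> 1 \<in> Kpts L" using K by auto
  have d: "Kdist n L (\<gamma> s) (\<gamma> r) = \<bar>s - r\<bar> * Kdist n L (\<gamma> 0) (\<gamma> 1)" if "s \<in> {0..1}" "r \<in> {0..1}" for s r
    using g that unfolding geodesic_def by blast
  have t': "0 \<le> t" "t \<le> 1" using t by auto
  obtain m where m: "m \<in> Kpts L" "supp m \<subseteq> F" "\<And>i. pos h m i = (1 - t) * pos h (\<gamma> 0) i + t * pos h (\<gamma> 1) i"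
    by (rule frame_point[OF h K01(1) F(1) K01(2) F(2) t']) (rule that; blast)
  have "Kdist n L (\<gamma> 0) (\<gamma> t) \<le> t * Kdist n L (\<gamma> 0) (\<gamma> 1)"
    "Kdist n L (\<gamma> t) (\<gamma> 1) \<le> (1 - t) * Kdist n L (\<gamma> 0) (\<gamma> 1)"
    using d[of 0 t] d[of t 1] t' by simp_all
  then have "\<gamma> t = m"
    using geodesic_point_unique[OF h K01(1) F(1) K01(2) F(2) m(1,2) t' _ K[OF t]] m(3) by blast
  then show "supp (\<gamma> t) \<subseteq> F" "pos h (\<gamma> t) i = (1 - t) * pos h (\<gamma> 0) i + t * pos h (\<gamma> 1) i"
    using m by auto
qed

lemma ex_geodesic:
  assumes h: "chart F h" and x: "x \<in> Kpts L" "supp x \<subseteq> F" and y: "y \<in> Kpts L" "supp y \<subseteq> F"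
  obtains \<gamma> where "geodesic n L \<gamma>" "\<gamma> 0 = x" "\<gamma> 1 = y"
proof -
  have "\<exists>z. z \<in> Kpts L \<and> supp z \<subseteq> F \<and> (\<forall>i. pos h z i = (1 - t) * pos h x i + t * pos h y i)"
    if "0 \<le> t" "t \<le> 1" for t
    using frame_point[OF h x y that] by metis
  then obtain z where z: "0 \<le> t \<Longrightarrow> t \<le> 1 \<Longrightarrow> z t \<in> Kpts L \<and> supp (z t) \<subseteq> F
    \<and> (\<forall>i. pos h (z t) i = (1 - t) * pos h x i + t * pos h y i)" for t
    by metis
  have z01: "z 0 = x" "z 1 = y"
    using z[of 0] z[of 1] pos_inj[OF chart_embeds[OF h] _ _ x, of "z 0"]
      pos_inj[OF chart_embeds[OF h] _ _ y, of "z 1"] by auto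
  have "Kdist n L (z s) (z t) = \<bar>s - t\<bar> * Kdist n L x y" if st: "s \<in> {0..1}" "t \<in> {0..1}" for s t
  proof -
    have "Kdist n L (z s) (z t) = ed n (pos h (z s)) (pos h (z t))"
      using z[of s] z[of t] st by (intro Kdist_frame[OF h]) auto
    also have "\<dots> = \<bar>t - s\<bar> * ed n (pos h x) (pos h y)"
    proof (rule ed_scale)
      fix i
      have "pos h (z s) i = (1 - s) * pos h x i + s * pos h y i" "pos h (z t) i = (1 - t) * pos h x i + t * pos h y i"
        using z[of s] z[of t] st by auto
      then show "pos h (z s) i - pos h (z t) i = (t - s) * (pos h x i - pos h y i)"
        by (simp add: left_diff_distrib right_diff_distrib)
    qed
    finally show ?thesis using Kdist_frame[OF h x y] by (simp add: abs_minus_commute)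
  qed
  then have "geodesic n L z" using z z01 by (auto simp: geodesic_def)
  then show ?thesis using that z01 by blast
qed

end

section \<open>The hull of a metric interval\<close>

lemma l1_between:
  assumes "l1 n u v + l1 n v w \<le> l1 n u w" "i < n"
  shows "\<bar>u i - v i\<bar> + \<bar>v i - w i\<bar> = \<bar>u i - w i\<bar>"
proof -
  have "(\<Sum>i<n. \<bar>u i - v i\<bar> + \<bar>v i - w i\<bar> - \<bar>u i - w i\<bar>) \<le> 0"
    using assms(1) by (simp add: l1_def sum.distrib sum_subtractf)
  moreover have "(\<Sum>i<n. \<bar>u i - v i\<bar> + \<bar>v i - w i\<bar> - \<bar>u i - w i\<bar>) \<ge> 0" by (rule sum_nonneg) simp
  ultimately have "(\<Sum>i<n. \<bar>u i - v i\<bar> + \<bar>v i - w i\<bar> - \<bar>u i - w i\<bar>) = 0" by simp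
  then have "\<forall>i\<in>{..<n}. \<bar>u i - v i\<bar> + \<bar>v i - w i\<bar> - \<bar>u i - w i\<bar> = 0"
    by (subst (asm) sum_nonneg_eq_0_iff) auto
  then show ?thesis using assms(2) by auto
qed

definition dirac :: "'a \<Rightarrow> 'a \<Rightarrow> real" where
  "dirac p x = (if x = p then 1 else 0)"

lemma supp_dirac [simp]: "supp (dirac p) = {p}"
  by (auto simp: supp_def dirac_def)

lemma dirac_Kpts: "p \<in> L \<Longrightarrow> dirac p \<in> Kpts L"
  by (simp add: Kpts_def) (simp add: dirac_def)

lemma pos_dirac [simp]: "pos k (dirac p) i = real_of_int (k p i)"
  by (simp add: pos_def) (simp add: dirac_def)

lemma lovasz_dirac [simp]: "lovasz f (dirac p) = f p"
  by (simp add: lovasz_def) (simp add: dirac_def one_ereal_def[symmetric])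

context polar begin

text \<open>\<open>R\<close> is injective between finite sets of equal size. A frame may therefore
  be measured in the coordinates of a retraction, which also reach points outside it.\<close>

lemma embeds_chart:
  assumes h: "chart F h" and R: "embeds F R"
  shows "chart F R"
proof -
  have inj: "inj_on R F" using embeds_inj[OF R] by (auto intro: inj_onI)
  have "R ` F = S2n n"
  proof (rule card_subset_eq[OF finite_S2n])
    show "R ` F \<subseteq> S2n n" using embeds_S2n[OF R] by auto
    show "card (R ` F) = card (S2n n)"
      using card_image[OF inj] bij_betw_same_card[OF chart_bij[OF h]] by simp
  qed
  then show ?thesis
    using h inj embeds_le[OF R] by (auto simp: chart_def order_iso_def bij_betw_def)
qed

lemma nz_ujoin: "chart F h \<Longrightarrow> p \<in> F \<Longrightarrow> q \<in> F \<Longrightarrow> nz (h (ujoin F h p q)) = nz (h p) \<union> nz (h q)"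
  by (auto simp: nz_def ujoin(2))

text \<open>Every vertex of the support lies below \<open>m\<close>, so a coordinate in which
  \<open>m\<close> vanishes is zero throughout, and elsewhere signs cannot cancel. The position thus
  determines the top vertex.\<close>

lemma max_supp_sgn:
  assumes k: "embeds G k" and x: "x \<in> Kpts L" "supp x \<subseteq> G"
    and m: "m \<in> supp x" "\<And>b. b \<in> supp x \<Longrightarrow> b \<le> m"
  shows "real_of_int (k m i) = sgn (pos k x i)"
proof (cases "k m i = 0")
  case True
  have "k p i = 0" if p: "p \<in> supp x" for p
  proof -
    have "S2_le (k p) (k m)" using embeds_le[OF k, of p m] m p x(2) by auto
    then have "k p i = 0 \<or> k p i = k m i" by (simp add: S2_le_def)
    then show ?thesis using True by auto
  qed
  then show ?thesis using True by (simp add: pos_def)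
next
  case False
  then show ?thesis using pos_sgn[OF k x m(1)] by simp
qed

lemma ujoin_unique:
  assumes h: "chart F h" "p \<in> F" "q \<in> F" and k: "chart G k" "p \<in> G" "q \<in> G"
  shows "ujoin F h p q = ujoin G k p q"
proof -
  have L: "p \<in> L" "q \<in> L" using h chart_subset by auto
  obtain \<gamma> where \<gamma>: "geodesic n L \<gamma>" "\<gamma> 0 = dirac p" "\<gamma> 1 = dirac q"
    by (rule ex_geodesic[OF h(1) dirac_Kpts[OF L(1)] _ dirac_Kpts[OF L(2)]]) (use h in auto)
  \<comment> \<open>Any parameter strictly between 0 and 1/2 would do: \<open>p\<close> outweighs
    \<open>q\<close> wherever both are nonzero, and \<open>q\<close> fills in the rest.\<close>
  let ?x = "\<gamma> (1/4)"
  have x: "?x \<in> Kpts L" using \<gamma>(1) unfolding geodesic_def by auto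
  obtain m where m: "m \<in> supp ?x" "\<And>b. b \<in> supp ?x \<Longrightarrow> b \<le> m"
    using finite_chain_has_max[OF Kpts_supp(1)[OF x] Kpts_supp_ne[OF x]] supp_comparable[OF x] by metis
  have *: "m = ujoin H u p q" if u: "chart H u" "p \<in> H" "q \<in> H" for H u
  proof -
    have q: "(1/4::real) \<in> {0..1}" by simp
    have F: "supp (\<gamma> 0) \<subseteq> H" "supp (\<gamma> 1) \<subseteq> H" using \<gamma> u by auto
    have xH: "supp ?x \<subseteq> H" by (rule geodesic_in_frame(1)[OF u(1) \<gamma>(1) F q])
    have "u m i = u (ujoin H u p q) i" for i
    proof -
      have "pos u ?x i = 3/4 * real_of_int (u p i) + 1/4 * real_of_int (u q i)"
        using geodesic_in_frame(2)[OF u(1) \<gamma>(1) F q, of i] \<gamma> by simp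
      then have "real_of_int (u m i) = sgn (3/4 * real_of_int (u p i) + 1/4 * real_of_int (u q i))"
        using max_supp_sgn[OF chart_embeds[OF u(1)] x xH m, of i] by simp
      also have "\<dots> = real_of_int (if u p i = 0 then u q i else u p i)"
        using S2n_values[OF chart_S2n[OF u(1,2)], of i] S2n_values[OF chart_S2n[OF u(1,3)], of i]
        by (auto simp: sgn_if)
      finally show ?thesis using ujoin(2)[OF u, of i] by simp
    qed
    then show ?thesis using chart_inj[OF u(1) _ ujoin(1)[OF u]] xH m(1) by blast
  qed
  show ?thesis using *[OF h] *[OF k] by simp
qed

text \<open>The coordinates of \<open>rvec L p q w\<close> thus add up to the height of
  \<open>w\<close> above the meet, and a bound on ranks in the interval becomes the slanted side of
  the polygon in \<open>pentagon\<close>.\<close>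

lemma interval_rk:
  assumes "p \<in> L" "q \<in> L" "w \<in> L" "gd p w + gd w q = gd p q"
  shows "rk L w + rk L (meet L p q) = rk L (meet L w p) + rk L (meet L w q)"
  using assms meet_commute[of p w] by (simp add: gd_def)

text \<open>\<open>w\<close> may lie outside \<open>F\<close>. A retraction keeps its rank and does
  not lengthen the two distances, so its image is coordinatewise between those of \<open>p\<close>
  and \<open>q\<close> and is nonzero only where one of them is.\<close>

lemma interval_rk_le:
  assumes h: "chart F h" "p \<in> F" "q \<in> F" and w: "w \<in> L" "gd p w + gd w q = gd p q"
  shows "rk L w \<le> rk L (ujoin F h p q)"
proof -
  have L: "p \<in> L" "q \<in> L" using h chart_subset by auto
  obtain R where R: "embeds F R" "\<And>D. is_chain L D \<Longrightarrow> embeds ({} \<union> D) R"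
    by (rule retraction[OF h(1), of "{}"]) (auto simp: is_chain_def)
  have c: "chart F R" by (rule embeds_chart[OF h(1) R(1)])
  have e: "embeds ({} \<union> {w}) R" using R(2)[of "{w}"] w by simp
  have "l1 n (R p) (R w) + l1 n (R w) (R q) \<le> l1 n (R p) (R q)"
    using l1_retraction_le_gd[OF R(2) L(1) w(1)] l1_retraction_le_gd[OF R(2) w(1) L(2)] gd_chart[OF c h(2,3)] w(2)
    by simp
  from l1_between[OF this] have b: "\<bar>R p i - R w i\<bar> + \<bar>R w i - R q i\<bar> = \<bar>R p i - R q i\<bar>" if "i < n" for i
    using that by blast
  have wS: "R w \<in> S2n n" using embeds_S2n[OF e] by simp
  have "nz (R w) \<subseteq> nz (R p) \<union> nz (R q)"
  proof
    fix i assume i: "i \<in> nz (R w)"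
    then have "i < n" using nz_S2n[OF wS] by auto
    then show "i \<in> nz (R p) \<union> nz (R q)" using b[of i] i by (auto simp: nz_def)
  qed
  then have "card (nz (R w)) \<le> card (nz (R (ujoin F R p q)))"
    using nz_ujoin[OF c h(2,3)] finite_nz[OF chart_S2n[OF c]] h by (intro card_mono) auto
  then show ?thesis
    using rk_embeds[OF e, of w] rk_chart[OF c ujoin(1)[OF c h(2,3)]] ujoin_unique[OF h c h(2,3)] by simp
qed

lemma ujoin_interval:
  assumes h: "chart F h" "p \<in> F" "q \<in> F"
  shows "gd p (ujoin F h p q) + gd (ujoin F h p q) q = gd p q" "p \<le> ujoin F h p q"
proof -
  note u = ujoin[OF h]
  have "\<bar>h p i - h (ujoin F h p q) i\<bar> + \<bar>h (ujoin F h p q) i - h q i\<bar> = \<bar>h p i - h q i\<bar>" for i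
    by (simp add: u(2))
  then show "gd p (ujoin F h p q) + gd (ujoin F h p q) q = gd p q"
    using gd_chart[OF h(1,2) u(1)] gd_chart[OF h(1) u(1) h(3)] gd_chart[OF h]
    by (simp add: l1_def sum.distrib[symmetric])
  show "p \<le> ujoin F h p q" using chart_le[OF h(1,2) u(1)] u(2) by (simp add: S2_le_def)
qed

text \<open>Since \<open>p \<le> w\<close> is a chain, \<open>p\<close>, \<open>w\<close> and
  \<open>q\<close> do share a frame \<open>G\<close>. There \<open>w\<close> keeps the signs of
  \<open>p\<close>, has full support by its rank, and betweenness forces the signs of
  \<open>q\<close> on the rest.\<close>

lemma interval_top_unique:
  assumes h: "chart F h" "p \<in> F" "q \<in> F" and w: "w \<in> L" "gd p w + gd w q = gd p q"
    and pw: "p \<le> w" and r: "rk L w = rk L (ujoin F h p q)"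
  shows "w = ujoin F h p q"
proof -
  have L: "p \<in> L" "q \<in> L" using h chart_subset by auto
  obtain G k where k: "chart G k" "{p, w} \<subseteq> G" "{q} \<subseteq> G"
    using ex_chart_chains[OF is_chain_pair[OF L(1) w(1) pw], of "{q}"] L by auto
  have G: "p \<in> G" "w \<in> G" "q \<in> G" using k by auto
  have eq: "ujoin F h p q = ujoin G k p q" by (rule ujoin_unique[OF h k(1) G(1,3)])
  have S: "k p \<in> S2n n" "k w \<in> S2n n" "k q \<in> S2n n" using chart_S2n[OF k(1)] G by auto
  have b: "\<bar>k p i - k w i\<bar> + \<bar>k w i - k q i\<bar> = \<bar>k p i - k q i\<bar>" if "i < n" for i
    by (rule l1_between[OF _ that]) (use w(2) gd_chart[OF k(1)] G in simp)
  have le: "S2_le (k p) (k w)" using chart_le[OF k(1) G(1,2)] pw by simp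
  have sub: "nz (k w) \<subseteq> nz (k p) \<union> nz (k q)"
  proof
    fix i assume i: "i \<in> nz (k w)"
    then have "i < n" using nz_S2n[OF S(2)] by auto
    then show "i \<in> nz (k p) \<union> nz (k q)" using b[of i] i by (auto simp: nz_def)
  qed
  have "nz (k w) = nz (k p) \<union> nz (k q)"
  proof (rule card_subset_eq[OF _ sub])
    show "finite (nz (k p) \<union> nz (k q))" using finite_nz S by auto
    show "card (nz (k w)) = card (nz (k p) \<union> nz (k q))"
      using r eq rk_chart[OF k(1) G(2)] rk_chart[OF k(1) ujoin(1)[OF k(1) G(1,3)]] nz_ujoin[OF k(1) G(1,3)] by simp
  qed
  have "k w i = k (ujoin G k p q) i" for i
  proof (cases "k p i = 0")
    case False
    then show ?thesis using le ujoin(2)[OF k(1) G(1,3), of i] by (auto simp: S2_le_def)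
  next
    case True
    show ?thesis
    proof (cases "k q i = 0")
      case True
      then have "i \<notin> nz (k w)" using sub \<open>k p i = 0\<close> by (auto simp: nz_def)
      then show ?thesis using ujoin(2)[OF k(1) G(1,3), of i] True \<open>k p i = 0\<close> by (simp add: nz_def)
    next
      case False
      then have "i \<in> nz (k w)" "i < n" using \<open>nz (k w) = _\<close> nz_S2n[OF S(3)] by (auto simp: nz_def)
      then have "k w i = k q i"
        using b[of i] \<open>k p i = 0\<close> S2n_values[OF S(2), of i] S2n_values[OF S(3), of i] by (auto simp: nz_def)
      then show ?thesis using ujoin(2)[OF k(1) G(1,3), of i] \<open>k p i = 0\<close> by simp
    qed
  qed
  then have "w = ujoin G k p q" using chart_inj[OF k(1) G(2) ujoin(1)[OF k(1) G(1,3)]] by blast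
  then show ?thesis using eq by simp
qed

end

section \<open>Plane cones, their weights and the extreme points\<close>

lemma sector_unique:
  assumes "sector_ok C (\<alpha>, \<beta>)" "sector_ok C (\<alpha>', \<beta>')"
  shows "\<alpha> = \<alpha>' \<and> \<beta> = \<beta>'"
proof -
  have *: "a \<le> c \<and> d \<le> b" if ab: "sector_ok C (a, b)" and cd: "sector_ok C (c, d)" for a b c d
  proof -
    have r: "0 \<le> b" "b \<le> a" "a \<le> pi/2" "0 \<le> d" "d \<le> c" "c \<le> pi/2" and C: "C = sector a b" "C = sector c d"
      using ab cd by (auto simp: sector_ok_def)
    have trig: "0 \<le> cos a" "0 \<le> sin a" "0 \<le> cos b" "0 \<le> sin b"
      using r by (auto intro!: cos_ge_zero sin_ge_zero)
    have "sin (a - b) \<ge> 0" using r by (intro sin_ge_zero) auto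
    then have le: "cos a * sin b \<le> sin a * cos b" by (simp add: sin_diff)
    \<comment> \<open>The boundary rays of one description lie in the sector of the other, which
      compares the angles through the sign of a sine.\<close>
    then have "(cos a, sin a) \<in> sector c d" "(cos b, sin b) \<in> sector c d"
      using trig C by (auto simp: sector_def mult.commute)
    then have "sin (c - a) \<ge> 0" "sin (b - d) \<ge> 0"
      by (auto simp: sector_def sin_diff mult.commute)
    moreover have "sin (c - a) < 0" if "c < a" using r that sin_gt_zero[of "a - c"] by (simp add: sin_diff mult.commute)
    moreover have "sin (b - d) < 0" if "b < d" using r that sin_gt_zero[of "d - b"] by (simp add: sin_diff mult.commute)
    ultimately show ?thesis by linarith
  qed
  show ?thesis using *[OF assms] *[OF assms(2,1)] by auto
qed

lemma cone_weight_sector: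
  assumes "0 \<le> \<beta>" "\<beta> \<le> \<alpha>" "\<alpha> \<le> pi / 2"
  shows "cone_weight (sector \<alpha> \<beta>) = sin \<alpha> / (sin \<alpha> + cos \<alpha>) - sin \<beta> / (sin \<beta> + cos \<beta>)"
proof -
  have ok: "sector_ok (sector \<alpha> \<beta>) (\<alpha>, \<beta>)" using assms by (simp add: sector_ok_def)
  have "(SOME ab. sector_ok (sector \<alpha> \<beta>) ab) = (\<alpha>, \<beta>)"
    by (rule some_equality[of _ "(\<alpha>, \<beta>)"]) (use ok sector_unique[OF _ ok] in auto)
  then show ?thesis using ok by (auto simp: cone_weight_def)
qed

lemma cone_weight_quadrant: "cone_weight {w. 0 \<le> fst w \<and> 0 \<le> snd w} = 1"
proof -
  have "{w. 0 \<le> fst w \<and> 0 \<le> snd w} = sector (pi / 2) 0" by (auto simp: sector_def)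
  then show ?thesis using cone_weight_sector[of 0 "pi / 2"] by simp
qed

text \<open>The diagonal is the ray at angle \<open>pi / 4\<close>, where sine and cosine agree, so
  \<open>sin / (sin + cos)\<close> is halfway between its values 0 and 1 at the axes.\<close>

lemma cone_weight_below_diagonal: "cone_weight {w. 0 \<le> fst w \<and> 0 \<le> snd w \<and> snd w \<le> fst w} = 1 / 2"
proof -
  have "{w. 0 \<le> fst w \<and> 0 \<le> snd w \<and> snd w \<le> fst w} = sector (pi / 4) 0"
    by (auto simp: sector_def sin_45 cos_45)
  then show ?thesis using cone_weight_sector[of 0 "pi / 4"] by (simp add: sin_45 cos_45)
qed

lemma cone_weight_above_diagonal: "cone_weight {w. 0 \<le> fst w \<and> 0 \<le> snd w \<and> fst w \<le> snd w} = 1 / 2"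
proof -
  have "{w. 0 \<le> fst w \<and> 0 \<le> snd w \<and> fst w \<le> snd w} = sector (pi / 2) (pi / 4)"
    by (auto simp: sector_def sin_45 cos_45)
  then show ?thesis using cone_weight_sector[of "pi / 4" "pi / 2"] by (simp add: sin_45 cos_45)
qed

text \<open>Three half-planes bound the hull, and \<open>e1\<close>, \<open>e2\<close> are the ends
  of the slanted edge. Every point of the hull is dominated componentwise by a point of this edge,
  so only its ends are both maximal and extreme, and functionals with nonnegative coefficients
  attain their maximum at one of them. For \<open>S = A + B\<close> the edge shrinks to a
  point.\<close>

lemma pentagon:
  fixes V :: "(real \<times> real) set" and A B S :: real
  defines "C \<equiv> convex hull V" and "e1 \<equiv> (A, S - A)" and "e2 \<equiv> (S - B, B)"
  assumes V: "\<forall>z\<in>V. fst z \<le> A \<and> snd z \<le> B \<and> fst z + snd z \<le> S"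
    and e: "e1 \<in> V" "e2 \<in> V" and S: "S \<le> A + B"
  shows "z extreme_point_of C \<and> compwise_maximal C z \<longleftrightarrow> z = e1 \<or> z = e2"
    and "0 \<le> fst w \<Longrightarrow> 0 \<le> snd w \<Longrightarrow> (SUP z\<in>C. w \<bullet> z) = max (w \<bullet> e1) (w \<bullet> e2)"
proof -
  let ?P = "{z. (1, 0) \<bullet> z \<le> A} \<inter> {z. (0, 1) \<bullet> z \<le> B} \<inter> {z. (1, 1) \<bullet> z \<le> S} :: (real \<times> real) set"
  have "convex ?P" by (intro convex_Int convex_halfspace_le)
  then have "C \<subseteq> ?P"
    unfolding C_def by (intro hull_minimal) (use V in \<open>auto simp: inner_prod_def\<close>)
  then have CP: "fst z \<le> A" "snd z \<le> B" "fst z + snd z \<le> S" if "z \<in> C" for z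
    using that by (auto simp: inner_prod_def)
  have eC: "e1 \<in> C" "e2 \<in> C" unfolding C_def using e by (auto intro: hull_inc)
  have cvx: "convex C" by (simp add: C_def)
  have seg: "closed_segment e1 e2 \<subseteq> C" using closed_segment_subset[OF eC cvx] .
  have dom: "\<exists>y\<in>closed_segment e1 e2. fst z \<le> fst y \<and> snd z \<le> snd y" if z: "z \<in> C" for z
  \<comment> \<open>Below the edge, \<open>z\<close> is raised vertically onto it; to the left of
    the edge, or if the edge is a point, \<open>e2\<close> dominates \<open>z\<close>.\<close>
  proof (cases "fst z \<ge> S - B \<and> A + B - S > 0")
    case True
    define u where "u = (A - fst z) / (A + B - S)"
    have uA: "u * (A + B - S) = A - fst z" using True by (simp add: u_def)
    have u: "0 \<le> u" "u \<le> 1" using True CP[OF z] by (auto simp: u_def field_simps)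
    have "(1 - u) *\<^sub>R e1 + u *\<^sub>R e2 = (A - u * (A + B - S), S - A + u * (A + B - S))"
      by (simp add: e1_def e2_def algebra_simps)
    also have "\<dots> = (fst z, S - fst z)" unfolding uA by simp
    finally have "(fst z, S - fst z) \<in> closed_segment e1 e2"
      using u unfolding closed_segment_def by (metis (mono_tags, lifting) mem_Collect_eq)
    then show ?thesis using CP[OF z] by (intro bexI[of _ "(fst z, S - fst z)"]) auto
  next
    case False
    then show ?thesis using CP[OF z] S by (intro bexI[of _ e2]) (auto simp: e2_def)
  qed
  have ext: "e1 extreme_point_of C" "e2 extreme_point_of C"
  proof -
    have *: "a = e \<and> b = e" if ab: "a \<in> C" "b \<in> C" "e \<in> open_segment a b" "e = e1 \<or> e = e2" for a b e
    proof -
      obtain u where u: "0 < u" "u < 1" "e = (1 - u) *\<^sub>R a + u *\<^sub>R b" using ab(3) by (auto simp: in_segment)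
      \<comment> \<open>A proper average of two numbers at most \<open>c\<close> equals
        \<open>c\<close> only if both do. Applied to two bounding lines through \<open>e\<close>,
        this pins both ends of the segment.\<close>
      have sq: "s = c \<and> t = c" if "s \<le> c" "t \<le> c" "c = (1 - u) * s + u * t" for s t c :: real
      proof -
        have "(1 - u) * (c - s) + u * (c - t) = 0" using that(3) by (simp add: algebra_simps)
        moreover have "0 \<le> (1 - u) * (c - s)" "0 \<le> u * (c - t)" using that u by auto
        ultimately have "(1 - u) * (c - s) = 0" "u * (c - t) = 0" by linarith+
        then show ?thesis using u by simp
      qed
      have s: "fst a + snd a = S \<and> fst b + snd b = S"
      proof (rule sq)
        show "S = (1 - u) * (fst a + snd a) + u * (fst b + snd b)"
          using ab(4) u(3) by (auto simp: e1_def e2_def prod_eq_iff algebra_simps)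
      qed (use CP ab(1,2) in auto)
      show ?thesis
        using ab(4)
      proof
        assume e: "e = e1"
        have "fst a = A \<and> fst b = A"
          by (rule sq) (use CP ab(1,2) u(3) e in \<open>auto simp: e1_def prod_eq_iff\<close>)
        then show ?thesis using s e by (auto simp: e1_def prod_eq_iff)
      next
        assume e: "e = e2"
        have "snd a = B \<and> snd b = B"
          by (rule sq) (use CP ab(1,2) u(3) e in \<open>auto simp: e2_def prod_eq_iff\<close>)
        then show ?thesis using s e by (auto simp: e2_def prod_eq_iff)
      qed
    qed
    show "e1 extreme_point_of C" "e2 extreme_point_of C"
      unfolding extreme_point_of_def using eC * by (metis Diff_iff insertCI open_segment_def)+
  qed
  have mx: "compwise_maximal C e1" "compwise_maximal C e2"
    unfolding compwise_maximal_def using eC CP by (force simp: e1_def e2_def prod_eq_iff)+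
  show "z extreme_point_of C \<and> compwise_maximal C z \<longleftrightarrow> z = e1 \<or> z = e2"
  proof
    assume z: "z extreme_point_of C \<and> compwise_maximal C z"
    then have zC: "z \<in> C" by (simp add: extreme_point_of_def)
    obtain y where y: "y \<in> closed_segment e1 e2" "fst z \<le> fst y" "snd z \<le> snd y" using dom[OF zC] by blast
    then have "y = z" using z seg by (auto simp: compwise_maximal_def)
    then have "z \<notin> open_segment e1 e2" using z eC by (auto simp: extreme_point_of_def)
    then show "z = e1 \<or> z = e2" using y(1) \<open>y = z\<close> by (auto simp: open_segment_def)
  qed (use ext mx in auto)
  assume w: "0 \<le> fst w" "0 \<le> snd w"
  show "(SUP z\<in>C. w \<bullet> z) = max (w \<bullet> e1) (w \<bullet> e2)"
  proof (rule cSup_eq_maximum)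
    show "max (w \<bullet> e1) (w \<bullet> e2) \<in> (\<bullet>) w ` C" using eC by (auto simp: max_def)
    fix r assume "r \<in> (\<bullet>) w ` C"
    then obtain z where z: "z \<in> C" "r = w \<bullet> z" by auto
    obtain y where y: "y \<in> closed_segment e1 e2" "fst z \<le> fst y" "snd z \<le> snd y" using dom[OF z(1)] by blast
    have "r \<le> w \<bullet> y" using z(2) y w by (auto simp: inner_prod_def intro!: add_mono mult_left_mono)
    also obtain u where u: "0 \<le> u" "u \<le> 1" "y = (1 - u) *\<^sub>R e1 + u *\<^sub>R e2" using y(1) by (auto simp: in_segment)
    have "w \<bullet> y = (1 - u) * (w \<bullet> e1) + u * (w \<bullet> e2)" by (simp add: u(3) inner_add_right)
    also have "\<dots> \<le> (1 - u) * max (w \<bullet> e1) (w \<bullet> e2) + u * max (w \<bullet> e1) (w \<bullet> e2)"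
      using u by (intro add_mono mult_left_mono) auto
    also have "\<dots> = max (w \<bullet> e1) (w \<bullet> e2)" by (simp add: algebra_simps)
    finally show "r \<le> max (w \<bullet> e1) (w \<bullet> e2)" .
  qed
qed

section \<open>Submodularity and convexity\<close>

context polar begin

text \<open>The functionals at the two vertices differ by \<open>b * (fst v - snd v)\<close>, so for
  \<open>b > 0\<close> the cones are separated by the diagonal whatever the ranks are. For
  \<open>b = 0\<close> the two elements coincide with weight 1, written here as two halves.\<close>

lemma weighted_sum_Epq:
  assumes h: "chart F h" "p \<in> F" "q \<in> F"
  shows "(\<Sum>u \<in> {u \<in> Epq L p q. cone_weight (Cone L p q u) \<noteq> 0}. ereal (cone_weight (Cone L p q u)) * f u)
    = ereal (1/2) * f (ujoin F h p q) + ereal (1/2) * f (ujoin F h q p)"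
proof -
  let ?u = "ujoin F h p q" and ?u' = "ujoin F h q p"
  have L: "p \<in> L" "q \<in> L" using h chart_subset by auto
  have uL: "?u \<in> L" "?u' \<in> L" using ujoin(1)[OF h] ujoin(1)[OF h(1,3,2)] chart_subset[OF h(1)] by auto
  obtain a b c d where r: "rk L p = a + b + c" "rk L q = a + b + d" "rk L (meet L p q) = a"
    "rk L ?u = a + b + c + d" and b0: "b = 0 \<longleftrightarrow> ?u = ?u'"
    using rank_decomposition[OF h] by metis
  have ru': "rk L ?u' = a + b + c + d"
    using r(4) rk_chart[OF h(1) ujoin(1)[OF h]] rk_chart[OF h(1) ujoin(1)[OF h(1,3,2)]]
      nz_ujoin[OF h] nz_ujoin[OF h(1,3,2)] by (simp add: Un_commute)
  \<comment> \<open>Heights above the meet: \<open>A\<close> is that of \<open>p\<close>,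
    \<open>B\<close> that of \<open>q\<close>, and \<open>S\<close> that of both
    completions.\<close>
  define A where "A = real (b + c)"
  define B where "B = real (b + d)"
  define S where "S = real (b + c + d)"
  let ?e1 = "(A, S - A)" and ?e2 = "(S - B, B)"
  have rv: "rvec L p q w = (real (rk L (meet L w p)) - real a, real (rk L (meet L w q)) - real a)" for w
    using r(3) by (simp add: rvec_def)
  have I: "w \<in> L" "gd p w + gd w q = gd p q" "rk L w + a = rk L (meet L w p) + rk L (meet L w q)"
    if "w \<in> Ipq L p q" for w
    using that Ipq_iff[OF L] interval_rk[OF L, of w] r(3) by auto
  have IuL: "?u \<in> Ipq L p q" "?u' \<in> Ipq L p q"
    using Ipq_iff[OF L] uL ujoin_interval(1)[OF h] ujoin_interval(1)[OF h(1,3,2)] gd_commute L by auto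
  have mu: "meet L ?u p = p" "meet L ?u' q = q"
    using meet_le_eq[OF L(1) uL(1) ujoin_interval(2)[OF h]] meet_le_eq[OF L(2) uL(2) ujoin_interval(2)[OF h(1,3,2)]]
      meet_commute L uL by auto
  have rvu: "rvec L p q ?u = ?e1" "rvec L p q ?u' = ?e2"
    using I(3)[OF IuL(1)] I(3)[OF IuL(2)] r ru' mu by (simp_all add: rv A_def B_def S_def)
  have V: "\<forall>z\<in>rvec L p q ` Ipq L p q. fst z \<le> A \<and> snd z \<le> B \<and> fst z + snd z \<le> S"
  proof
    fix z assume z: "z \<in> rvec L p q ` Ipq L p q"
    obtain w where w: "w \<in> Ipq L p q" "z = rvec L p q w" using z by blast
    note Iw = I[OF w(1)]
    have "rk L (meet L w p) \<le> rk L p" "rk L (meet L w q) \<le> rk L q"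
      using rk_mono[OF meet_in L(1) meet_le2] rk_mono[OF meet_in L(2) meet_le2] Iw(1) L by auto
    moreover have "rk L w \<le> rk L ?u" by (rule interval_rk_le[OF h Iw(1,2)])
    ultimately show "fst z \<le> A \<and> snd z \<le> B \<and> fst z + snd z \<le> S"
      using w(2) Iw(3) r by (simp add: rv A_def B_def S_def)
  qed
  have eV: "?e1 \<in> rvec L p q ` Ipq L p q" "?e2 \<in> rvec L p q ` Ipq L p q"
    using IuL rvu by (metis imageI)+
  have SAB: "S \<le> A + B" by (simp add: S_def A_def B_def)
  note pent = pentagon[OF V eV SAB, folded ConvI_def]
  \<comment> \<open>Attaining the bound in the first coordinate means lying above \<open>p\<close>,
    and the sum of the coordinates gives the top rank, so the vertex has only one preimage in the
    interval.\<close>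
  have E1: "w = ?u" if w: "w \<in> Ipq L p q" "rvec L p q w = ?e1" for w
  proof (rule interval_top_unique[OF h I(1,2)[OF w(1)]])
    have m: "rk L (meet L w p) = rk L p" using w(2) r by (simp add: rv A_def)
    have "meet L w p = p"
      by (rule rk_eq_imp_eq[OF meet_in L(1) meet_le2 m]) (use I(1)[OF w(1)] L in auto)
    then show "p \<le> w" using meet_le1[OF I(1)[OF w(1)] L(1)] by simp
    show "rk L w = rk L ?u" using w(2) I(3)[OF w(1)] r by (simp add: rv A_def S_def)
  qed
  have E2: "w = ?u'" if w: "w \<in> Ipq L p q" "rvec L p q w = ?e2" for w
  proof (rule interval_top_unique[OF h(1,3,2) I(1)[OF w(1)]])
    show "gd q w + gd w p = gd q p" using I(1,2)[OF w(1)] gd_commute L by auto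
    have m: "rk L (meet L w q) = rk L q" using w(2) r by (simp add: rv B_def)
    have "meet L w q = q"
      by (rule rk_eq_imp_eq[OF meet_in L(2) meet_le2 m]) (use I(1)[OF w(1)] L in auto)
    then show "q \<le> w" using meet_le1[OF I(1)[OF w(1)] L(2)] by simp
    show "rk L w = rk L ?u'" using w(2) I(3)[OF w(1)] r ru' by (simp add: rv B_def S_def)
  qed
  have "w \<in> Epq L p q \<longleftrightarrow> w \<in> {?u, ?u'}" for w
    unfolding Epq_def mem_Collect_eq pent(1) insert_iff empty_iff using E1 E2 IuL rvu by metis
  then have Epq: "Epq L p q = {?u, ?u'}" by (rule set_eqI)
  have cone: "Cone L p q w = {v. 0 \<le> fst v \<and> 0 \<le> snd v \<and> v \<bullet> rvec L p q w = max (v \<bullet> ?e1) (v \<bullet> ?e2)}" for w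
    unfolding Cone_def using pent(2) by auto
  have diff: "v \<bullet> ?e1 - v \<bullet> ?e2 = real b * (fst v - snd v)" for v :: "real \<times> real"
    by (simp add: inner_prod_def A_def B_def S_def algebra_simps)
  show ?thesis
  proof (cases "b = 0")
    case True
    then have uu: "?u' = ?u" using b0 by simp
    have "?e1 = ?e2" using True by (simp add: A_def B_def S_def)
    then have "Cone L p q ?u = {w. 0 \<le> fst w \<and> 0 \<le> snd w}" unfolding cone rvu by simp
    then have "cone_weight (Cone L p q ?u) = 1" by (simp add: cone_weight_quadrant)
    then have "(\<Sum>u \<in> {u \<in> Epq L p q. cone_weight (Cone L p q u) \<noteq> 0}. ereal (cone_weight (Cone L p q u)) * f u) = f ?u"
      unfolding Epq uu by (simp add: Collect_conv_if one_ereal_def[symmetric])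
    also have "\<dots> = ereal (1/2) * f ?u + ereal (1/2) * f ?u"
      by (cases "f ?u") auto
    finally show ?thesis by (simp only: uu)
  next
    case False
    then have bp: "real b > 0" and ne: "?u \<noteq> ?u'" using b0 by auto
    have "v \<bullet> ?e1 = max (v \<bullet> ?e1) (v \<bullet> ?e2) \<longleftrightarrow> snd v \<le> fst v"
      "v \<bullet> ?e2 = max (v \<bullet> ?e1) (v \<bullet> ?e2) \<longleftrightarrow> fst v \<le> snd v" for v :: "real \<times> real"
    proof -
      have "v \<bullet> ?e2 \<le> v \<bullet> ?e1 \<longleftrightarrow> snd v \<le> fst v" "v \<bullet> ?e1 \<le> v \<bullet> ?e2 \<longleftrightarrow> fst v \<le> snd v"
        using diff[of v] bp zero_le_mult_iff[of "real b" "fst v - snd v"] mult_le_0_iff[of "real b" "fst v - snd v"]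
        by auto
      then show "v \<bullet> ?e1 = max (v \<bullet> ?e1) (v \<bullet> ?e2) \<longleftrightarrow> snd v \<le> fst v"
        "v \<bullet> ?e2 = max (v \<bullet> ?e1) (v \<bullet> ?e2) \<longleftrightarrow> fst v \<le> snd v" by linarith+
    qed
    then have cw: "cone_weight (Cone L p q ?u) = 1/2" "cone_weight (Cone L p q ?u') = 1/2"
      unfolding cone rvu by (simp_all add: cone_weight_below_diagonal cone_weight_above_diagonal)
    then have supp: "{u \<in> Epq L p q. cone_weight (Cone L p q u) \<noteq> 0} = {?u, ?u'}"
      unfolding Epq by auto
    have "sum g {?u, ?u'} = g ?u + g ?u'" for g :: "'a \<Rightarrow> ereal" using ne by simp
    then show ?thesis unfolding supp by (simp only: cw)
  qed
qed

section \<open>Submodularity, bisubmodularity and convexity\<close>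

definition ujoin_submodular_on :: "'a set \<Rightarrow> ('a \<Rightarrow> nat \<Rightarrow> int) \<Rightarrow> ('a \<Rightarrow> ereal) \<Rightarrow> bool" where
  "ujoin_submodular_on F h f \<longleftrightarrow> (\<forall>p\<in>F. \<forall>q\<in>F.
     f (meet L p q) + (ereal (1/2) * f (ujoin F h p q) + ereal (1/2) * f (ujoin F h q p)) \<le> f p + f q)"

lemma submodular_iff_ujoin: "submodular L f \<longleftrightarrow> (\<forall>F h. chart F h \<longrightarrow> ujoin_submodular_on F h f)"
proof
  assume s: "submodular L f"
  show "\<forall>F h. chart F h \<longrightarrow> ujoin_submodular_on F h f"
    unfolding ujoin_submodular_on_def
  proof (intro allI impI ballI)
    fix F h p q assume h: "chart F h" "p \<in> F" "q \<in> F"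
    then have "p \<in> L" "q \<in> L" using chart_subset by auto
    then show "f (meet L p q) + (ereal (1/2) * f (ujoin F h p q) + ereal (1/2) * f (ujoin F h q p)) \<le> f p + f q"
      using s unfolding submodular_def weighted_sum_Epq[OF h, of f, symmetric] by blast
  qed
next
  assume u: "\<forall>F h. chart F h \<longrightarrow> ujoin_submodular_on F h f"
  show "submodular L f"
    unfolding submodular_def
  proof (intro ballI)
    fix p q assume "p \<in> L" "q \<in> L"
    then obtain F h where h: "chart F h" "p \<in> F" "q \<in> F" using ex_chart_points by blast
    show "f (meet L p q) + (\<Sum>u \<in> {u \<in> Epq L p q. cone_weight (Cone L p q u) \<noteq> 0}.
           ereal (cone_weight (Cone L p q u)) * f u) \<le> f p + f q"
      unfolding weighted_sum_Epq[OF h] using u h by (auto simp: ujoin_submodular_on_def)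
  qed
qed

lemma chart_eqI: "chart F h \<Longrightarrow> p \<in> F \<Longrightarrow> q \<in> F \<Longrightarrow> (\<And>i. h p i = h q i) \<Longrightarrow> p = q"
  using chart_inj[of F h p q] by auto

text \<open>The inequality for the pair \<open>?u\<close>, \<open>?u'\<close> has \<open>?j\<close>
  as its meet and reproduces \<open>?u\<close> and \<open>?u'\<close> as completions, so it bounds
  \<open>f ?j\<close> by the mean of \<open>f ?u\<close> and \<open>f ?u'\<close>. This is inserted
  into the inequality for \<open>p\<close> and \<open>q\<close>.\<close>

lemma ujoin_submodular_imp_bisubmodular:
  assumes h: "chart F h" and f: "\<forall>p\<in>L. f p \<noteq> -\<infinity>" and us: "ujoin_submodular_on F h f"
  shows "bisubmodular_on F h f"
  unfolding bisubmodular_on_def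
proof (intro ballI)
  fix p q assume pq: "p \<in> F" "q \<in> F"
  let ?u = "ujoin F h p q" and ?u' = "ujoin F h q p" and ?j = "bjoin F h p q"
  have FL: "F \<subseteq> L" by (rule chart_subset[OF h])
  have mF: "meet L p q \<in> F" if "p \<in> F" "q \<in> F" for p q using frame_meet that h by (auto simp: chart_def)
  note u = ujoin[OF h pq] and u' = ujoin[OF h pq(2,1)] and j = bjoin[OF h pq]
  have "meet L ?u ?u' = ?j"
    by (rule chart_eqI[OF h mF[OF u(1) u'(1)] j(1)]) (auto simp: chart_meet[OF h u(1) u'(1)] u u' j)
  moreover have "ujoin F h ?u ?u' = ?u"
    by (rule chart_eqI[OF h ujoin(1)[OF h u(1) u'(1)] u(1)]) (auto simp: ujoin(2)[OF h u(1) u'(1)] u(2) u'(2))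
  moreover have "ujoin F h ?u' ?u = ?u'"
    by (rule chart_eqI[OF h ujoin(1)[OF h u'(1) u(1)] u'(1)]) (auto simp: ujoin(2)[OF h u'(1) u(1)] u(2) u'(2))
  ultimately have 1: "f ?j + (ereal (1/2) * f ?u + ereal (1/2) * f ?u') \<le> f ?u + f ?u'"
    using us u(1) u'(1) unfolding ujoin_submodular_on_def by metis
  have "f ?j \<le> ereal (1/2) * f ?u + ereal (1/2) * f ?u'"
  proof -
    have "f ?j \<noteq> -\<infinity>" "f ?u \<noteq> -\<infinity>" "f ?u' \<noteq> -\<infinity>" using f FL j(1) u(1) u'(1) by auto
    then show ?thesis using 1 by (cases "f ?j"; cases "f ?u"; cases "f ?u'") auto
  qed
  then have "f (meet L p q) + f ?j \<le> f (meet L p q) + (ereal (1/2) * f ?u + ereal (1/2) * f ?u')"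
    by (rule add_left_mono)
  also have "\<dots> \<le> f p + f q" using us pq by (auto simp: ujoin_submodular_on_def)
  finally show "f (meet L p q) + f ?j \<le> f p + f q" .
qed

text \<open>Bisubmodularity is applied to the pairs \<open>p, ?j\<close> and \<open>q, ?j\<close>
  and \<open>?x, ?y\<close>. In the sum \<open>?x\<close> and \<open>?y\<close> cancel, leaving
  \<open>f ?m + f ?u + f ?u' \<le> f p + f q + f ?j\<close>. Adding the inequality for
  \<open>p, q\<close> removes \<open>f ?j\<close>, and halving gives the claim.\<close>

lemma bisubmodular_imp_ujoin_submodular:
  assumes h: "chart F h" and f: "\<forall>p\<in>L. f p \<noteq> -\<infinity>" and bs: "bisubmodular_on F h f"
  shows "ujoin_submodular_on F h f"
  unfolding ujoin_submodular_on_def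
proof (intro ballI)
  fix p q assume pq: "p \<in> F" "q \<in> F"
  let ?u = "ujoin F h p q" and ?u' = "ujoin F h q p" and ?j = "bjoin F h p q" and ?m = "meet L p q"
  have FL: "F \<subseteq> L" by (rule chart_subset[OF h])
  have mF: "meet L p q \<in> F" if "p \<in> F" "q \<in> F" for p q using frame_meet that h by (auto simp: chart_def)
  note u = ujoin[OF h pq] and u' = ujoin[OF h pq(2,1)] and j = bjoin[OF h pq]
  let ?x = "meet L p ?j" and ?y = "meet L q ?j"
  have xF: "?x \<in> F" "?y \<in> F" "?m \<in> F" using mF pq j(1) by auto
  have bs': "f (meet L a b) + f (bjoin F h a b) \<le> f a + f b" if "a \<in> F" "b \<in> F" for a b
    using bs that by (auto simp: bisubmodular_on_def)
  note bj = bjoin[OF h pq(1) j(1)] bjoin[OF h pq(2) j(1)] bjoin[OF h xF(1,2)]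
  note mt = chart_meet[OF h pq(1) j(1)] chart_meet[OF h pq(2) j(1)] chart_meet[OF h pq] chart_meet[OF h xF(1,2)]
  have e1: "bjoin F h p ?j = ?u" by (rule chart_eqI[OF h bj(1) u(1)]) (simp add: bj u(2) j(2))
  have e2: "bjoin F h q ?j = ?u'" by (rule chart_eqI[OF h bj(3) u'(1)]) (auto simp: bj u'(2) j(2))
  have e3: "meet L ?x ?y = ?m" by (rule chart_eqI[OF h mF[OF xF(1,2)] xF(3)]) (auto simp: mt j(2))
  have e4: "bjoin F h ?x ?y = ?j" by (rule chart_eqI[OF h bj(5) j(1)]) (auto simp: bj(6) mt j(2))
  have i1: "f ?x + f ?u \<le> f p + f ?j" using bs'[OF pq(1) j(1)] e1 by simp
  have i2: "f ?y + f ?u' \<le> f q + f ?j" using bs'[OF pq(2) j(1)] e2 by simp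
  have i3: "f ?m + f ?j \<le> f ?x + f ?y" using bs'[OF xF(1,2)] e3 e4 by simp
  have i4: "f ?m + f ?j \<le> f p + f q" by (rule bs'[OF pq])
  have nm: "f a \<noteq> -\<infinity>" if "a \<in> F" for a using f FL that by auto
  show "f ?m + (ereal (1/2) * f ?u + ereal (1/2) * f ?u') \<le> f p + f q"
  \<comment> \<open>Cancellation requires finite values. From finite \<open>f p\<close> and
    \<open>f q\<close> the inequalities pass finiteness on, to \<open>?m\<close> and
    \<open>?j\<close> first and from there to the rest.\<close>
  proof (cases "f p = \<infinity> \<or> f q = \<infinity>")
    case False
    then obtain P Q where PQ: "f p = ereal P" "f q = ereal Q"
      using nm[OF pq(1)] nm[OF pq(2)] by (cases "f p"; cases "f q") auto
    then obtain M J where MJ: "f ?m = ereal M" "f ?j = ereal J"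
      using i4 nm[OF xF(3)] nm[OF j(1)] by (cases "f ?m"; cases "f ?j") auto
    then obtain X U where XU: "f ?x = ereal X" "f ?u = ereal U"
      using i1 PQ nm[OF xF(1)] nm[OF u(1)] by (cases "f ?x"; cases "f ?u") auto
    obtain Y U' where YU: "f ?y = ereal Y" "f ?u' = ereal U'"
      using i2 PQ MJ nm[OF xF(2)] nm[OF u'(1)] by (cases "f ?y"; cases "f ?u'") auto
    show ?thesis using i1 i2 i3 i4 unfolding PQ MJ XU YU by simp
  qed auto
qed

text \<open>As vectors, \<open>p\<close> plus \<open>q\<close> equals meet plus bjoin, so the
  midpoint of the geodesic from \<open>p\<close> to \<open>q\<close> is the midpoint of the edge
  from the meet to the bjoin. Convexity there is half the bisubmodular inequality.\<close>

lemma K_convex_imp_bisubmodular: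
  assumes h: "chart F h" and f: "\<forall>p\<in>L. f p \<noteq> -\<infinity>" and cv: "K_convex n L (lovasz f)"
  shows "bisubmodular_on F h f"
  unfolding bisubmodular_on_def
proof (intro ballI)
  fix p q assume pq: "p \<in> F" "q \<in> F"
  have FL: "F \<subseteq> L" by (rule chart_subset[OF h])
  have L: "p \<in> L" "q \<in> L" using FL pq by auto
  let ?j = "bjoin F h p q" and ?m = "meet L p q"
  have mj: "?m \<in> F" "?j \<in> F" using frame_meet pq h bjoin(1)[OF h pq] by (auto simp: chart_def)
  have le: "?m \<le> ?j"
    using chart_le[OF h mj] bjoin(2)[OF h pq] chart_meet[OF h pq] by (auto simp: S2_le_def)
  \<comment> \<open>Written with two point masses so that it also covers coinciding meet and bjoin,
    for instance for opposite \<open>p\<close> and \<open>q\<close>.\<close>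
  define y where "y x = (1/2) * dirac ?m x + (1/2) * dirac ?j x" for x
  have sy: "supp y = {?m, ?j}" by (auto simp: supp_def y_def dirac_def)
  have yK: "y \<in> Kpts L"
  proof -
    have "is_chain L {?m, ?j}" using is_chain_pair le mj FL by blast
    moreover have "sum y {?m, ?j} = 1" by (cases "?m = ?j") (auto simp: y_def dirac_def)
    ultimately show ?thesis by (auto simp: Kpts_def sy) (simp add: y_def dirac_def)
  qed
  have ysum: "(\<Sum>x\<in>supp y. y x * g x) = (1/2) * g ?m + (1/2) * g ?j" for g :: "'a \<Rightarrow> real"
    unfolding sy by (cases "?m = ?j") (auto simp: y_def dirac_def)
  have ly: "lovasz f y = ereal (1/2) * f ?m + ereal (1/2) * f ?j"
  proof (cases "?m = ?j")
    case True
    then show ?thesis unfolding lovasz_def sy by (cases "f ?j") (auto simp: y_def dirac_def)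
  next
    case False
    then show ?thesis unfolding lovasz_def sy by (simp add: y_def dirac_def)
  qed
  obtain \<gamma> where \<gamma>: "geodesic n L \<gamma>" "\<gamma> 0 = dirac p" "\<gamma> 1 = dirac q"
    by (rule ex_geodesic[OF h dirac_Kpts[OF L(1)] _ dirac_Kpts[OF L(2)]]) (use pq in auto)
  have half: "(1/2::real) \<in> {0..1}" by simp
  have F: "supp (\<gamma> 0) \<subseteq> F" "supp (\<gamma> 1) \<subseteq> F" using \<gamma> pq by auto
  have g: "supp (\<gamma> (1/2)) \<subseteq> F" "pos h (\<gamma> (1/2)) i = (1/2) * real_of_int (h p i) + (1/2) * real_of_int (h q i)" for i
    using geodesic_in_frame[OF h \<gamma>(1) F half] \<gamma>(2,3) by simp_all
  have "\<gamma> (1/2) = y"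
  proof (rule pos_inj[OF chart_embeds[OF h] _ g(1) yK])
    show "\<gamma> (1/2) \<in> Kpts L" using \<gamma>(1) unfolding geodesic_def by simp
    show "supp y \<subseteq> F" using sy mj by simp
    fix i
    have "real_of_int (h p i) + real_of_int (h q i) = real_of_int (h ?m i) + real_of_int (h ?j i)"
      using meet_bjoin_sum[OF h pq, of i] by (simp flip: of_int_add)
    then show "pos h (\<gamma> (1/2)) i = pos h y i"
      unfolding g(2) pos_def[of h y] ysum by simp
  qed
  moreover have "lovasz f (\<gamma> (1/2)) \<le> ereal (1 - 1/2) * lovasz f (\<gamma> 0) + ereal (1/2) * lovasz f (\<gamma> 1)"
    using cv \<gamma>(1) half unfolding K_convex_def by blast
  ultimately have "ereal (1/2) * f ?m + ereal (1/2) * f ?j \<le> ereal (1/2) * f p + ereal (1/2) * f q"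
    using ly \<gamma> by simp
  moreover have "f p \<noteq> -\<infinity>" "f q \<noteq> -\<infinity>" "f ?m \<noteq> -\<infinity>" "f ?j \<noteq> -\<infinity>" using f L mj FL by auto
  ultimately show "f ?m + f ?j \<le> f p + f q"
    by (cases "f p"; cases "f q"; cases "f ?m"; cases "f ?j") auto
qed

text \<open>A geodesic stays in any frame containing its two ends, so convexity along segments of
  single frames is enough.\<close>

lemma bisubmodular_imp_K_convex:
  assumes f: "\<forall>p\<in>L. f p \<noteq> -\<infinity>" and bs: "\<And>F h. chart F h \<Longrightarrow> bisubmodular_on F h f"
  shows "K_convex n L (lovasz f)"
  unfolding K_convex_def
proof (intro allI impI ballI)
  fix \<gamma> and t :: real assume \<gamma>: "geodesic n L \<gamma>" and t: "t \<in> {0..1}"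
  have K: "\<gamma> s \<in> Kpts L" if "s \<in> {0..1}" for s using \<gamma> that unfolding geodesic_def by blast
  have K01: "\<gamma> 0 \<in> Kpts L" "\<gamma> 1 \<in> Kpts L" using K by auto
  obtain F h where h: "chart F h" "supp (\<gamma> 0) \<subseteq> F" "supp (\<gamma> 1) \<subseteq> F" by (rule ex_chart_Kpts[OF K01])
  note g = geodesic_in_frame[OF h(1) \<gamma> h(2,3) t]
  show "lovasz f (\<gamma> t) \<le> ereal (1 - t) * lovasz f (\<gamma> 0) + ereal t * lovasz f (\<gamma> 1)"
    by (rule lovasz_convex_on_frame[OF h(1) f bs[OF h(1)] K01(1) h(2) K01(2) h(3) K[OF t] g(1)])
      (use t g(2) in auto)
qed

theorem submodular_iff_K_convex:
  assumes f: "\<forall>p\<in>L. f p \<noteq> -\<infinity>"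
  shows "submodular L f \<longleftrightarrow> K_convex n L (lovasz f)"
  unfolding submodular_iff_ujoin
  using ujoin_submodular_imp_bisubmodular[OF _ f] bisubmodular_imp_ujoin_submodular[OF _ f]
    K_convex_imp_bisubmodular[OF _ f] bisubmodular_imp_K_convex[OF f] by blast

end

theorem theorem3p11:
  fixes L :: "'a::order set" and n :: nat and f :: "'a \<Rightarrow> ereal"
  assumes "polar_space L n"
    and "\<forall>p\<in>L. f p \<noteq> -\<infinity>"
  shows "submodular L f \<longleftrightarrow> K_convex n L (lovasz f)"
proof -
  obtain Fs where "polar_space_frames L n Fs" using assms(1) by (auto simp: polar_space_def)
  then interpret polar L n Fs by unfold_locales
  show ?thesis by (rule submodular_iff_K_convex[OF assms(2)])
qed

end
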